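(* One has the following commutative diagram of linear extensions. There is a short exact sequence of bifunctors $0\to D^\sim\xrightarrow{\rho}D^\approx\to\tilde D\to0$, and there are linear extensions of categories $$0\to D^\sim\to\mathbf{Niq}\to\mathbf{Niq}^\sim\to0,\qquad 0\to D^\approx\to\mathbf{Niq}\to\mathbf{Niq}^\approx\to0,\qquad 0\to\tilde D\to\mathbf{Niq}^\sim\to\mathbf{Niq}^\approx\to0,$$ where the functors are the quotient functors. These fit together compatibly: the quotient functor $\mathbf{Niq}\to\mathbf{Niq}^\approx$ is the composite $\mathbf{Niq}\to\mathbf{Niq}^\sim\to\mathbf{Niq}^\approx$, the action of $D^\sim$ on $\mathbf{Niq}$ is the restriction of the action of $D^\approx$ along $\rho$, and the action of $\tilde D$ on $\mathbf{Niq}^\sim$ is induced by the action of $D^\approx$ on $\mathbf{Niq}$. In particular $\mathbf{Niq}^\approx$ is also an additive category, and the quotient functors $\mathbf{Niq}\to\mathbf{Niq}^\sim\to\mathbf{Niq}^\approx$ reflect isomorphisms and yield bijections on isomorphism classes of objects.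
   Context: Groups are written additively; $[a,b]=-a-b+a+b$. A nil$_2$-group is a group $G$ with $[[G,G],G]=0$; $G^{\mathrm{ab}}=G/[G,G]$, and $\hat g$ is the class of $g\in G$ in $G^{\mathrm{ab}}$. For a map $f:G\to H$ put $(a\mid b)_f:=-(f(a)+f(b))+f(a+b)$. The map $f$ is weakly quadratic if for all $a,b,c\in G$ the element $(a\mid b)_f$ commutes with $f(c)$ and is additive in $a$ and in $b$; it is quadratic if moreover $(a\mid b)_f$ is central in $H$. $\mathsf{Quad}(G,H)$ is the set of quadratic maps (an abelian group under pointwise addition when $H$ is abelian). A q-map is a weakly quadratic map $f:G\to H$ between nil$_2$-groups with $(a\mid b)_f\in[H,H]$ for all $a,b$. $\mathbf{Niq}$ is the category of nil$_2$-groups and q-maps. A q-map $f:G\to H$ induces a homomorphism $f^{\mathrm{ab}}:G^{\mathrm{ab}}\to H^{\mathrm{ab}}$ and restricts to a homomorphism $[f,f]:[G,G]\to[H,H]$. For a homomorphism $\alpha:G^{\mathrm{ab}}\otimes G^{\mathrm{ab}}\to[H,H]$ and a q-map $f:G\to H$, $f+\alpha$ is the q-map $g\mapsto f(g)+\alpha(\hat g,\hat g)$. For q-maps $f,g:G\to H$: $f\sim g$ means $g=f+\alpha$ for some such $\alpha$; $f\approx g$ means $f^{\mathrm{ab}}=g^{\mathrm{ab}}$ and $[f,f]=[g,g]$. $\mathbf{Niq}^\sim$ and $\mathbf{Niq}^\approx$ are the quotient categories of $\mathbf{Niq}$ (same objects) by $\sim$ and $\approx$; since $f\sim g$ implies $f\approx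 g$, $\mathbf{Niq}\to\mathbf{Niq}^\approx$ factors through $\mathbf{Niq}^\sim$. Bifunctors $(\mathbf{Niq}^\approx)^{\mathrm{op}}\times\mathbf{Niq}^\approx\to\mathbf{Ab}$ (regarded also as bifunctors on $\mathbf{Niq}^\sim$ and $\mathbf{Niq}$ via the quotient functors; functorial through $f^{\mathrm{ab}}$ and $[f,f]$): $D^\sim(G,H)$ is the quotient of $\mathrm{Hom}(G^{\mathrm{ab}}\otimes G^{\mathrm{ab}},[H,H])$ by the subgroup of those $\alpha$ with $\alpha(\hat x,\hat x)=0$ for all $x\in G$; $D^\approx(G,H)=\mathsf{Quad}(G^{\mathrm{ab}},[H,H])$; $\rho:D^\sim\to D^\approx$ is the monomorphism $\rho(\alpha)(\hat x)=\alpha(\hat x,\hat x)$; $\tilde D=\mathrm{Coker}(\rho)$. The group $D^\sim(G,H)$ acts on q-maps by $(f,\alpha)\mapsto f+\alpha$, and $D^\approx(G,H)$ by $(f,h)\mapsto (x\mapsto f(x)+h(\hat x))$. A linear extension of a category $\mathbf C$ by a bifunctor $D:\mathbf C^{\mathrm{op}}\times\mathbf C\to\mathbf{Ab}$, written $0\to D\to\mathbf E\xrightarrow{P}\mathbf C\to0$, is a full functor $P:\mathbf E\to\mathbf C$ which is the identity on objects, together with, for all objects $i,j$, an action $(\alpha,a)\mapsto\alpha+a$ of the abelian group $D(i,j)$ on the set $\mathrm{Hom}_{\mathbf E}(i,j)$ which is transitive and free on each fibre of $P:\mathrm{Hom}_{\mathbf E}(i,j)\to\mathrm{Hom}_{\mathbf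 C}(i,j)$ (the fibres being preserved), satisfying $(\alpha+a)(\beta+b)=\alpha\beta+P(\alpha)_*b+P(\beta)^*a$ for composable $\alpha,\beta$. Set-theoretic size issues are disregarded. *)

theory Defs
  imports
    "HOL-Algebra.Generated_Groups"
    "HOL-Algebra.Group_Action"
    "HOL-Algebra.Free_Abelian_Groups"
begin

section \<open>Categories, functors, bifunctors\<close>

text \<open>The sets \<open>Hom C i j\<close> for different pairs of objects need not be disjoint, so composition and
  the other operations take their objects as arguments: \<open>Comp C i j k g f\<close> is the composite of
  \<open>f : i \<rightarrow> j\<close> and \<open>g : j \<rightarrow> k\<close>.\<close>

record ('o, 'm) cat =
  Obj :: "'o set"
  Hom :: "'o \<Rightarrow> 'o \<Rightarrow> 'm set"
  Ident :: "'o \<Rightarrow> 'm"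
  Comp :: "'o \<Rightarrow> 'o \<Rightarrow> 'o \<Rightarrow> 'm \<Rightarrow> 'm \<Rightarrow> 'm"

definition category :: "('o, 'm) cat \<Rightarrow> bool" where
  "category C \<longleftrightarrow>
     (\<forall>i\<in>Obj C. Ident C i \<in> Hom C i i) \<and>
     (\<forall>i\<in>Obj C. \<forall>j\<in>Obj C. \<forall>k\<in>Obj C. \<forall>f\<in>Hom C i j. \<forall>g\<in>Hom C j k.
        Comp C i j k g f \<in> Hom C i k) \<and>
     (\<forall>i\<in>Obj C. \<forall>j\<in>Obj C. \<forall>f\<in>Hom C i j.
        Comp C i i j f (Ident C i) = f \<and> Comp C i j j (Ident C j) f = f) \<and>
     (\<forall>i\<in>Obj C. \<forall>j\<in>Obj C. \<forall>k\<in>Obj C. \<forall>l\<in>Obj C.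
        \<forall>f\<in>Hom C i j. \<forall>g\<in>Hom C j k. \<forall>h\<in>Hom C k l.
        Comp C i k l h (Comp C i j k g f) = Comp C i j l (Comp C j k l h g) f)"

record ('o, 'm, 'p, 'n) func =
  on_obj :: "'o \<Rightarrow> 'p"
  on_hom :: "'o \<Rightarrow> 'o \<Rightarrow> 'm \<Rightarrow> 'n"

definition is_functor :: "('o, 'm) cat \<Rightarrow> ('p, 'n) cat \<Rightarrow> ('o, 'm, 'p, 'n) func \<Rightarrow> bool" where
  "is_functor C D P \<longleftrightarrow> category C \<and> category D \<and>
     (\<forall>i\<in>Obj C. on_obj P i \<in> Obj D) \<and>
     (\<forall>i\<in>Obj C. \<forall>j\<in>Obj C. \<forall>f\<in>Hom C i j.
        on_hom P i j f \<in> Hom D (on_obj P i) (on_obj P j)) \<and>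
     (\<forall>i\<in>Obj C. on_hom P i i (Ident C i) = Ident D (on_obj P i)) \<and>
     (\<forall>i\<in>Obj C. \<forall>j\<in>Obj C. \<forall>k\<in>Obj C. \<forall>f\<in>Hom C i j. \<forall>g\<in>Hom C j k.
        on_hom P i k (Comp C i j k g f)
          = Comp D (on_obj P i) (on_obj P j) (on_obj P k) (on_hom P j k g) (on_hom P i j f))"

definition full_functor :: "('o, 'm) cat \<Rightarrow> ('p, 'n) cat \<Rightarrow> ('o, 'm, 'p, 'n) func \<Rightarrow> bool" where
  "full_functor C D P \<longleftrightarrow> is_functor C D P \<and>
     (\<forall>i\<in>Obj C. \<forall>j\<in>Obj C. on_hom P i j ` Hom C i j = Hom D (on_obj P i) (on_obj P j))"

definition identity_on_objects ::
    "('o, 'm) cat \<Rightarrow> ('o, 'n) cat \<Rightarrow> ('o, 'm, 'o, 'n) func \<Rightarrow> bool" where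
  "identity_on_objects C D P \<longleftrightarrow> Obj C = Obj D \<and> (\<forall>i\<in>Obj C. on_obj P i = i)"

definition comp_func ::
    "('p, 'n, 'q, 'l) func \<Rightarrow> ('o, 'm, 'p, 'n) func \<Rightarrow> ('o, 'm, 'q, 'l) func" where
  "comp_func Q P =
     \<lparr>on_obj = (\<lambda>i. on_obj Q (on_obj P i)),
      on_hom = (\<lambda>i j f. on_hom Q (on_obj P i) (on_obj P j) (on_hom P i j f))\<rparr>"

definition same_functor ::
    "('o, 'm) cat \<Rightarrow> ('o, 'm, 'p, 'n) func \<Rightarrow> ('o, 'm, 'p, 'n) func \<Rightarrow> bool" where
  "same_functor C P Q \<longleftrightarrow>
     (\<forall>i\<in>Obj C. on_obj P i = on_obj Q i) \<and>
     (\<forall>i\<in>Obj C. \<forall>j\<in>Obj C. \<forall>f\<in>Hom C i j. on_hom P i j f = on_hom Q i j f)"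

text \<open>Quotient of a category by a relation on each of its Hom-sets. The morphisms of the quotient
  are equivalence classes.\<close>

definition quotient_cat ::
    "('o, 'm) cat \<Rightarrow> ('o \<Rightarrow> 'o \<Rightarrow> ('m \<times> 'm) set) \<Rightarrow> ('o, 'm set) cat" where
  "quotient_cat C R =
     \<lparr>Obj = Obj C,
      Hom = (\<lambda>i j. Hom C i j // R i j),
      Ident = (\<lambda>i. R i i `` {Ident C i}),
      Comp = (\<lambda>i j k B A. \<Union>g\<in>B. \<Union>f\<in>A. R i k `` {Comp C i j k g f})\<rparr>"

definition quotient_func :: "('o \<Rightarrow> 'o \<Rightarrow> ('m \<times> 'm) set) \<Rightarrow> ('o, 'm, 'o, 'm set) func" where
  "quotient_func R = \<lparr>on_obj = (\<lambda>i. i), on_hom = (\<lambda>i j f. R i j `` {f})\<rparr>"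

text \<open>The functor from the quotient by a finer relation to the quotient by a coarser relation \<open>S\<close>.\<close>

definition induced_quotient_func ::
    "('o \<Rightarrow> 'o \<Rightarrow> ('m \<times> 'm) set) \<Rightarrow> ('o, 'm set, 'o, 'm set) func" where
  "induced_quotient_func S =
     \<lparr>on_obj = (\<lambda>i. i), on_hom = (\<lambda>i j A. \<Union>f\<in>A. S i j `` {f})\<rparr>"

text \<open>Bifunctors \<open>C\<^sup>o\<^sup>p \<times> C \<rightarrow> Ab\<close>. For \<open>\<phi> : i' \<rightarrow> i\<close> and \<open>\<psi> : j \<rightarrow> j'\<close>, \<open>BMap D i j i' j' \<phi> \<psi>\<close> is the
  homomorphism \<open>D(\<phi>, \<psi>) : D(i, j) \<rightarrow> D(i', j')\<close>.\<close>

record ('o, 'm, 'd) bifunc =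
  BGrp :: "'o \<Rightarrow> 'o \<Rightarrow> 'd monoid"
  BMap :: "'o \<Rightarrow> 'o \<Rightarrow> 'o \<Rightarrow> 'o \<Rightarrow> 'm \<Rightarrow> 'm \<Rightarrow> 'd \<Rightarrow> 'd"

definition bifunctor :: "('o, 'm) cat \<Rightarrow> ('o, 'm, 'd) bifunc \<Rightarrow> bool" where
  "bifunctor C D \<longleftrightarrow> category C \<and>
     (\<forall>i\<in>Obj C. \<forall>j\<in>Obj C. comm_group (BGrp D i j)) \<and>
     (\<forall>i\<in>Obj C. \<forall>j\<in>Obj C. \<forall>i'\<in>Obj C. \<forall>j'\<in>Obj C. \<forall>\<phi>\<in>Hom C i' i. \<forall>\<psi>\<in>Hom C j j'.
        BMap D i j i' j' \<phi> \<psi> \<in> hom (BGrp D i j) (BGrp D i' j')) \<and>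
     (\<forall>i\<in>Obj C. \<forall>j\<in>Obj C. \<forall>d\<in>carrier (BGrp D i j).
        BMap D i j i j (Ident C i) (Ident C j) d = d) \<and>
     (\<forall>i\<in>Obj C. \<forall>j\<in>Obj C. \<forall>i'\<in>Obj C. \<forall>j'\<in>Obj C. \<forall>i''\<in>Obj C. \<forall>j''\<in>Obj C.
        \<forall>\<phi>\<in>Hom C i' i. \<forall>\<phi>'\<in>Hom C i'' i'. \<forall>\<psi>\<in>Hom C j j'. \<forall>\<psi>'\<in>Hom C j' j''.
        \<forall>d\<in>carrier (BGrp D i j).
        BMap D i j i'' j'' (Comp C i'' i' i \<phi> \<phi>') (Comp C j j' j'' \<psi>' \<psi>) d
          = BMap D i' j' i'' j'' \<phi>' \<psi>' (BMap D i j i' j' \<phi> \<psi> d))"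

definition pullback_bifunc ::
    "('o, 'm, 'p, 'n) func \<Rightarrow> ('p, 'n, 'd) bifunc \<Rightarrow> ('o, 'm, 'd) bifunc" where
  "pullback_bifunc P D =
     \<lparr>BGrp = (\<lambda>i j. BGrp D (on_obj P i) (on_obj P j)),
      BMap = (\<lambda>i j i' j' \<phi> \<psi>.
        BMap D (on_obj P i) (on_obj P j) (on_obj P i') (on_obj P j')
          (on_hom P i' i \<phi>) (on_hom P j j' \<psi>))\<rparr>"

definition natural_bifunc ::
    "('o, 'm) cat \<Rightarrow> ('o, 'm, 'd) bifunc \<Rightarrow> ('o, 'm, 'e) bifunc \<Rightarrow> ('o \<Rightarrow> 'o \<Rightarrow> 'd \<Rightarrow> 'e) \<Rightarrow> bool"
  where
  "natural_bifunc C D E \<tau> \<longleftrightarrow> bifunctor C D \<and> bifunctor C E \<and>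
     (\<forall>i\<in>Obj C. \<forall>j\<in>Obj C. \<tau> i j \<in> hom (BGrp D i j) (BGrp E i j)) \<and>
     (\<forall>i\<in>Obj C. \<forall>j\<in>Obj C. \<forall>i'\<in>Obj C. \<forall>j'\<in>Obj C. \<forall>\<phi>\<in>Hom C i' i. \<forall>\<psi>\<in>Hom C j j'.
        \<forall>d\<in>carrier (BGrp D i j).
        \<tau> i' j' (BMap D i j i' j' \<phi> \<psi> d) = BMap E i j i' j' \<phi> \<psi> (\<tau> i j d))"

definition short_exact_bifunc ::
    "('o, 'm) cat \<Rightarrow> ('o, 'm, 'd) bifunc \<Rightarrow> ('o, 'm, 'e) bifunc \<Rightarrow> ('o, 'm, 'f) bifunc \<Rightarrow>
     ('o \<Rightarrow> 'o \<Rightarrow> 'd \<Rightarrow> 'e) \<Rightarrow> ('o \<Rightarrow> 'o \<Rightarrow> 'e \<Rightarrow> 'f) \<Rightarrow> bool" where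
  "short_exact_bifunc C D E F \<sigma> \<tau> \<longleftrightarrow>
     natural_bifunc C D E \<sigma> \<and> natural_bifunc C E F \<tau> \<and>
     (\<forall>i\<in>Obj C. \<forall>j\<in>Obj C.
        inj_on (\<sigma> i j) (carrier (BGrp D i j)) \<and>
        \<sigma> i j ` carrier (BGrp D i j) = kernel (BGrp E i j) (BGrp F i j) (\<tau> i j) \<and>
        \<tau> i j ` carrier (BGrp E i j) = carrier (BGrp F i j))"

definition coker_bifunc ::
    "('o, 'm, 'd) bifunc \<Rightarrow> ('o, 'm, 'e) bifunc \<Rightarrow> ('o \<Rightarrow> 'o \<Rightarrow> 'd \<Rightarrow> 'e) \<Rightarrow> ('o, 'm, 'e set) bifunc"
  where
  "coker_bifunc D E \<sigma> =
     \<lparr>BGrp = (\<lambda>i j. BGrp E i j Mod (\<sigma> i j ` carrier (BGrp D i j))),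
      BMap = (\<lambda>i j i' j' \<phi> \<psi> X.
        \<Union>e\<in>X. (\<sigma> i' j' ` carrier (BGrp D i' j')) #>\<^bsub>BGrp E i' j'\<^esub> BMap E i j i' j' \<phi> \<psi> e)\<rparr>"

definition coker_proj ::
    "('o, 'm, 'd) bifunc \<Rightarrow> ('o, 'm, 'e) bifunc \<Rightarrow> ('o \<Rightarrow> 'o \<Rightarrow> 'd \<Rightarrow> 'e) \<Rightarrow>
     'o \<Rightarrow> 'o \<Rightarrow> 'e \<Rightarrow> 'e set" where
  "coker_proj D E \<sigma> i j e = (\<sigma> i j ` carrier (BGrp D i j)) #>\<^bsub>BGrp E i j\<^esub> e"


section \<open>Linear extensions\<close>

text \<open>\<open>act i j a \<alpha>\<close> is the morphism written \<open>\<alpha> + a\<close>, and \<open>\<alpha>\<^sub>*\<close>, \<open>\<beta>\<^sup>*\<close> are \<open>D(1, \<alpha>)\<close>, \<open>D(\<beta>, 1)\<close>.\<close>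

definition linear_extension ::
    "('o, 'n, 'd) bifunc \<Rightarrow> ('o, 'm) cat \<Rightarrow> ('o, 'n) cat \<Rightarrow> ('o, 'm, 'o, 'n) func \<Rightarrow>
     ('o \<Rightarrow> 'o \<Rightarrow> 'd \<Rightarrow> 'm \<Rightarrow> 'm) \<Rightarrow> bool" where
  "linear_extension D E C P act \<longleftrightarrow>
     bifunctor C D \<and> full_functor E C P \<and> identity_on_objects E C P \<and>
     (\<forall>i\<in>Obj E. \<forall>j\<in>Obj E. group_action (BGrp D i j) (Hom E i j) (act i j)) \<and>
     (\<forall>i\<in>Obj E. \<forall>j\<in>Obj E. \<forall>\<alpha>\<in>Hom E i j. \<forall>a\<in>carrier (BGrp D i j).
        on_hom P i j (act i j a \<alpha>) = on_hom P i j \<alpha>) \<and>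
     (\<forall>i\<in>Obj E. \<forall>j\<in>Obj E. \<forall>\<alpha>\<in>Hom E i j. \<forall>\<beta>\<in>Hom E i j.
        on_hom P i j \<alpha> = on_hom P i j \<beta> \<longrightarrow> (\<exists>a\<in>carrier (BGrp D i j). act i j a \<alpha> = \<beta>)) \<and>
     (\<forall>i\<in>Obj E. \<forall>j\<in>Obj E. \<forall>\<alpha>\<in>Hom E i j. \<forall>a\<in>carrier (BGrp D i j).
        act i j a \<alpha> = \<alpha> \<longrightarrow> a = \<one>\<^bsub>BGrp D i j\<^esub>) \<and>
     (\<forall>i\<in>Obj E. \<forall>j\<in>Obj E. \<forall>k\<in>Obj E. \<forall>\<alpha>\<in>Hom E j k. \<forall>\<beta>\<in>Hom E i j.
        \<forall>a\<in>carrier (BGrp D j k). \<forall>b\<in>carrier (BGrp D i j).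
        Comp E i j k (act j k a \<alpha>) (act i j b \<beta>)
          = act i k
              (BMap D i j i k (Ident C i) (on_hom P j k \<alpha>) b \<otimes>\<^bsub>BGrp D i k\<^esub>
               BMap D j k i k (on_hom P i j \<beta>) (Ident C k) a)
              (Comp E i j k \<alpha> \<beta>))"


section \<open>Isomorphisms and additive categories\<close>

definition iso_in :: "('o, 'm) cat \<Rightarrow> 'o \<Rightarrow> 'o \<Rightarrow> 'm \<Rightarrow> bool" where
  "iso_in C i j f \<longleftrightarrow> f \<in> Hom C i j \<and>
     (\<exists>g\<in>Hom C j i. Comp C i j i g f = Ident C i \<and> Comp C j i j f g = Ident C j)"

definition iso_rel :: "('o, 'm) cat \<Rightarrow> ('o \<times> 'o) set" where
  "iso_rel C = {(i, j). i \<in> Obj C \<and> j \<in> Obj C \<and> (\<exists>f. iso_in C i j f)}"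

definition reflects_isos :: "('o, 'm) cat \<Rightarrow> ('p, 'n) cat \<Rightarrow> ('o, 'm, 'p, 'n) func \<Rightarrow> bool" where
  "reflects_isos C D P \<longleftrightarrow>
     (\<forall>i\<in>Obj C. \<forall>j\<in>Obj C. \<forall>f\<in>Hom C i j.
        iso_in D (on_obj P i) (on_obj P j) (on_hom P i j f) \<longrightarrow> iso_in C i j f)"

definition bijective_on_iso_classes ::
    "('o, 'm) cat \<Rightarrow> ('p, 'n) cat \<Rightarrow> ('o, 'm, 'p, 'n) func \<Rightarrow> bool" where
  "bijective_on_iso_classes C D P \<longleftrightarrow>
     bij_betw (\<lambda>X. \<Union>i\<in>X. iso_rel D `` {on_obj P i}) (Obj C // iso_rel C) (Obj D // iso_rel D)"

text \<open>\<open>A i j\<close> is an abelian group structure on \<open>Hom C i j\<close>, written multiplicatively.\<close>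

definition preadditive :: "('o, 'm) cat \<Rightarrow> ('o \<Rightarrow> 'o \<Rightarrow> 'm monoid) \<Rightarrow> bool" where
  "preadditive C A \<longleftrightarrow> category C \<and>
     (\<forall>i\<in>Obj C. \<forall>j\<in>Obj C. comm_group (A i j) \<and> carrier (A i j) = Hom C i j) \<and>
     (\<forall>i\<in>Obj C. \<forall>j\<in>Obj C. \<forall>k\<in>Obj C. \<forall>f\<in>Hom C i j. \<forall>g\<in>Hom C j k. \<forall>g'\<in>Hom C j k.
        Comp C i j k (g \<otimes>\<^bsub>A j k\<^esub> g') f = Comp C i j k g f \<otimes>\<^bsub>A i k\<^esub> Comp C i j k g' f) \<and>
     (\<forall>i\<in>Obj C. \<forall>j\<in>Obj C. \<forall>k\<in>Obj C. \<forall>f\<in>Hom C i j. \<forall>f'\<in>Hom C i j. \<forall>g\<in>Hom C j k.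
        Comp C i j k g (f \<otimes>\<^bsub>A i j\<^esub> f') = Comp C i j k g f \<otimes>\<^bsub>A i k\<^esub> Comp C i j k g f')"

definition zero_object :: "('o, 'm) cat \<Rightarrow> 'o \<Rightarrow> bool" where
  "zero_object C z \<longleftrightarrow> z \<in> Obj C \<and>
     (\<forall>i\<in>Obj C. (\<exists>!f. f \<in> Hom C z i) \<and> (\<exists>!f. f \<in> Hom C i z))"

definition biproduct ::
    "('o, 'm) cat \<Rightarrow> ('o \<Rightarrow> 'o \<Rightarrow> 'm monoid) \<Rightarrow> 'o \<Rightarrow> 'o \<Rightarrow> 'o \<Rightarrow> 'm \<Rightarrow> 'm \<Rightarrow> 'm \<Rightarrow> 'm \<Rightarrow> bool" where
  "biproduct C A i j s in1 in2 pr1 pr2 \<longleftrightarrow>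
     s \<in> Obj C \<and> in1 \<in> Hom C i s \<and> in2 \<in> Hom C j s \<and> pr1 \<in> Hom C s i \<and> pr2 \<in> Hom C s j \<and>
     Comp C i s i pr1 in1 = Ident C i \<and> Comp C j s j pr2 in2 = Ident C j \<and>
     Comp C j s i pr1 in2 = \<one>\<^bsub>A j i\<^esub> \<and> Comp C i s j pr2 in1 = \<one>\<^bsub>A i j\<^esub> \<and>
     Comp C s i s in1 pr1 \<otimes>\<^bsub>A s s\<^esub> Comp C s j s in2 pr2 = Ident C s"

definition additive_category :: "('o, 'm) cat \<Rightarrow> bool" where
  "additive_category C \<longleftrightarrow>
     (\<exists>A. preadditive C A \<and> (\<exists>z. zero_object C z) \<and>
        (\<forall>i\<in>Obj C. \<forall>j\<in>Obj C. \<exists>s in1 in2 pr1 pr2. biproduct C A i j s in1 in2 pr1 pr2))"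


section \<open>Tensor products and groups of homomorphisms\<close>

definition tensor_relations ::
    "'a monoid \<Rightarrow> 'b monoid \<Rightarrow> ('a \<times> 'b \<Rightarrow>\<^sub>0 int) set" where
  "tensor_relations A B =
     {frag_of (a \<otimes>\<^bsub>A\<^esub> a', b) - frag_of (a, b) - frag_of (a', b) | a a' b.
        a \<in> carrier A \<and> a' \<in> carrier A \<and> b \<in> carrier B} \<union>
     {frag_of (a, b \<otimes>\<^bsub>B\<^esub> b') - frag_of (a, b) - frag_of (a, b') | a b b'.
        a \<in> carrier A \<and> b \<in> carrier B \<and> b' \<in> carrier B}"

definition tensor_kernel ::
    "'a monoid \<Rightarrow> 'b monoid \<Rightarrow> ('a \<times> 'b \<Rightarrow>\<^sub>0 int) set" where
  "tensor_kernel A B =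
     generate (free_Abelian_group (carrier A \<times> carrier B)) (tensor_relations A B)"

definition tensor_group ::
    "'a monoid \<Rightarrow> 'b monoid \<Rightarrow> ('a \<times> 'b \<Rightarrow>\<^sub>0 int) set monoid" where
  "tensor_group A B = free_Abelian_group (carrier A \<times> carrier B) Mod tensor_kernel A B"

definition pure_tensor ::
    "'a monoid \<Rightarrow> 'b monoid \<Rightarrow> 'a \<Rightarrow> 'b \<Rightarrow> ('a \<times> 'b \<Rightarrow>\<^sub>0 int) set" where
  "pure_tensor A B a b =
     tensor_kernel A B #>\<^bsub>free_Abelian_group (carrier A \<times> carrier B)\<^esub> frag_of (a, b)"

definition tensor_map ::
    "'a monoid \<Rightarrow> 'b monoid \<Rightarrow> 'c monoid \<Rightarrow> 'd monoid \<Rightarrow> ('a \<Rightarrow> 'c) \<Rightarrow> ('b \<Rightarrow> 'd) \<Rightarrow>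
     ('a \<times> 'b \<Rightarrow>\<^sub>0 int) set \<Rightarrow> ('c \<times> 'd \<Rightarrow>\<^sub>0 int) set" where
  "tensor_map A B A' B' u v = (\<lambda>X\<in>carrier (tensor_group A B).
     \<Union>c\<in>X. tensor_kernel A' B' #>\<^bsub>free_Abelian_group (carrier A' \<times> carrier B')\<^esub>
             frag_extend (\<lambda>(a, b). frag_of (u a, v b)) c)"

definition pointwise_group :: "('a \<Rightarrow> 'b) set \<Rightarrow> 'a set \<Rightarrow> 'b monoid \<Rightarrow> ('a \<Rightarrow> 'b) monoid" where
  "pointwise_group F S B =
     \<lparr>carrier = F, monoid.mult = (\<lambda>f g. \<lambda>x\<in>S. f x \<otimes>\<^bsub>B\<^esub> g x), one = (\<lambda>x\<in>S. \<one>\<^bsub>B\<^esub>)\<rparr>"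

definition hom_group :: "'a monoid \<Rightarrow> 'b monoid \<Rightarrow> ('a \<Rightarrow> 'b) monoid" where
  "hom_group A B = pointwise_group (hom A B \<inter> extensional (carrier A)) (carrier A) B"


section \<open>Groups of nilpotency class two and q-maps\<close>

text \<open>Groups are written multiplicatively. The library's \<open>derived\<close> is generated by the elements
  \<open>a \<otimes> b \<otimes> inv a \<otimes> inv b\<close>; since \<open>a\<close> and \<open>b\<close> range over the whole group this is the subgroup
  generated by the commutators \<open>[a, b]\<close> below.\<close>

definition commutator :: "'a monoid \<Rightarrow> 'a \<Rightarrow> 'a \<Rightarrow> 'a" where
  "commutator G a b = inv\<^bsub>G\<^esub> a \<otimes>\<^bsub>G\<^esub> inv\<^bsub>G\<^esub> b \<otimes>\<^bsub>G\<^esub> a \<otimes>\<^bsub>G\<^esub> b"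

definition mixed_commutator_subgroup :: "'a monoid \<Rightarrow> 'a set \<Rightarrow> 'a set \<Rightarrow> 'a set" where
  "mixed_commutator_subgroup G A B = generate G {commutator G a b | a b. a \<in> A \<and> b \<in> B}"

definition nil2_group :: "'a monoid \<Rightarrow> bool" where
  "nil2_group G \<longleftrightarrow> group G \<and>
     mixed_commutator_subgroup G (derived G (carrier G)) (carrier G) = {\<one>\<^bsub>G\<^esub>}"

definition comm_sub :: "'a monoid \<Rightarrow> 'a monoid" where
  "comm_sub G = G\<lparr>carrier := derived G (carrier G)\<rparr>"

definition ab_quot :: "'a monoid \<Rightarrow> 'a set monoid" where
  "ab_quot G = G Mod derived G (carrier G)"

definition ab_class :: "'a monoid \<Rightarrow> 'a \<Rightarrow> 'a set" where
  "ab_class G g = derived G (carrier G) #>\<^bsub>G\<^esub> g"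

definition deviation :: "'a monoid \<Rightarrow> 'b monoid \<Rightarrow> ('a \<Rightarrow> 'b) \<Rightarrow> 'a \<Rightarrow> 'a \<Rightarrow> 'b" where
  "deviation G H f a b = inv\<^bsub>H\<^esub> (f a \<otimes>\<^bsub>H\<^esub> f b) \<otimes>\<^bsub>H\<^esub> f (a \<otimes>\<^bsub>G\<^esub> b)"

definition weakly_quadratic :: "'a monoid \<Rightarrow> 'b monoid \<Rightarrow> ('a \<Rightarrow> 'b) \<Rightarrow> bool" where
  "weakly_quadratic G H f \<longleftrightarrow> f \<in> carrier G \<rightarrow> carrier H \<and>
     (\<forall>a\<in>carrier G. \<forall>b\<in>carrier G. \<forall>c\<in>carrier G.
        deviation G H f a b \<otimes>\<^bsub>H\<^esub> f c = f c \<otimes>\<^bsub>H\<^esub> deviation G H f a b \<and>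
        deviation G H f (a \<otimes>\<^bsub>G\<^esub> b) c = deviation G H f a c \<otimes>\<^bsub>H\<^esub> deviation G H f b c \<and>
        deviation G H f a (b \<otimes>\<^bsub>G\<^esub> c) = deviation G H f a b \<otimes>\<^bsub>H\<^esub> deviation G H f a c)"

definition quadratic :: "'a monoid \<Rightarrow> 'b monoid \<Rightarrow> ('a \<Rightarrow> 'b) \<Rightarrow> bool" where
  "quadratic G H f \<longleftrightarrow> weakly_quadratic G H f \<and>
     (\<forall>a\<in>carrier G. \<forall>b\<in>carrier G. \<forall>h\<in>carrier H.
        deviation G H f a b \<otimes>\<^bsub>H\<^esub> h = h \<otimes>\<^bsub>H\<^esub> deviation G H f a b)"

definition quad_group :: "'a monoid \<Rightarrow> 'b monoid \<Rightarrow> ('a \<Rightarrow> 'b) monoid" where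
  "quad_group G H =
     pointwise_group ({f. quadratic G H f} \<inter> extensional (carrier G)) (carrier G) H"

definition q_map :: "'a monoid \<Rightarrow> 'b monoid \<Rightarrow> ('a \<Rightarrow> 'b) \<Rightarrow> bool" where
  "q_map G H f \<longleftrightarrow> nil2_group G \<and> nil2_group H \<and> weakly_quadratic G H f \<and>
     (\<forall>a\<in>carrier G. \<forall>b\<in>carrier G. deviation G H f a b \<in> derived H (carrier H))"

text \<open>The induced map \<open>f\<^sup>a\<^sup>b\<close> and the restriction \<open>[f, f]\<close>.\<close>

definition ab_map :: "'a monoid \<Rightarrow> 'b monoid \<Rightarrow> ('a \<Rightarrow> 'b) \<Rightarrow> 'a set \<Rightarrow> 'b set" where
  "ab_map G H f = (\<lambda>X\<in>carrier (ab_quot G). the_elem ((\<lambda>x. ab_class H (f x)) ` X))"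

definition comm_map :: "'a monoid \<Rightarrow> ('a \<Rightarrow> 'b) \<Rightarrow> 'a \<Rightarrow> 'b" where
  "comm_map G f = restrict f (derived G (carrier G))"


section \<open>The category of nil-2 groups and its quotients\<close>

text \<open>The objects are the nil-2 groups whose elements belong to the type \<open>'a\<close>, which plays the role
  of a universe. Maps are normalised to \<open>undefined\<close> outside the carrier of their source, so that
  equality of morphisms is equality of maps.\<close>

definition Niq :: "('a monoid, 'a \<Rightarrow> 'a) cat" where
  "Niq =
     \<lparr>Obj = {G. nil2_group G},
      Hom = (\<lambda>G H. {f. q_map G H f} \<inter> extensional (carrier G)),
      Ident = (\<lambda>G. \<lambda>x\<in>carrier G. x),
      Comp = (\<lambda>G H K g f. compose (carrier G) g f)\<rparr>"

text \<open>The group \<open>Hom(G\<^sup>a\<^sup>b \<otimes> G\<^sup>a\<^sup>b, [H, H])\<close>, its subgroup of alternating elements, and \<open>f + \<alpha>\<close>.\<close>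

definition tensor_ab :: "'a monoid \<Rightarrow> ('a set \<times> 'a set \<Rightarrow>\<^sub>0 int) set monoid" where
  "tensor_ab G = tensor_group (ab_quot G) (ab_quot G)"

definition tensor_hom ::
    "'a monoid \<Rightarrow> 'a monoid \<Rightarrow> (('a set \<times> 'a set \<Rightarrow>\<^sub>0 int) set \<Rightarrow> 'a) monoid" where
  "tensor_hom G H = hom_group (tensor_ab G) (comm_sub H)"

definition alternating ::
    "'a monoid \<Rightarrow> 'a monoid \<Rightarrow> (('a set \<times> 'a set \<Rightarrow>\<^sub>0 int) set \<Rightarrow> 'a) set" where
  "alternating G H = {\<alpha> \<in> carrier (tensor_hom G H). \<forall>x\<in>carrier G.
     \<alpha> (pure_tensor (ab_quot G) (ab_quot G) (ab_class G x) (ab_class G x)) = \<one>\<^bsub>H\<^esub>}"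

definition add_tensor ::
    "'a monoid \<Rightarrow> 'a monoid \<Rightarrow> ('a \<Rightarrow> 'a) \<Rightarrow> (('a set \<times> 'a set \<Rightarrow>\<^sub>0 int) set \<Rightarrow> 'a) \<Rightarrow> 'a \<Rightarrow> 'a"
  where
  "add_tensor G H f \<alpha> = (\<lambda>g\<in>carrier G.
     f g \<otimes>\<^bsub>H\<^esub> \<alpha> (pure_tensor (ab_quot G) (ab_quot G) (ab_class G g) (ab_class G g)))"

definition add_quad ::
    "'a monoid \<Rightarrow> 'a monoid \<Rightarrow> ('a \<Rightarrow> 'a) \<Rightarrow> ('a set \<Rightarrow> 'a) \<Rightarrow> 'a \<Rightarrow> 'a" where
  "add_quad G H f h = (\<lambda>x\<in>carrier G. f x \<otimes>\<^bsub>H\<^esub> h (ab_class G x))"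

definition sim_rel :: "'a monoid \<Rightarrow> 'a monoid \<Rightarrow> (('a \<Rightarrow> 'a) \<times> ('a \<Rightarrow> 'a)) set" where
  "sim_rel G H = {(f, g). f \<in> Hom Niq G H \<and> g \<in> Hom Niq G H \<and>
     (\<exists>\<alpha>\<in>carrier (tensor_hom G H). g = add_tensor G H f \<alpha>)}"

definition approx_rel :: "'a monoid \<Rightarrow> 'a monoid \<Rightarrow> (('a \<Rightarrow> 'a) \<times> ('a \<Rightarrow> 'a)) set" where
  "approx_rel G H = {(f, g). f \<in> Hom Niq G H \<and> g \<in> Hom Niq G H \<and>
     ab_map G H f = ab_map G H g \<and> comm_map G f = comm_map G g}"

definition Niq_sim :: "('a monoid, ('a \<Rightarrow> 'a) set) cat" where
  "Niq_sim = quotient_cat Niq sim_rel"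

definition Niq_approx :: "('a monoid, ('a \<Rightarrow> 'a) set) cat" where
  "Niq_approx = quotient_cat Niq approx_rel"

definition to_sim :: "('a monoid, 'a \<Rightarrow> 'a, 'a monoid, ('a \<Rightarrow> 'a) set) func" where
  "to_sim = quotient_func sim_rel"

definition to_approx :: "('a monoid, 'a \<Rightarrow> 'a, 'a monoid, ('a \<Rightarrow> 'a) set) func" where
  "to_approx = quotient_func approx_rel"

definition sim_to_approx ::
    "('a monoid, ('a \<Rightarrow> 'a) set, 'a monoid, ('a \<Rightarrow> 'a) set) func" where
  "sim_to_approx = induced_quotient_func approx_rel"


section \<open>The bifunctors and their actions\<close>

text \<open>The maps \<open>f\<^sup>a\<^sup>b\<close> and \<open>[f, f]\<close> for \<open>f\<close> in a class of q-maps modulo \<open>\<approx>\<close>; here and below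
  \<open>the_elem\<close> picks the common value on all representatives of a class.\<close>

definition class_ab_map :: "'a monoid \<Rightarrow> 'a monoid \<Rightarrow> ('a \<Rightarrow> 'a) set \<Rightarrow> 'a set \<Rightarrow> 'a set" where
  "class_ab_map G H F = the_elem (ab_map G H ` F)"

definition class_comm_map :: "'a monoid \<Rightarrow> ('a \<Rightarrow> 'a) set \<Rightarrow> 'a \<Rightarrow> 'a" where
  "class_comm_map G F = the_elem (comm_map G ` F)"

definition D_sim ::
    "('a monoid, ('a \<Rightarrow> 'a) set, (('a set \<times> 'a set \<Rightarrow>\<^sub>0 int) set \<Rightarrow> 'a) set) bifunc" where
  "D_sim =
     \<lparr>BGrp = (\<lambda>G H. tensor_hom G H Mod alternating G H),
      BMap = (\<lambda>G H G' H' \<Phi> \<Psi> X.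
        \<Union>\<alpha>\<in>X. alternating G' H' #>\<^bsub>tensor_hom G' H'\<^esub>
          compose (carrier (tensor_ab G')) (class_comm_map H \<Psi>)
            (compose (carrier (tensor_ab G')) \<alpha>
              (tensor_map (ab_quot G') (ab_quot G') (ab_quot G) (ab_quot G)
                (class_ab_map G' G \<Phi>) (class_ab_map G' G \<Phi>))))\<rparr>"

definition D_approx :: "('a monoid, ('a \<Rightarrow> 'a) set, 'a set \<Rightarrow> 'a) bifunc" where
  "D_approx =
     \<lparr>BGrp = (\<lambda>G H. quad_group (ab_quot G) (comm_sub H)),
      BMap = (\<lambda>G H G' H' \<Phi> \<Psi> h.
        compose (carrier (ab_quot G')) (class_comm_map H \<Psi>)
          (compose (carrier (ab_quot G')) h (class_ab_map G' G \<Phi>)))\<rparr>"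

definition rho ::
    "'a monoid \<Rightarrow> 'a monoid \<Rightarrow> (('a set \<times> 'a set \<Rightarrow>\<^sub>0 int) set \<Rightarrow> 'a) set \<Rightarrow> 'a set \<Rightarrow> 'a" where
  "rho G H X = (\<lambda>\<xi>\<in>carrier (ab_quot G).
     the_elem ((\<lambda>\<alpha>. \<alpha> (pure_tensor (ab_quot G) (ab_quot G) \<xi> \<xi>)) ` X))"

definition D_tilde :: "('a monoid, ('a \<Rightarrow> 'a) set, ('a set \<Rightarrow> 'a) set) bifunc" where
  "D_tilde = coker_bifunc D_sim D_approx rho"

definition rho_coker :: "'a monoid \<Rightarrow> 'a monoid \<Rightarrow> ('a set \<Rightarrow> 'a) \<Rightarrow> ('a set \<Rightarrow> 'a) set" where
  "rho_coker = coker_proj D_sim D_approx rho"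

definition act_sim ::
    "'a monoid \<Rightarrow> 'a monoid \<Rightarrow> (('a set \<times> 'a set \<Rightarrow>\<^sub>0 int) set \<Rightarrow> 'a) set \<Rightarrow>
     ('a \<Rightarrow> 'a) \<Rightarrow> ('a \<Rightarrow> 'a)" where
  "act_sim G H X = (\<lambda>f\<in>Hom Niq G H. the_elem (add_tensor G H f ` X))"

definition act_approx ::
    "'a monoid \<Rightarrow> 'a monoid \<Rightarrow> ('a set \<Rightarrow> 'a) \<Rightarrow> ('a \<Rightarrow> 'a) \<Rightarrow> ('a \<Rightarrow> 'a)" where
  "act_approx G H h = (\<lambda>f\<in>Hom Niq G H. add_quad G H f h)"

definition act_tilde ::
    "'a monoid \<Rightarrow> 'a monoid \<Rightarrow> ('a set \<Rightarrow> 'a) set \<Rightarrow> ('a \<Rightarrow> 'a) set \<Rightarrow> ('a \<Rightarrow> 'a) set" where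
  "act_tilde G H Y = (\<lambda>F\<in>Hom Niq_sim G H.
     \<Union>h\<in>Y. \<Union>f\<in>F. sim_rel G H `` {act_approx G H h f})"

end

theory Submission
  imports Defs
begin

text \<open>The deviation of a q-map is bilinear with values in the abelian group \<open>[H, H]\<close>, so it vanishes as
  soon as one argument is a commutator. Hence q-maps compose, and two q-maps \<open>f\<close>, \<open>g\<close> have the same
  invariants \<open>f\<^sup>a\<^sup>b\<close> and \<open>[f, f]\<close> iff \<open>x \<mapsto> -f(x) + g(x)\<close> descends to a quadratic map
  \<open>G\<^sup>a\<^sup>b \<rightarrow> [H, H]\<close>; this is the extension by \<open>D_approx\<close>. The other two extensions are formal: for a
  linear extension of \<open>E/S\<close> by \<open>D2\<close> and a monomorphism of bifunctors \<open>\<sigma> : D1 \<rightarrow> D2\<close>, the orbits of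
  \<open>D1\<close> form a congruence \<open>R\<close>, and \<open>E\<close> is an extension of \<open>E/R\<close> by \<open>D1\<close>, which in turn is an
  extension of \<open>E/S\<close> by the cokernel. Any linear extension reflects isomorphisms. Up to \<open>\<approx>\<close> the
  pointwise product of q-maps is commutative and composition distributes over it, because this can
  be tested on the homomorphisms \<open>f\<^sup>a\<^sup>b\<close> and \<open>[f, f]\<close>.\<close>

section \<open>Categories and quotients\<close>

text \<open>In \<open>g (f x \<otimes> b)\<close> with \<open>b\<close> in the commutator subgroup,
  a q-map \<open>g\<close> splits off \<open>g b\<close> without any correction, and the factor
  \<open>b\<close> does not change the class in the abelianisation. This is why corrections of
  q-maps compose additively, with coefficients depending only on the two invariants. The awkward
  bifunctor is \<open>D_sim\<close>: its maps pass through tensor products given as cosets in a free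
  abelian group, and its elements are themselves cosets. For this reason \<open>alternating\<close>
  is identified with the kernel of the map that restricts a bilinear map to the diagonal. The first
  isomorphism theorem then makes \<open>rho\<close> injective, and both the well-definedness of the
  maps of \<open>D_sim\<close> and its functor laws are pulled back from \<open>D_approx\<close>
  along \<open>rho\<close>. In \<open>Niq\<close> itself the pointwise product is not commutative,
  and \<open>g\<close> does not distribute over a product \<open>f \<otimes> f'\<close>. Both
  defects take values in the commutator subgroup of the target and vanish on commutators of the
  source, so neither invariant sees them.\<close>

lemma ident_closed: "category C \<Longrightarrow> i \<in> Obj C \<Longrightarrow> Ident C i \<in> Hom C i i"
  by (simp add: category_def)

lemma comp_closed:
  "category C \<Longrightarrow> i \<in> Obj C \<Longrightarrow> j \<in> Obj C \<Longrightarrow> k \<in> Obj C \<Longrightarrow> f \<in> Hom C i j \<Longrightarrow> g \<in> Hom C j k \<Longrightarrow>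
     Comp C i j k g f \<in> Hom C i k"
  by (simp add: category_def)

lemma comp_ident_right:
  "category C \<Longrightarrow> i \<in> Obj C \<Longrightarrow> j \<in> Obj C \<Longrightarrow> f \<in> Hom C i j \<Longrightarrow> Comp C i i j f (Ident C i) = f"
  by (simp add: category_def)

lemma comp_ident_left:
  "category C \<Longrightarrow> i \<in> Obj C \<Longrightarrow> j \<in> Obj C \<Longrightarrow> f \<in> Hom C i j \<Longrightarrow> Comp C i j j (Ident C j) f = f"
  by (simp add: category_def)

lemma comp_assoc:
  "category C \<Longrightarrow> i \<in> Obj C \<Longrightarrow> j \<in> Obj C \<Longrightarrow> k \<in> Obj C \<Longrightarrow> l \<in> Obj C \<Longrightarrow>
     f \<in> Hom C i j \<Longrightarrow> g \<in> Hom C j k \<Longrightarrow> h \<in> Hom C k l \<Longrightarrow>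
     Comp C i k l h (Comp C i j k g f) = Comp C i j l (Comp C j k l h g) f"
  by (simp add: category_def)

text \<open>The last clause has no membership conditions on the morphisms: \<open>equiv\<close>
  already confines \<open>R i j\<close> to pairs from \<open>Hom C i j\<close>.\<close>

definition congruence :: "('o, 'm) cat \<Rightarrow> ('o \<Rightarrow> 'o \<Rightarrow> ('m \<times> 'm) set) \<Rightarrow> bool" where
  "congruence C R \<longleftrightarrow> category C \<and>
     (\<forall>i\<in>Obj C. \<forall>j\<in>Obj C. equiv (Hom C i j) (R i j)) \<and>
     (\<forall>i\<in>Obj C. \<forall>j\<in>Obj C. \<forall>k\<in>Obj C. \<forall>f f' g g'. (f, f') \<in> R i j \<longrightarrow> (g, g') \<in> R j k \<longrightarrow>
        (Comp C i j k g f, Comp C i j k g' f') \<in> R i k)"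

lemma quotient_cat_simps [simp]:
  "Obj (quotient_cat C R) = Obj C"
  "Hom (quotient_cat C R) i j = Hom C i j // R i j"
  "Ident (quotient_cat C R) i = R i i `` {Ident C i}"
  by (simp_all add: quotient_cat_def)

lemma quotient_func_simps [simp]:
  "on_obj (quotient_func R) i = i"
  "on_hom (quotient_func R) i j f = R i j `` {f}"
  by (simp_all add: quotient_func_def)

context
  fixes C :: "('o, 'm) cat" and R
  assumes R: "congruence C R"
begin

lemma congruence_category: "category C"
  using R by (simp add: congruence_def)

lemma congruence_equiv: "i \<in> Obj C \<Longrightarrow> j \<in> Obj C \<Longrightarrow> equiv (Hom C i j) (R i j)"
  using R by (simp add: congruence_def)

lemma congruence_comp:
  "i \<in> Obj C \<Longrightarrow> j \<in> Obj C \<Longrightarrow> k \<in> Obj C \<Longrightarrow> (f, f') \<in> R i j \<Longrightarrow> (g, g') \<in> R j k \<Longrightarrow>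
     (Comp C i j k g f, Comp C i j k g' f') \<in> R i k"
  using R by (simp add: congruence_def)

lemma congruence_class_eq_iff:
  "i \<in> Obj C \<Longrightarrow> j \<in> Obj C \<Longrightarrow> f \<in> Hom C i j \<Longrightarrow> g \<in> Hom C i j \<Longrightarrow>
     R i j `` {f} = R i j `` {g} \<longleftrightarrow> (f, g) \<in> R i j"
  by (rule eq_equiv_class_iff[OF congruence_equiv])

text \<open>Composition in the quotient is a union over all pairs of representatives. Compatibility
  of \<open>R\<close> with composition makes every member of the union the same class, so the union
  collapses to a single one.\<close>

lemma quotient_comp:
  assumes o: "i \<in> Obj C" "j \<in> Obj C" "k \<in> Obj C" and f: "f \<in> Hom C i j" and g: "g \<in> Hom C j k"
  shows "Comp (quotient_cat C R) i j k (R j k `` {g}) (R i j `` {f}) = R i k `` {Comp C i j k g f}"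
proof -
  have "congruent2 (R j k) (R i j) (\<lambda>g f. R i k `` {Comp C i j k g f})"
    by (rule congruent2I') (rule equiv_class_eq[OF congruence_equiv[OF o(1,3)] congruence_comp[OF o]])
  from UN_equiv_class2[OF congruence_equiv[OF o(2,3)] congruence_equiv[OF o(1,2)] this g f]
  show ?thesis by (simp add: quotient_cat_def)
qed

lemma quotient_hom_class:
  "F \<in> Hom C i j // R i j \<Longrightarrow> \<exists>f\<in>Hom C i j. F = R i j `` {f}"
  by (auto simp: quotient_def)

lemma category_quotient: "category (quotient_cat C R)"
proof -
  note cl = comp_closed[OF congruence_category] and id = ident_closed[OF congruence_category]
  show ?thesis
    unfolding category_def quotient_cat_simps
  proof (intro conjI ballI)
    fix i j k F G assume o: "i \<in> Obj C" "j \<in> Obj C" "k \<in> Obj C"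
      and "F \<in> Hom C i j // R i j" "G \<in> Hom C j k // R j k"
    then obtain f g where "f \<in> Hom C i j" "F = R i j `` {f}" "g \<in> Hom C j k" "G = R j k `` {g}"
      using quotient_hom_class by metis
    then show "Comp (quotient_cat C R) i j k G F \<in> Hom C i k // R i k"
      using o by (simp add: quotient_comp cl quotientI)
  next
    fix i j F assume o: "i \<in> Obj C" "j \<in> Obj C" and "F \<in> Hom C i j // R i j"
    then obtain f where f: "f \<in> Hom C i j" "F = R i j `` {f}"
      using quotient_hom_class by metis
    with o show "Comp (quotient_cat C R) i i j F (R i i `` {Ident C i}) = F"
      by (simp add: quotient_comp id comp_ident_right[OF congruence_category])
    from f o show "Comp (quotient_cat C R) i j j (R j j `` {Ident C j}) F = F"
      by (simp add: quotient_comp id comp_ident_left[OF congruence_category])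
  next
    fix i j k l F G H
    assume o: "i \<in> Obj C" "j \<in> Obj C" "k \<in> Obj C" "l \<in> Obj C"
      and "F \<in> Hom C i j // R i j" "G \<in> Hom C j k // R j k" "H \<in> Hom C k l // R k l"
    then obtain f g h where
      "f \<in> Hom C i j" "F = R i j `` {f}" "g \<in> Hom C j k" "G = R j k `` {g}"
      "h \<in> Hom C k l" "H = R k l `` {h}"
      using quotient_hom_class by metis
    with o show "Comp (quotient_cat C R) i k l H (Comp (quotient_cat C R) i j k G F) =
        Comp (quotient_cat C R) i j l (Comp (quotient_cat C R) j k l H G) F"
      by (simp add: quotient_comp cl comp_assoc[OF congruence_category])
  qed (auto intro: quotientI id)
qed

lemma full_functor_quotient: "full_functor C (quotient_cat C R) (quotient_func R)"
  unfolding full_functor_def is_functor_def quotient_cat_simps quotient_func_simps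
proof (intro conjI ballI)
  fix i j
  show "(\<lambda>f. R i j `` {f}) ` Hom C i j = Hom C i j // R i j"
    by (auto simp: quotient_def)
qed (simp_all add: congruence_category category_quotient quotient_comp quotientI)

end

lemma identity_on_objects_quotient: "identity_on_objects C (quotient_cat C R) (quotient_func R)"
  by (simp add: identity_on_objects_def)

section \<open>Comparison of two quotients of the same category\<close>

lemma induced_quotient_func_simps [simp]:
  "on_obj (induced_quotient_func S) i = i"
  by (simp add: induced_quotient_func_def)

context
  fixes C :: "('o, 'm) cat" and R S
  assumes R: "congruence C R" and S: "congruence C S"
    and sub: "\<And>i j. i \<in> Obj C \<Longrightarrow> j \<in> Obj C \<Longrightarrow> R i j \<subseteq> S i j"
begin

lemma induced_quotient_class:
  assumes o: "i \<in> Obj C" "j \<in> Obj C" and f: "f \<in> Hom C i j"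
  shows "on_hom (induced_quotient_func S) i j (R i j `` {f}) = S i j `` {f}"
proof -
  have "(\<lambda>f. S i j `` {f}) respects R i j"
    by (rule congruentI) (rule equiv_class_eq[OF congruence_equiv[OF S o] subsetD[OF sub[OF o]]])
  from UN_equiv_class[OF congruence_equiv[OF R o] this f] show ?thesis
    by (simp add: induced_quotient_func_def)
qed

lemma full_functor_induced_quotient:
  "full_functor (quotient_cat C R) (quotient_cat C S) (induced_quotient_func S)"
  unfolding full_functor_def is_functor_def quotient_cat_simps induced_quotient_func_simps
proof (intro conjI ballI)
  show "category (quotient_cat C R)" "category (quotient_cat C S)"
    by (rule category_quotient, fact)+
  fix i j assume o: "i \<in> Obj C" "j \<in> Obj C"
  show im: "on_hom (induced_quotient_func S) i j ` (Hom C i j // R i j) = Hom C i j // S i j"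
  proof -
    have "Hom C i j // T i j = (\<lambda>f. T i j `` {f}) ` Hom C i j" for T
      by (auto simp: quotient_def)
    then show ?thesis
      using o by (simp add: image_image induced_quotient_class)
  qed
  show "on_hom (induced_quotient_func S) i j F \<in> Hom C i j // S i j"
    if "F \<in> Hom C i j // R i j" for F
    using im that by blast
  fix k F G assume o': "k \<in> Obj C" and "F \<in> Hom C i j // R i j" "G \<in> Hom C j k // R j k"
  then obtain f g where "f \<in> Hom C i j" "F = R i j `` {f}" "g \<in> Hom C j k" "G = R j k `` {g}"
    using quotient_hom_class[OF R] by metis
  then show "on_hom (induced_quotient_func S) i k (Comp (quotient_cat C R) i j k G F) =
      Comp (quotient_cat C S) i j k (on_hom (induced_quotient_func S) j k G)
        (on_hom (induced_quotient_func S) i j F)"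
    using o o' by (simp add: quotient_comp[OF R] quotient_comp[OF S] induced_quotient_class
        comp_closed[OF congruence_category[OF R]])
qed (simp_all add: induced_quotient_class ident_closed[OF congruence_category[OF R]])

lemma same_functor_induced_quotient:
  "same_functor C (quotient_func S) (comp_func (induced_quotient_func S) (quotient_func R))"
  by (simp add: same_functor_def comp_func_def induced_quotient_class)

end

lemma identity_on_objects_induced_quotient:
  "identity_on_objects (quotient_cat C R) (quotient_cat C S) (induced_quotient_func S)"
  by (simp add: identity_on_objects_def)


section \<open>Functors reflecting isomorphisms\<close>

lemma iso_rel_equiv:
  assumes C: "category C"
  shows "equiv (Obj C) (iso_rel C)"
proof (rule equivI)
  show "refl_on (Obj C) (iso_rel C)"
  proof (rule refl_onI)
    fix i assume i: "i \<in> Obj C"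
    with C have "Ident C i \<in> Hom C i i" "Comp C i i i (Ident C i) (Ident C i) = Ident C i"
      by (simp_all add: ident_closed comp_ident_left)
    with i show "(i, i) \<in> iso_rel C"
      unfolding iso_rel_def iso_in_def by blast
  qed
  show "sym (iso_rel C)"
    unfolding sym_def iso_rel_def iso_in_def by blast
  show "trans (iso_rel C)"
  proof (rule transI)
    fix i j k assume "(i, j) \<in> iso_rel C" "(j, k) \<in> iso_rel C"
    then obtain f f' g g' where o: "i \<in> Obj C" "j \<in> Obj C" "k \<in> Obj C"
      and f: "f \<in> Hom C i j" "f' \<in> Hom C j i" "Comp C i j i f' f = Ident C i" "Comp C j i j f f' = Ident C j"
      and g: "g \<in> Hom C j k" "g' \<in> Hom C k j" "Comp C j k j g' g = Ident C j" "Comp C k j k g g' = Ident C k"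
      unfolding iso_rel_def iso_in_def by blast
    note cl = comp_closed[OF C] and as = comp_assoc[OF C]
    have "Comp C j k i (Comp C k j i f' g') g = f'"
      using o f g as[of j k j i g g' f'] comp_ident_right[OF C, of j i f'] by simp
    then have 1: "Comp C i k i (Comp C k j i f' g') (Comp C i j k g f) = Ident C i"
      using o f g as[of i j k i f g "Comp C k j i f' g'"] cl by simp
    have "Comp C j i k (Comp C i j k g f) f' = g"
      using o f g as[of j i j k f' f g] comp_ident_right[OF C, of j k g] by simp
    then have "Comp C k i k (Comp C i j k g f) (Comp C k j i f' g') = Ident C k"
      using o f g as[of k j i k g' f' "Comp C i j k g f"] cl by simp
    then show "(i, k) \<in> iso_rel C"
      unfolding iso_rel_def iso_in_def using 1 o f g cl by blast
  qed
qed (auto simp: iso_rel_def)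

text \<open>Fullness lifts an isomorphism of the target to a morphism, and reflection makes the lift
  an isomorphism. Hence both categories have the same relation \<open>iso_rel\<close>, and the
  induced map on classes is the identity.\<close>

lemma bijective_on_iso_classesI:
  assumes full: "full_functor E C P" and id: "identity_on_objects E C P"
    and refl: "reflects_isos E C P"
  shows "bijective_on_iso_classes E C P"
proof -
  have oo: "Obj E = Obj C" and P: "\<And>i. i \<in> Obj E \<Longrightarrow> on_obj P i = i"
    using id by (auto simp: identity_on_objects_def)
  have fn: "is_functor E C P"
    using full by (simp add: full_functor_def)
  then have catE: "category E" and catC: "category C"
    by (auto simp: is_functor_def)
  have eq: "iso_rel E = iso_rel C"
  proof (intro equalityI subrelI)
    fix i j assume "(i, j) \<in> iso_rel E"
    then obtain f g where o: "i \<in> Obj E" "j \<in> Obj E"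
      and f: "f \<in> Hom E i j" "g \<in> Hom E j i" "Comp E i j i g f = Ident E i" "Comp E j i j f g = Ident E j"
      unfolding iso_rel_def iso_in_def by blast
    have "Comp C i j i (on_hom P j i g) (on_hom P i j f) = Ident C i"
      "Comp C j i j (on_hom P i j f) (on_hom P j i g) = Ident C j"
      "on_hom P i j f \<in> Hom C i j" "on_hom P j i g \<in> Hom C j i"
      using fn o f unfolding is_functor_def by (metis P)+
    then show "(i, j) \<in> iso_rel C"
      unfolding iso_rel_def iso_in_def using o oo by blast
  next
    fix i j assume "(i, j) \<in> iso_rel C"
    then obtain f where o: "i \<in> Obj E" "j \<in> Obj E" and f: "iso_in C i j f"
      unfolding iso_rel_def oo by blast
    then obtain f' where "f' \<in> Hom E i j" "on_hom P i j f' = f"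
      using full P unfolding full_functor_def iso_in_def by (metis imageE)
    then show "(i, j) \<in> iso_rel E"
      using refl o f P unfolding reflects_isos_def iso_rel_def by auto
  qed
  have *: "(\<Union>i\<in>X. iso_rel C `` {on_obj P i}) = X" if X: "X \<in> Obj E // iso_rel E" for X
  proof -
    obtain x where x: "x \<in> Obj E" "X = iso_rel E `` {x}"
      using X by (auto elim: quotientE)
    have "(\<lambda>i. iso_rel C `` {on_obj P i}) respects iso_rel E"
      unfolding congruent_def
    proof clarify
      fix i j assume "(i, j) \<in> iso_rel E"
      moreover from this have "i \<in> Obj E" "j \<in> Obj E"
        by (auto simp: iso_rel_def)
      ultimately show "iso_rel C `` {on_obj P i} = iso_rel C `` {on_obj P j}"
        using equiv_class_eq[OF iso_rel_equiv[OF catC]] P by (simp add: eq)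
    qed
    from UN_equiv_class[OF iso_rel_equiv[OF catE] this x(1)] show ?thesis
      using x P by (simp add: eq)
  qed
  then have "(\<lambda>X. \<Union>i\<in>X. iso_rel C `` {on_obj P i}) ` (Obj E // iso_rel E) = Obj E // iso_rel E"
    by (metis (no_types, lifting) image_cong image_ident)
  moreover have "inj_on (\<lambda>X. \<Union>i\<in>X. iso_rel C `` {on_obj P i}) (Obj E // iso_rel E)"
    by (rule inj_onI) (metis (no_types, lifting) *)
  ultimately show ?thesis
    unfolding bijective_on_iso_classes_def bij_betw_def using oo eq by simp
qed

section \<open>Linear extensions\<close>

lemma bifunctorD:
  assumes "bifunctor C D"
  shows "category C"
    and "\<And>i j. i \<in> Obj C \<Longrightarrow> j \<in> Obj C \<Longrightarrow> comm_group (BGrp D i j)"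
    and "\<And>i j i' j' \<phi> \<psi>. i \<in> Obj C \<Longrightarrow> j \<in> Obj C \<Longrightarrow> i' \<in> Obj C \<Longrightarrow> j' \<in> Obj C \<Longrightarrow>
      \<phi> \<in> Hom C i' i \<Longrightarrow> \<psi> \<in> Hom C j j' \<Longrightarrow>
      BMap D i j i' j' \<phi> \<psi> \<in> hom (BGrp D i j) (BGrp D i' j')"
    and "\<And>i j d. i \<in> Obj C \<Longrightarrow> j \<in> Obj C \<Longrightarrow> d \<in> carrier (BGrp D i j) \<Longrightarrow>
      BMap D i j i j (Ident C i) (Ident C j) d = d"
    and "\<And>i j i' j' i'' j'' \<phi> \<phi>' \<psi> \<psi>' d.
      i \<in> Obj C \<Longrightarrow> j \<in> Obj C \<Longrightarrow> i' \<in> Obj C \<Longrightarrow> j' \<in> Obj C \<Longrightarrow> i'' \<in> Obj C \<Longrightarrow> j'' \<in> Obj C \<Longrightarrow>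
      \<phi> \<in> Hom C i' i \<Longrightarrow> \<phi>' \<in> Hom C i'' i' \<Longrightarrow> \<psi> \<in> Hom C j j' \<Longrightarrow> \<psi>' \<in> Hom C j' j'' \<Longrightarrow>
      d \<in> carrier (BGrp D i j) \<Longrightarrow>
      BMap D i j i'' j'' (Comp C i'' i' i \<phi> \<phi>') (Comp C j j' j'' \<psi>' \<psi>) d
        = BMap D i' j' i'' j'' \<phi>' \<psi>' (BMap D i j i' j' \<phi> \<psi> d)"
  using assms by (simp_all add: bifunctor_def)

lemma bifunctor_map_closed:
  assumes "bifunctor C D" "i \<in> Obj C" "j \<in> Obj C" "i' \<in> Obj C" "j' \<in> Obj C"
    "\<phi> \<in> Hom C i' i" "\<psi> \<in> Hom C j j'" "d \<in> carrier (BGrp D i j)"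
  shows "BMap D i j i' j' \<phi> \<psi> d \<in> carrier (BGrp D i' j')"
  using bifunctorD(3)[OF assms(1-7)] assms(8) by (rule hom_in_carrier)

lemma bifunctor_map_one:
  assumes "bifunctor C D" "i \<in> Obj C" "j \<in> Obj C" "i' \<in> Obj C" "j' \<in> Obj C"
    "\<phi> \<in> Hom C i' i" "\<psi> \<in> Hom C j j'"
  shows "BMap D i j i' j' \<phi> \<psi> \<one>\<^bsub>BGrp D i j\<^esub> = \<one>\<^bsub>BGrp D i' j'\<^esub>"
  using hom_one[OF bifunctorD(3)[OF assms]] bifunctorD(2)[OF assms(1)] assms(2-5)
  by (simp add: comm_group.axioms(2))

lemma group_action_one:
  assumes "group_action G E act" "x \<in> E"
  shows "act \<one>\<^bsub>G\<^esub> x = x"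
  using group_action.id_eq_one[OF assms(1)] assms(2) by (metis restrict_apply')

text \<open>An action in the library is a homomorphism into \<open>BijGroup E\<close>, whose
  elements are extensional bijections. Extensionality has to be supplied; bijectivity follows
  because the inverse group element acts as the inverse map.\<close>

lemma group_actionI:
  assumes G: "group G"
    and ext: "\<And>a. a \<in> carrier G \<Longrightarrow> act a \<in> extensional E"
    and cl: "\<And>a x. a \<in> carrier G \<Longrightarrow> x \<in> E \<Longrightarrow> act a x \<in> E"
    and one: "\<And>x. x \<in> E \<Longrightarrow> act \<one>\<^bsub>G\<^esub> x = x"
    and mult: "\<And>a b x. a \<in> carrier G \<Longrightarrow> b \<in> carrier G \<Longrightarrow> x \<in> E \<Longrightarrow> act (a \<otimes>\<^bsub>G\<^esub> b) x = act a (act b x)"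
  shows "group_action G E act"
proof -
  interpret group G by fact
  have bij: "act a \<in> Bij E" if a: "a \<in> carrier G" for a
    unfolding Bij_def
  proof (intro IntI CollectI)
    show "act a \<in> extensional E" by (rule ext[OF a])
    have "act (inv\<^bsub>G\<^esub> a) (act a x) = x" "act a (act (inv\<^bsub>G\<^esub> a) x) = x" if "x \<in> E" for x
      using a that by (simp_all add: mult[symmetric] one)
    then show "bij_betw (act a) E E"
      by (intro bij_betw_byWitness[where f' = "act (inv\<^bsub>G\<^esub> a)"]) (use a cl in auto)
  qed
  show ?thesis
    unfolding group_action_def group_hom_def group_hom_axioms_def
  proof (intro conjI homI)
    fix a b assume ab: "a \<in> carrier G" "b \<in> carrier G"
    show "act (a \<otimes>\<^bsub>G\<^esub> b) = act a \<otimes>\<^bsub>BijGroup E\<^esub> act b"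
    proof (rule extensionalityI[of _ E])
      fix x assume "x \<in> E"
      then show "act (a \<otimes>\<^bsub>G\<^esub> b) x = (act a \<otimes>\<^bsub>BijGroup E\<^esub> act b) x"
        using ab by (simp add: BijGroup_def bij compose_eq mult)
    qed (use ab bij in \<open>simp_all add: ext BijGroup_def\<close>)
  qed (simp_all add: G group_BijGroup, simp add: BijGroup_def bij)
qed

context
  fixes D :: "('o, 'n, 'd) bifunc" and E :: "('o, 'm) cat" and C P act
  assumes L: "linear_extension D E C P act"
begin

lemma linear_extension_bifunctor: "bifunctor C D"
  and linear_extension_full: "full_functor E C P"
  and linear_extension_identity: "identity_on_objects E C P"
  using L by (simp_all add: linear_extension_def)

lemma linear_extension_functor: "is_functor E C P"
  using linear_extension_full by (simp add: full_functor_def)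

lemma linear_extension_category: "category E" "category C"
  using linear_extension_functor by (simp_all add: is_functor_def)

lemma linear_extension_obj: "Obj C = Obj E" "i \<in> Obj E \<Longrightarrow> on_obj P i = i"
  using linear_extension_identity by (simp_all add: identity_on_objects_def)

lemma linear_extension_func:
  "i \<in> Obj E \<Longrightarrow> j \<in> Obj E \<Longrightarrow> f \<in> Hom E i j \<Longrightarrow> on_hom P i j f \<in> Hom C i j"
  "i \<in> Obj E \<Longrightarrow> on_hom P i i (Ident E i) = Ident C i"
  "i \<in> Obj E \<Longrightarrow> j \<in> Obj E \<Longrightarrow> k \<in> Obj E \<Longrightarrow> f \<in> Hom E i j \<Longrightarrow> g \<in> Hom E j k \<Longrightarrow>
     on_hom P i k (Comp E i j k g f) = Comp C i j k (on_hom P j k g) (on_hom P i j f)"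
  using linear_extension_functor linear_extension_obj(2) unfolding is_functor_def by metis+

lemma linear_extension_surj:
  "i \<in> Obj E \<Longrightarrow> j \<in> Obj E \<Longrightarrow> \<phi> \<in> Hom C i j \<Longrightarrow> \<exists>f\<in>Hom E i j. on_hom P i j f = \<phi>"
  using linear_extension_full linear_extension_obj(2) unfolding full_functor_def by (metis imageE)

lemma linear_extension_action:
  "i \<in> Obj E \<Longrightarrow> j \<in> Obj E \<Longrightarrow> group_action (BGrp D i j) (Hom E i j) (act i j)"
  and linear_extension_fibre:
  "i \<in> Obj E \<Longrightarrow> j \<in> Obj E \<Longrightarrow> f \<in> Hom E i j \<Longrightarrow> a \<in> carrier (BGrp D i j) \<Longrightarrow>
     on_hom P i j (act i j a f) = on_hom P i j f"
  and linear_extension_transitive: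
  "i \<in> Obj E \<Longrightarrow> j \<in> Obj E \<Longrightarrow> f \<in> Hom E i j \<Longrightarrow> g \<in> Hom E i j \<Longrightarrow>
     on_hom P i j f = on_hom P i j g \<Longrightarrow> \<exists>a\<in>carrier (BGrp D i j). act i j a f = g"
  and linear_extension_free:
  "i \<in> Obj E \<Longrightarrow> j \<in> Obj E \<Longrightarrow> f \<in> Hom E i j \<Longrightarrow> a \<in> carrier (BGrp D i j) \<Longrightarrow>
     act i j a f = f \<Longrightarrow> a = \<one>\<^bsub>BGrp D i j\<^esub>"
  and linear_extension_comp:
  "i \<in> Obj E \<Longrightarrow> j \<in> Obj E \<Longrightarrow> k \<in> Obj E \<Longrightarrow> g \<in> Hom E j k \<Longrightarrow> f \<in> Hom E i j \<Longrightarrow>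
     a \<in> carrier (BGrp D j k) \<Longrightarrow> b \<in> carrier (BGrp D i j) \<Longrightarrow>
     Comp E i j k (act j k a g) (act i j b f)
       = act i k
          (BMap D i j i k (Ident C i) (on_hom P j k g) b \<otimes>\<^bsub>BGrp D i k\<^esub>
           BMap D j k i k (on_hom P i j f) (Ident C k) a)
          (Comp E i j k g f)"
  using L by (simp_all add: linear_extension_def)

lemma linear_extension_act_closed:
  "i \<in> Obj E \<Longrightarrow> j \<in> Obj E \<Longrightarrow> f \<in> Hom E i j \<Longrightarrow> a \<in> carrier (BGrp D i j) \<Longrightarrow> act i j a f \<in> Hom E i j"
  by (rule group_action.element_image[OF linear_extension_action _ _ refl])

lemma linear_extension_group: "i \<in> Obj E \<Longrightarrow> j \<in> Obj E \<Longrightarrow> comm_group (BGrp D i j)"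
  using bifunctorD(2)[OF linear_extension_bifunctor] by (simp add: linear_extension_obj)

lemma linear_extension_act_one:
  "i \<in> Obj E \<Longrightarrow> j \<in> Obj E \<Longrightarrow> f \<in> Hom E i j \<Longrightarrow> act i j \<one>\<^bsub>BGrp D i j\<^esub> f = f"
  by (rule group_action_one[OF linear_extension_action])

lemma linear_extension_act_mult:
  "i \<in> Obj E \<Longrightarrow> j \<in> Obj E \<Longrightarrow> f \<in> Hom E i j \<Longrightarrow> a \<in> carrier (BGrp D i j) \<Longrightarrow> b \<in> carrier (BGrp D i j) \<Longrightarrow>
     act i j (a \<otimes>\<^bsub>BGrp D i j\<^esub> b) f = act i j a (act i j b f)"
  by (rule group_action.composition_rule[OF linear_extension_action])

text \<open>A lift \<open>g\<close> of the inverse of the image of \<open>f\<close> is a left inverse of \<open>f\<close> up to the action of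
  \<open>D(i, i)\<close>. The error can be moved into \<open>D(j, i)\<close>, because \<open>f\<close> acts invertibly on \<open>D\<close>, and
  correcting \<open>g\<close> by it gives a left inverse. This one has itself a left inverse, which must be \<open>f\<close>.\<close>

lemma linear_extension_left_inverse:
  assumes o: "i \<in> Obj E" "j \<in> Obj E" and f: "f \<in> Hom E i j" and \<gamma>: "\<gamma> \<in> Hom C j i"
    and eq: "Comp C i j i \<gamma> (on_hom P i j f) = Ident C i"
  shows "\<exists>g\<in>Hom E j i. Comp E i j i g f = Ident E i \<and> on_hom P j i g = \<gamma>"
proof -
  note oC = linear_extension_obj(1)
  note cat = linear_extension_category
  note idC = ident_closed[OF cat(2), unfolded oC]
  obtain g where g: "g \<in> Hom E j i" and Pg: "on_hom P j i g = \<gamma>"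
    using linear_extension_surj[OF o(2,1) \<gamma>] by blast
  have "on_hom P i i (Comp E i j i g f) = on_hom P i i (Ident E i)"
    using o f g eq Pg by (simp add: linear_extension_func)
  then obtain a where a: "a \<in> carrier (BGrp D i i)" "act i i a (Comp E i j i g f) = Ident E i"
    using linear_extension_transitive[OF o(1) o(1)] o f g comp_closed[OF cat(1)] ident_closed[OF cat(1)]
    by metis
  define b where "b = BMap D i i j i \<gamma> (Ident C i) a"
  have b: "b \<in> carrier (BGrp D j i)"
    unfolding b_def using o \<gamma> a(1) idC
    by (intro bifunctor_map_closed[OF linear_extension_bifunctor, unfolded oC]) auto
  have "Comp C i i i (Ident C i) (Ident C i) = Ident C i"
    using o by (simp add: comp_ident_left[OF cat(2)] oC idC)
  then have "BMap D j i i i (on_hom P i j f) (Ident C i) b = a"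
    unfolding b_def using o f \<gamma> eq a(1) idC linear_extension_func(1)
    by (simp add: bifunctorD(5)[OF linear_extension_bifunctor, unfolded oC, symmetric]
        bifunctorD(4)[OF linear_extension_bifunctor, unfolded oC])
  then have "Comp E i j i (act j i b g) (act i j \<one>\<^bsub>BGrp D i j\<^esub> f) = Ident E i"
    using o f g a b idC linear_extension_func(1)
      group.is_monoid[OF comm_group.axioms(2)[OF linear_extension_group]]
    by (simp add: linear_extension_comp bifunctor_map_one[OF linear_extension_bifunctor, unfolded oC]
        Group.monoid.l_one Group.monoid.one_closed)
  then show ?thesis
    using linear_extension_act_closed[OF o(2,1) g b] linear_extension_fibre[OF o(2,1) g b] o f Pg
    by (auto simp: linear_extension_act_one)
qed

lemma linear_extension_reflects_isos: "reflects_isos E C P"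
  unfolding reflects_isos_def
proof (intro ballI impI)
  fix i j f assume o: "i \<in> Obj E" "j \<in> Obj E" and f: "f \<in> Hom E i j"
    and "iso_in C (on_obj P i) (on_obj P j) (on_hom P i j f)"
  then obtain \<gamma> where \<gamma>: "\<gamma> \<in> Hom C j i" "Comp C i j i \<gamma> (on_hom P i j f) = Ident C i"
    "Comp C j i j (on_hom P i j f) \<gamma> = Ident C j"
    by (auto simp: iso_in_def linear_extension_obj)
  obtain g where g: "g \<in> Hom E j i" "Comp E i j i g f = Ident E i" "on_hom P j i g = \<gamma>"
    using linear_extension_left_inverse[OF o f \<gamma>(1,2)] by blast
  obtain h where h: "h \<in> Hom E i j" "Comp E j i j h g = Ident E j"
    using linear_extension_left_inverse[OF o(2,1) g(1) linear_extension_func(1)[OF o f]] g(3) \<gamma>(3) by blast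
  have "h = f"
    using comp_assoc[OF linear_extension_category(1) o(1,2,1,2) f g(1) h(1)] o f g h
    by (simp add: comp_ident_left[OF linear_extension_category(1)]
        comp_ident_right[OF linear_extension_category(1)])
  then show "iso_in E i j f"
    unfolding iso_in_def using f g h by blast
qed

lemma linear_extension_bijective: "bijective_on_iso_classes E C P"
  by (rule bijective_on_iso_classesI[OF linear_extension_full linear_extension_identity
        linear_extension_reflects_isos])

end

section \<open>Natural transformations of bifunctors and their cokernels\<close>

lemma natural_bifuncD:
  assumes "natural_bifunc C D E \<tau>"
  shows "bifunctor C D" "bifunctor C E"
    and "\<And>i j. i \<in> Obj C \<Longrightarrow> j \<in> Obj C \<Longrightarrow> \<tau> i j \<in> hom (BGrp D i j) (BGrp E i j)"
    and "\<And>i j i' j' \<phi> \<psi> d. i \<in> Obj C \<Longrightarrow> j \<in> Obj C \<Longrightarrow> i' \<in> Obj C \<Longrightarrow> j' \<in> Obj C \<Longrightarrow>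
      \<phi> \<in> Hom C i' i \<Longrightarrow> \<psi> \<in> Hom C j j' \<Longrightarrow> d \<in> carrier (BGrp D i j) \<Longrightarrow>
      \<tau> i' j' (BMap D i j i' j' \<phi> \<psi> d) = BMap E i j i' j' \<phi> \<psi> (\<tau> i j d)"
  using assms by (simp_all add: natural_bifunc_def)

text \<open>Each law for \<open>D\<close> holds after applying \<open>\<sigma>\<close>, because it
  holds in \<open>E\<close> and \<open>\<sigma>\<close> intertwines the maps; injectivity then
  cancels \<open>\<sigma>\<close>. It serves for \<open>D_sim\<close>, where only closedness and
  compatibility with \<open>rho\<close> remain to be checked.\<close>

lemma natural_bifunc_of_injective:
  assumes E: "bifunctor C E"
    and grp: "\<And>i j. i \<in> Obj C \<Longrightarrow> j \<in> Obj C \<Longrightarrow> comm_group (BGrp D i j)"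
    and cl: "\<And>i j i' j' \<phi> \<psi> d. i \<in> Obj C \<Longrightarrow> j \<in> Obj C \<Longrightarrow> i' \<in> Obj C \<Longrightarrow> j' \<in> Obj C \<Longrightarrow>
      \<phi> \<in> Hom C i' i \<Longrightarrow> \<psi> \<in> Hom C j j' \<Longrightarrow> d \<in> carrier (BGrp D i j) \<Longrightarrow>
      BMap D i j i' j' \<phi> \<psi> d \<in> carrier (BGrp D i' j')"
    and hom: "\<And>i j. i \<in> Obj C \<Longrightarrow> j \<in> Obj C \<Longrightarrow> \<sigma> i j \<in> hom (BGrp D i j) (BGrp E i j)"
    and inj: "\<And>i j. i \<in> Obj C \<Longrightarrow> j \<in> Obj C \<Longrightarrow> inj_on (\<sigma> i j) (carrier (BGrp D i j))"
    and nat: "\<And>i j i' j' \<phi> \<psi> d. i \<in> Obj C \<Longrightarrow> j \<in> Obj C \<Longrightarrow> i' \<in> Obj C \<Longrightarrow> j' \<in> Obj C \<Longrightarrow>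
      \<phi> \<in> Hom C i' i \<Longrightarrow> \<psi> \<in> Hom C j j' \<Longrightarrow> d \<in> carrier (BGrp D i j) \<Longrightarrow>
      \<sigma> i' j' (BMap D i j i' j' \<phi> \<psi> d) = BMap E i j i' j' \<phi> \<psi> (\<sigma> i j d)"
  shows "natural_bifunc C D E \<sigma>"
proof -
  note C = bifunctorD(1)[OF E]
  note mcl = Group.monoid.m_closed[OF group.is_monoid[OF comm_group.axioms(2)[OF grp]]]
  note scl = hom_in_carrier[OF hom]
  have eqI: "x = y" if "i \<in> Obj C" "j \<in> Obj C" "x \<in> carrier (BGrp D i j)" "y \<in> carrier (BGrp D i j)"
    "\<sigma> i j x = \<sigma> i j y" for i j x y
    using inj_onD[OF inj] that by blast
  have "bifunctor C D"
    unfolding bifunctor_def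
  proof (intro conjI ballI homI)
    fix i j d assume *: "i \<in> Obj C" "j \<in> Obj C" "d \<in> carrier (BGrp D i j)"
    show "BMap D i j i j (Ident C i) (Ident C j) d = d"
      by (rule eqI[of i j])
        (use * in \<open>simp_all add: nat cl ident_closed[OF C] bifunctorD(4)[OF E] scl\<close>)
  next
    fix i j i' j' \<phi> \<psi> d d'
    assume *: "i \<in> Obj C" "j \<in> Obj C" "i' \<in> Obj C" "j' \<in> Obj C" "\<phi> \<in> Hom C i' i" "\<psi> \<in> Hom C j j'"
      "d \<in> carrier (BGrp D i j)" "d' \<in> carrier (BGrp D i j)"
    show "BMap D i j i' j' \<phi> \<psi> (d \<otimes>\<^bsub>BGrp D i j\<^esub> d') =
        BMap D i j i' j' \<phi> \<psi> d \<otimes>\<^bsub>BGrp D i' j'\<^esub> BMap D i j i' j' \<phi> \<psi> d'"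
      by (rule eqI[of i' j'])
        (use * in \<open>simp_all add: nat cl mcl hom_mult[OF hom] hom_mult[OF bifunctorD(3)[OF E]] scl\<close>)
  next
    fix i j i' j' i'' j'' \<phi> \<phi>' \<psi> \<psi>' d
    assume *: "i \<in> Obj C" "j \<in> Obj C" "i' \<in> Obj C" "j' \<in> Obj C" "i'' \<in> Obj C" "j'' \<in> Obj C"
      "\<phi> \<in> Hom C i' i" "\<phi>' \<in> Hom C i'' i'" "\<psi> \<in> Hom C j j'" "\<psi>' \<in> Hom C j' j''"
      "d \<in> carrier (BGrp D i j)"
    have **: "Comp C i'' i' i \<phi> \<phi>' \<in> Hom C i'' i" "Comp C j j' j'' \<psi>' \<psi> \<in> Hom C j j''"
      using * by (simp_all add: comp_closed[OF C])
    show "BMap D i j i'' j'' (Comp C i'' i' i \<phi> \<phi>') (Comp C j j' j'' \<psi>' \<psi>) d =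
       BMap D i' j' i'' j'' \<phi>' \<psi>' (BMap D i j i' j' \<phi> \<psi> d)"
    proof (rule eqI[of i'' j''])
      have "\<sigma> i'' j'' (BMap D i' j' i'' j'' \<phi>' \<psi>' (BMap D i j i' j' \<phi> \<psi> d)) =
          BMap E i' j' i'' j'' \<phi>' \<psi>' (BMap E i j i' j' \<phi> \<psi> (\<sigma> i j d))"
        using * by (simp add: nat cl)
      then show "\<sigma> i'' j'' (BMap D i j i'' j'' (Comp C i'' i' i \<phi> \<phi>') (Comp C j j' j'' \<psi>' \<psi>) d) =
          \<sigma> i'' j'' (BMap D i' j' i'' j'' \<phi>' \<psi>' (BMap D i j i' j' \<phi> \<psi> d))"
        using * ** by (simp add: nat bifunctorD(5)[OF E] scl)
    qed (use * ** in \<open>simp_all add: cl\<close>)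
  qed (simp_all add: C grp cl)
  then show ?thesis
    unfolding natural_bifunc_def using E hom nat by simp
qed

lemma bifunctor_pullback:
  assumes D: "bifunctor C D" and P: "is_functor B C P"
  shows "bifunctor B (pullback_bifunc P D)"
proof -
  have *: "category B" "\<And>i. i \<in> Obj B \<Longrightarrow> on_obj P i \<in> Obj C"
    "\<And>i j f. i \<in> Obj B \<Longrightarrow> j \<in> Obj B \<Longrightarrow> f \<in> Hom B i j \<Longrightarrow>
      on_hom P i j f \<in> Hom C (on_obj P i) (on_obj P j)"
    "\<And>i. i \<in> Obj B \<Longrightarrow> on_hom P i i (Ident B i) = Ident C (on_obj P i)"
    "\<And>i j k f g. i \<in> Obj B \<Longrightarrow> j \<in> Obj B \<Longrightarrow> k \<in> Obj B \<Longrightarrow> f \<in> Hom B i j \<Longrightarrow> g \<in> Hom B j k \<Longrightarrow>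
      on_hom P i k (Comp B i j k g f)
          = Comp C (on_obj P i) (on_obj P j) (on_obj P k) (on_hom P j k g) (on_hom P i j f)"
    using P by (simp_all add: is_functor_def)
  note D' = bifunctorD[OF D]
  show ?thesis
    unfolding bifunctor_def pullback_bifunc_def by (simp add: * D')
qed

context
  fixes C :: "('o, 'm) cat" and D :: "('o, 'm, 'd) bifunc" and E :: "('o, 'm, 'e) bifunc" and \<sigma>
  assumes nat: "natural_bifunc C D E \<sigma>"
begin

private lemma D: "bifunctor C D" and E: "bifunctor C E"
  using natural_bifuncD(1,2)[OF nat] .

private abbreviation "\<C> \<equiv> coker_bifunc D E \<sigma>"
private abbreviation "\<pi> \<equiv> coker_proj D E \<sigma>"

lemma natural_bifunc_image_normal:
  assumes "i \<in> Obj C" "j \<in> Obj C"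
  shows "\<sigma> i j ` carrier (BGrp D i j) \<lhd> BGrp E i j"
proof -
  interpret E: comm_group "BGrp E i j" using bifunctorD(2)[OF E] assms .
  interpret group_hom "BGrp D i j" "BGrp E i j" "\<sigma> i j"
    using natural_bifuncD(3)[OF nat assms] bifunctorD(2)[OF D assms] E.group_axioms
    by (simp add: group_hom_def group_hom_axioms_def comm_group.axioms(2))
  show ?thesis
    by (rule E.subgroup_imp_normal[OF img_is_subgroup])
qed

lemma coker_proj_eq_iff:
  assumes o: "i \<in> Obj C" "j \<in> Obj C" and e: "e \<in> carrier (BGrp E i j)" "e' \<in> carrier (BGrp E i j)"
  shows "\<pi> i j e = \<pi> i j e' \<longleftrightarrow>
    (\<exists>d\<in>carrier (BGrp D i j). e' = \<sigma> i j d \<otimes>\<^bsub>BGrp E i j\<^esub> e)"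
proof -
  interpret normal "\<sigma> i j ` carrier (BGrp D i j)" "BGrp E i j"
    using natural_bifunc_image_normal[OF o] .
  have "\<pi> i j e = \<pi> i j e' \<longleftrightarrow>
      e' \<in> (\<sigma> i j ` carrier (BGrp D i j)) #>\<^bsub>BGrp E i j\<^esub> e"
    unfolding coker_proj_def using e repr_independence[OF _ e(1) is_subgroup] rcos_self[OF e(2) is_subgroup]
    by auto
  also have "\<dots> \<longleftrightarrow> (\<exists>d\<in>carrier (BGrp D i j). e' = \<sigma> i j d \<otimes>\<^bsub>BGrp E i j\<^esub> e)"
    by (auto simp: r_coset_def)
  finally show ?thesis .
qed

lemma coker_group_simps:
  "carrier (BGrp \<C> i j) = \<pi> i j ` carrier (BGrp E i j)"
  "\<one>\<^bsub>BGrp \<C> i j\<^esub> = \<sigma> i j ` carrier (BGrp D i j)"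
  "i \<in> Obj C \<Longrightarrow> j \<in> Obj C \<Longrightarrow> e \<in> carrier (BGrp E i j) \<Longrightarrow> e' \<in> carrier (BGrp E i j) \<Longrightarrow>
    \<pi> i j e \<otimes>\<^bsub>BGrp \<C> i j\<^esub> \<pi> i j e' =
    \<pi> i j (e \<otimes>\<^bsub>BGrp E i j\<^esub> e')"
  using normal.rcos_sum[OF natural_bifunc_image_normal]
  by (auto simp: coker_bifunc_def coker_proj_def carrier_FactGroup)

lemma coker_proj_one:
  assumes o: "i \<in> Obj C" "j \<in> Obj C"
  shows "\<pi> i j \<one>\<^bsub>BGrp E i j\<^esub> = \<one>\<^bsub>BGrp \<C> i j\<^esub>"
proof -
  interpret normal "\<sigma> i j ` carrier (BGrp D i j)" "BGrp E i j"
    using natural_bifunc_image_normal[OF o] .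
  show ?thesis
    using coset_mult_one[OF subset] by (simp add: coker_group_simps coker_proj_def)
qed

text \<open>Changing the representative by \<open>\<sigma> i j d\<close> changes its image by
  \<open>\<sigma>\<close> applied to the image of \<open>d\<close>, by naturality. The union over
  the coset in \<open>coker_bifunc\<close> is therefore constant.\<close>

lemma coker_map_proj:
  assumes o: "i \<in> Obj C" "j \<in> Obj C" "i' \<in> Obj C" "j' \<in> Obj C"
    and h: "\<phi> \<in> Hom C i' i" "\<psi> \<in> Hom C j j'" and e: "e \<in> carrier (BGrp E i j)"
  shows "BMap \<C> i j i' j' \<phi> \<psi> (\<pi> i j e) =
    \<pi> i' j' (BMap E i j i' j' \<phi> \<psi> e)"
proof -
  interpret normal "\<sigma> i j ` carrier (BGrp D i j)" "BGrp E i j"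
    using natural_bifunc_image_normal[OF o(1,2)] .
  note cl = bifunctor_map_closed[OF E o h]
  have "\<pi> i' j' (BMap E i j i' j' \<phi> \<psi> e') = \<pi> i' j' (BMap E i j i' j' \<phi> \<psi> e)"
    if e': "e' \<in> \<pi> i j e" for e'
  proof -
    obtain d where d: "d \<in> carrier (BGrp D i j)" "e' = \<sigma> i j d \<otimes>\<^bsub>BGrp E i j\<^esub> e"
      using e' unfolding coker_proj_def r_coset_def by blast
    have d': "\<sigma> i j d \<in> carrier (BGrp E i j)"
      using d natural_bifuncD(3)[OF nat o(1,2)] by (rule_tac hom_in_carrier)
    have "BMap E i j i' j' \<phi> \<psi> e' =
        \<sigma> i' j' (BMap D i j i' j' \<phi> \<psi> d) \<otimes>\<^bsub>BGrp E i' j'\<^esub> BMap E i j i' j' \<phi> \<psi> e"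
      using d e d' hom_mult[OF bifunctorD(3)[OF E o h]] by (simp add: natural_bifuncD(4)[OF nat o h])
    moreover have "e' \<in> carrier (BGrp E i j)"
      using d d' e by simp
    ultimately show ?thesis
      using coker_proj_eq_iff[OF o(3,4) cl[OF e] cl] bifunctor_map_closed[OF D o h d(1)] by blast
  qed
  moreover have "e \<in> \<pi> i j e"
    unfolding coker_proj_def by (rule rcos_self[OF e is_subgroup])
  ultimately have "(\<Union>e'\<in>\<pi> i j e. \<pi> i' j' (BMap E i j i' j' \<phi> \<psi> e')) =
      \<pi> i' j' (BMap E i j i' j' \<phi> \<psi> e)"
    by (intro UN_constant_eq ballI)
  then show ?thesis
    by (simp add: coker_bifunc_def coker_proj_def)
qed

text \<open>Every element of the cokernel is a value of the projection, and the projection commutes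
  with products and with the maps, so all laws are inherited from \<open>E\<close>.\<close>

lemma natural_bifunc_coker: "natural_bifunc C E \<C> \<pi>"
proof -
  note C = bifunctorD(1)[OF E]
  note ecl = bifunctor_map_closed[OF E]
  have "bifunctor C \<C>"
    unfolding bifunctor_def
  proof (intro conjI ballI homI)
    fix i j assume o: "i \<in> Obj C" "j \<in> Obj C"
    show "comm_group (BGrp \<C> i j)"
      using comm_group.abelian_FactGroup[OF bifunctorD(2)[OF E o]]
        normal_imp_subgroup[OF natural_bifunc_image_normal[OF o]]
      by (simp add: coker_bifunc_def)
    fix d assume "d \<in> carrier (BGrp \<C> i j)"
    then show "BMap \<C> i j i j (Ident C i) (Ident C j) d = d"
      using o by (auto simp: coker_group_simps coker_map_proj ident_closed[OF C] bifunctorD(4)[OF E])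
  next
    fix i j i' j' \<phi> \<psi> d d'
    assume *: "i \<in> Obj C" "j \<in> Obj C" "i' \<in> Obj C" "j' \<in> Obj C" "\<phi> \<in> Hom C i' i" "\<psi> \<in> Hom C j j'"
    interpret E: comm_group "BGrp E i j" using bifunctorD(2)[OF E] * by simp
    assume d: "d \<in> carrier (BGrp \<C> i j)"
    then show "BMap \<C> i j i' j' \<phi> \<psi> d \<in> carrier (BGrp \<C> i' j')"
      using * by (auto simp: coker_group_simps coker_map_proj ecl)
    assume "d' \<in> carrier (BGrp \<C> i j)"
    with d * show "BMap \<C> i j i' j' \<phi> \<psi> (d \<otimes>\<^bsub>BGrp \<C> i j\<^esub> d') =
        BMap \<C> i j i' j' \<phi> \<psi> d \<otimes>\<^bsub>BGrp \<C> i' j'\<^esub>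
        BMap \<C> i j i' j' \<phi> \<psi> d'"
      by (auto simp: coker_group_simps coker_map_proj ecl hom_mult[OF bifunctorD(3)[OF E]])
  next
    fix i j i' j' i'' j'' \<phi> \<phi>' \<psi> \<psi>' d
    assume "i \<in> Obj C" "j \<in> Obj C" "i' \<in> Obj C" "j' \<in> Obj C" "i'' \<in> Obj C" "j'' \<in> Obj C"
      "\<phi> \<in> Hom C i' i" "\<phi>' \<in> Hom C i'' i'" "\<psi> \<in> Hom C j j'" "\<psi>' \<in> Hom C j' j''"
      "d \<in> carrier (BGrp \<C> i j)"
    then show "BMap \<C> i j i'' j'' (Comp C i'' i' i \<phi> \<phi>') (Comp C j j' j'' \<psi>' \<psi>) d =
       BMap \<C> i' j' i'' j'' \<phi>' \<psi>' (BMap \<C> i j i' j' \<phi> \<psi> d)"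
      by (auto simp: coker_group_simps coker_map_proj comp_closed[OF C] ecl bifunctorD(5)[OF E])
  qed (simp add: C)
  then show ?thesis
    unfolding natural_bifunc_def using E by (simp add: hom_def coker_group_simps coker_map_proj)
qed

lemma short_exact_coker:
  assumes inj: "\<And>i j. i \<in> Obj C \<Longrightarrow> j \<in> Obj C \<Longrightarrow> inj_on (\<sigma> i j) (carrier (BGrp D i j))"
  shows "short_exact_bifunc C D E \<C> \<sigma> (\<pi>)"
  unfolding short_exact_bifunc_def
proof (intro conjI ballI)
  fix i j assume o: "i \<in> Obj C" "j \<in> Obj C"
  interpret normal "\<sigma> i j ` carrier (BGrp D i j)" "BGrp E i j"
    using natural_bifunc_image_normal[OF o] .
  show "\<sigma> i j ` carrier (BGrp D i j) =
      kernel (BGrp E i j) (BGrp \<C> i j) (\<pi> i j)"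
  proof (intro equalityI subsetI)
    fix e assume e: "e \<in> \<sigma> i j ` carrier (BGrp D i j)"
    with subset have "e \<in> carrier (BGrp E i j)" by blast
    with e show "e \<in> kernel (BGrp E i j) (BGrp \<C> i j) (\<pi> i j)"
      by (simp only: kernel_def coker_group_simps coker_proj_def mem_Collect_eq coset_join2[OF _ is_subgroup] simp_thms)
  next
    fix e assume "e \<in> kernel (BGrp E i j) (BGrp \<C> i j) (\<pi> i j)"
    then show "e \<in> \<sigma> i j ` carrier (BGrp D i j)"
      unfolding kernel_def coker_group_simps coker_proj_def
      using coset_join1[OF _ _ is_subgroup] by blast
  qed
qed (simp_all add: nat natural_bifunc_coker inj coker_group_simps)

end

section \<open>Two linear extensions obtained from one extension and a sub-bifunctor\<close>

locale sub_extension =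
  fixes E :: "('o, 'm) cat" and S D2 act D1 \<sigma> R
  assumes S: "congruence E S"
    and ext: "linear_extension D2 E (quotient_cat E S) (quotient_func S) act"
    and nat: "natural_bifunc (quotient_cat E S) D1 D2 \<sigma>"
    and inj: "\<And>i j. i \<in> Obj E \<Longrightarrow> j \<in> Obj E \<Longrightarrow> inj_on (\<sigma> i j) (carrier (BGrp D1 i j))"
    and R_eq: "\<And>i j. i \<in> Obj E \<Longrightarrow> j \<in> Obj E \<Longrightarrow>
      R i j = {(f, g). f \<in> Hom E i j \<and> (\<exists>a\<in>carrier (BGrp D1 i j). g = act i j (\<sigma> i j a) f)}"
begin

lemmas act_closed = linear_extension_act_closed[OF ext]
  and act_one = linear_extension_act_one[OF ext]
  and act_mult = linear_extension_act_mult[OF ext]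
  and act_comp = linear_extension_comp[OF ext, unfolded quotient_func_simps quotient_cat_simps]
  and bmap_closed1 = bifunctor_map_closed[OF natural_bifuncD(1)[OF nat], unfolded quotient_cat_simps]
  and bmap_closed2 = bifunctor_map_closed[OF natural_bifuncD(2)[OF nat], unfolded quotient_cat_simps]
  and group1 = bifunctorD(2)[OF natural_bifuncD(1)[OF nat], unfolded quotient_cat_simps]
  and group2 = bifunctorD(2)[OF natural_bifuncD(2)[OF nat], unfolded quotient_cat_simps]
  and hom_sigma = natural_bifuncD(3)[OF nat, unfolded quotient_cat_simps]
  and sigma_natural = natural_bifuncD(4)[OF nat, unfolded quotient_cat_simps]
  and E_comp = comp_closed[OF congruence_category[OF S]]
  and E_ident = ident_closed[OF congruence_category[OF S]]

lemmas sigma_closed = hom_in_carrier[OF hom_sigma]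
  and sigma_mult = hom_mult[OF hom_sigma]
  and mult_closed1 = Group.monoid.m_closed[OF group.is_monoid[OF comm_group.axioms(2)[OF group1]]]
  and mult_closed2 = Group.monoid.m_closed[OF group.is_monoid[OF comm_group.axioms(2)[OF group2]]]

lemma sigma_one:
  "i \<in> Obj E \<Longrightarrow> j \<in> Obj E \<Longrightarrow> \<sigma> i j \<one>\<^bsub>BGrp D1 i j\<^esub> = \<one>\<^bsub>BGrp D2 i j\<^esub>"
  by (rule hom_one[OF hom_sigma comm_group.axioms(2)[OF group1] comm_group.axioms(2)[OF group2]])

lemma S_class_closed: "i \<in> Obj E \<Longrightarrow> j \<in> Obj E \<Longrightarrow> f \<in> Hom E i j \<Longrightarrow> S i j `` {f} \<in> Hom E i j // S i j"
  by (rule quotientI)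

lemma act_related:
  assumes "i \<in> Obj E" "j \<in> Obj E" "f \<in> Hom E i j" "a \<in> carrier (BGrp D2 i j)"
  shows "(f, act i j a f) \<in> S i j"
  using linear_extension_fibre[OF ext assms]
    congruence_class_eq_iff[OF S assms(1-3) act_closed[OF assms]] by simp

lemma R_subset:
  assumes "i \<in> Obj E" "j \<in> Obj E"
  shows "R i j \<subseteq> S i j"
  using assms by (auto simp: R_eq act_related sigma_closed)

lemma R_equiv:
  assumes o: "i \<in> Obj E" "j \<in> Obj E"
  shows "equiv (Hom E i j) (R i j)"
proof (rule equivI)
  interpret D1: comm_group "BGrp D1 i j" using group1[OF o] .
  show "R i j \<subseteq> Hom E i j \<times> Hom E i j"
    using o by (auto simp: R_eq act_closed sigma_closed)
  show "refl_on (Hom E i j) (R i j)"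
  proof (rule refl_onI)
    fix f assume "f \<in> Hom E i j"
    then have "f = act i j (\<sigma> i j \<one>\<^bsub>BGrp D1 i j\<^esub>) f"
      using o by (simp add: sigma_one act_one)
    then show "(f, f) \<in> R i j"
      using o \<open>f \<in> Hom E i j\<close> D1.one_closed unfolding R_eq[OF o] by blast
  qed
  show "sym (R i j)"
  proof (rule symI)
    fix f g assume "(f, g) \<in> R i j"
    then obtain a where f: "f \<in> Hom E i j" and a: "a \<in> carrier (BGrp D1 i j)"
      and g: "g = act i j (\<sigma> i j a) f"
      using o by (auto simp: R_eq)
    have "act i j (\<sigma> i j (inv\<^bsub>BGrp D1 i j\<^esub> a)) g = act i j (\<sigma> i j (inv\<^bsub>BGrp D1 i j\<^esub> a \<otimes>\<^bsub>BGrp D1 i j\<^esub> a)) f"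
      by (simp only: g sigma_mult[OF o D1.inv_closed[OF a] a]
          act_mult[OF o f sigma_closed[OF o D1.inv_closed[OF a]] sigma_closed[OF o a]])
    then have "f = act i j (\<sigma> i j (inv\<^bsub>BGrp D1 i j\<^esub> a)) g"
      using o f a by (simp add: sigma_one act_one)
    moreover have "g \<in> Hom E i j"
      unfolding g by (rule act_closed[OF o f sigma_closed[OF o a]])
    ultimately show "(g, f) \<in> R i j"
      unfolding R_eq[OF o] by (intro CollectI case_prodI conjI bexI[OF _ D1.inv_closed[OF a]])
  qed
  show "trans (R i j)"
  proof (rule transI)
    fix f g h assume "(f, g) \<in> R i j" "(g, h) \<in> R i j"
    then obtain a b where f: "f \<in> Hom E i j" and a: "a \<in> carrier (BGrp D1 i j)" "b \<in> carrier (BGrp D1 i j)"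
      and g: "g = act i j (\<sigma> i j a) f" "h = act i j (\<sigma> i j b) g"
      using o by (auto simp: R_eq)
    have "h = act i j (\<sigma> i j (b \<otimes>\<^bsub>BGrp D1 i j\<^esub> a)) f"
      using o f a g by (simp add: act_mult sigma_mult sigma_closed)
    then show "(f, h) \<in> R i j"
      unfolding R_eq[OF o] using f a by blast
  qed
qed

text \<open>Naturality of \<open>\<sigma>\<close> rewrites the two correction terms of the
  composition law for \<open>D2\<close> as images of elements of \<open>D1\<close>, and
  \<open>\<sigma>\<close> is additive. Both the compatibility of \<open>R\<close> with composition
  and the composition law for \<open>D1\<close> are instances.\<close>

lemma act_sigma_comp:
  assumes o: "i \<in> Obj E" "j \<in> Obj E" "k \<in> Obj E" and f: "f \<in> Hom E i j" and g: "g \<in> Hom E j k"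
    and a: "a \<in> carrier (BGrp D1 j k)" and b: "b \<in> carrier (BGrp D1 i j)"
  shows "Comp E i j k (act j k (\<sigma> j k a) g) (act i j (\<sigma> i j b) f) =
    act i k (\<sigma> i k (BMap D1 i j i k (S i i `` {Ident E i}) (S j k `` {g}) b \<otimes>\<^bsub>BGrp D1 i k\<^esub>
                     BMap D1 j k i k (S i j `` {f}) (S k k `` {Ident E k}) a)) (Comp E i j k g f)"
  using assms
  by (simp add: act_comp sigma_closed sigma_natural sigma_mult S_class_closed E_ident bmap_closed1)

lemma R_congruence: "congruence E R"
  unfolding congruence_def
proof (intro conjI ballI allI impI)
  fix i j k f f' g g'
  assume o: "i \<in> Obj E" "j \<in> Obj E" "k \<in> Obj E" and "(f, f') \<in> R i j" "(g, g') \<in> R j k"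
  then obtain a b where f: "f \<in> Hom E i j" "b \<in> carrier (BGrp D1 i j)" "f' = act i j (\<sigma> i j b) f"
    and g: "g \<in> Hom E j k" "a \<in> carrier (BGrp D1 j k)" "g' = act j k (\<sigma> j k a) g"
    by (auto simp: R_eq)
  show "(Comp E i j k g f, Comp E i j k g' f') \<in> R i k"
    unfolding R_eq[OF o(1,3)] f g act_sigma_comp[OF o f(1) g(1,2) f(2)]
    using o f g
    by (auto intro!: E_comp mult_closed1 bmap_closed1 S_class_closed E_ident)
qed (simp_all add: congruence_category[OF S] R_equiv)

abbreviation (input) "toS \<equiv> induced_quotient_func S"
abbreviation (input) "pullD \<equiv> pullback_bifunc toS D1"
abbreviation (input) "\<C> \<equiv> coker_bifunc D1 D2 \<sigma>"
abbreviation (input) "\<pi> \<equiv> coker_proj D1 D2 \<sigma>"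

lemma induced_class:
  "i \<in> Obj E \<Longrightarrow> j \<in> Obj E \<Longrightarrow> f \<in> Hom E i j \<Longrightarrow>
    on_hom toS i j (R i j `` {f}) = S i j `` {f}"
  by (rule induced_quotient_class[OF R_congruence S R_subset])

lemma full_functor_to_S: "full_functor (quotient_cat E R) (quotient_cat E S) toS"
  by (rule full_functor_induced_quotient[OF R_congruence S R_subset])

lemma act_R: "i \<in> Obj E \<Longrightarrow> j \<in> Obj E \<Longrightarrow> f \<in> Hom E i j \<Longrightarrow> a \<in> carrier (BGrp D1 i j) \<Longrightarrow>
   R i j `` {act i j (\<sigma> i j a) f} = R i j `` {f}"
  by (rule sym, rule equiv_class_eq[OF R_equiv]) (auto simp: R_eq)

text \<open>Transitivity on fibres is the description of \<open>R\<close> as an orbit relation;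
  freeness is that of \<open>D2\<close> combined with injectivity of \<open>\<sigma>\<close>. Both
  \<open>R\<close> and \<open>act1\<close> are parameters because \<open>sim_rel\<close> and
  \<open>act_sim\<close> have definitions of their own, which agree with the orbit relation and the
  restricted action only on objects and on group elements. Since \<open>D1\<close> lives on the
  coarser quotient, it is pulled back along the functor between the quotients.\<close>

lemma linear_extension_quotient:
  assumes act1: "\<And>i j a. i \<in> Obj E \<Longrightarrow> j \<in> Obj E \<Longrightarrow> a \<in> carrier (BGrp D1 i j) \<Longrightarrow> act1 i j a = act i j (\<sigma> i j a)"
  shows "linear_extension pullD E (quotient_cat E R) (quotient_func R) act1"
  unfolding linear_extension_def quotient_func_simps
proof (intro conjI ballI impI)
  show "bifunctor (quotient_cat E R) pullD"
    by (rule bifunctor_pullback[OF natural_bifuncD(1)[OF nat]])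
      (use full_functor_to_S in \<open>simp add: full_functor_def\<close>)
  show "full_functor E (quotient_cat E R) (quotient_func R)"
    by (rule full_functor_quotient[OF R_congruence])
  show "identity_on_objects E (quotient_cat E R) (quotient_func R)"
    by (rule identity_on_objects_quotient)
next
  fix i j assume o: "i \<in> Obj E" "j \<in> Obj E"
  interpret D1: comm_group "BGrp D1 i j" using group1[OF o] .
  interpret group_action "BGrp D2 i j" "Hom E i j" "act i j" using linear_extension_action[OF ext o] .
  show "group_action (BGrp pullD i j) (Hom E i j) (act1 i j)"
    by (rule group_actionI)
      (use o in \<open>simp_all add: pullback_bifunc_def act1 act_closed sigma_closed sigma_one act_one
        sigma_mult act_mult D1.is_group Bij_imp_extensional[OF bij_prop0]\<close>)
  fix f assume f: "f \<in> Hom E i j"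
  {
    fix a assume "a \<in> carrier (BGrp pullD i j)"
    then have a: "a \<in> carrier (BGrp D1 i j)" by (simp add: pullback_bifunc_def)
    then show "R i j `` {act1 i j a f} = R i j `` {f}"
      using o f by (simp add: act1 act_R)
    assume "act1 i j a f = f"
    then have "\<sigma> i j a = \<sigma> i j \<one>\<^bsub>BGrp D1 i j\<^esub>"
      using o f a linear_extension_free[OF ext o f sigma_closed[OF o a]] by (simp add: act1 sigma_one)
    then have "a = \<one>\<^bsub>BGrp D1 i j\<^esub>"
      using inj_onD[OF inj[OF o]] a by blast
    then show "a = \<one>\<^bsub>BGrp pullD i j\<^esub>"
      by (simp add: pullback_bifunc_def)
  }
  fix g assume g: "g \<in> Hom E i j" and "R i j `` {f} = R i j `` {g}"
  then have "(f, g) \<in> R i j"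
    using congruence_class_eq_iff[OF R_congruence o f g] by simp
  then show "\<exists>a\<in>carrier (BGrp pullD i j). act1 i j a f = g"
    using o by (auto simp: R_eq pullback_bifunc_def act1)
next
  fix i j k g f a b
  assume o: "i \<in> Obj E" "j \<in> Obj E" "k \<in> Obj E" and g: "g \<in> Hom E j k" and f: "f \<in> Hom E i j"
    and "a \<in> carrier (BGrp pullD j k)"
      "b \<in> carrier (BGrp pullD i j)"
  then have ab: "a \<in> carrier (BGrp D1 j k)" "b \<in> carrier (BGrp D1 i j)"
    by (simp_all add: pullback_bifunc_def)
  have *: "BMap D1 i j i k (S i i `` {Ident E i}) (S j k `` {g}) b \<otimes>\<^bsub>BGrp D1 i k\<^esub>
           BMap D1 j k i k (S i j `` {f}) (S k k `` {Ident E k}) a \<in> carrier (BGrp D1 i k)"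
    using o f g ab by (intro mult_closed1 bmap_closed1 S_class_closed E_ident) auto
  show "Comp E i j k (act1 j k a g) (act1 i j b f) =
      act1 i k (BMap pullD i j i k (Ident (quotient_cat E R) i) (R j k `` {g}) b
          \<otimes>\<^bsub>BGrp pullD i k\<^esub>
         BMap pullD j k i k (R i j `` {f}) (Ident (quotient_cat E R) k) a)
        (Comp E i j k g f)"
    using o f g ab * by (simp add: pullback_bifunc_def induced_class E_ident act1 act_sigma_comp)
qed

abbreviation (input) coker_act where
  "coker_act i j Y \<equiv> \<lambda>F\<in>Hom E i j // R i j. \<Union>h\<in>Y. \<Union>f\<in>F. R i j `` {act i j h f}"

text \<open>Another representative of the coset contributes some \<open>\<sigma> i j d\<close>,
  another representative of the class some \<open>\<sigma> i j b\<close>. Commutativity of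
  \<open>D2\<close> gathers them into \<open>\<sigma> i j (d \<otimes> b)\<close> acting after
  \<open>h\<close>, and such an action does not leave the \<open>R\<close>-class.\<close>

lemma coker_act_class:
  assumes o: "i \<in> Obj E" "j \<in> Obj E" and h: "h \<in> carrier (BGrp D2 i j)" and f: "f \<in> Hom E i j"
  shows "coker_act i j (\<pi> i j h) (R i j `` {f}) = R i j `` {act i j h f}"
proof -
  interpret D2: comm_group "BGrp D2 i j" using group2[OF o] .
  interpret normal "\<sigma> i j ` carrier (BGrp D1 i j)" "BGrp D2 i j"
    using natural_bifunc_image_normal[OF nat] o by simp
  have *: "R i j `` {act i j h' f'} = R i j `` {act i j h f}"
    if h': "h' \<in> \<pi> i j h" and f': "f' \<in> R i j `` {f}" for h' f'
  proof -
    obtain d where d: "d \<in> carrier (BGrp D1 i j)" "h' = \<sigma> i j d \<otimes>\<^bsub>BGrp D2 i j\<^esub> h"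
      using h' unfolding coker_proj_def r_coset_def by blast
    obtain b where b: "b \<in> carrier (BGrp D1 i j)" "f' = act i j (\<sigma> i j b) f"
      using f' by (auto simp: R_eq[OF o])
    have "act i j h' f' = act i j (h' \<otimes>\<^bsub>BGrp D2 i j\<^esub> \<sigma> i j b) f"
      using o d b f h by (simp add: act_mult sigma_closed)
    also have "h' \<otimes>\<^bsub>BGrp D2 i j\<^esub> \<sigma> i j b = \<sigma> i j (d \<otimes>\<^bsub>BGrp D1 i j\<^esub> b) \<otimes>\<^bsub>BGrp D2 i j\<^esub> h"
      using o d b h by (simp add: sigma_mult sigma_closed D2.m_assoc D2.m_comm[of h])
    also have "act i j (\<sigma> i j (d \<otimes>\<^bsub>BGrp D1 i j\<^esub> b) \<otimes>\<^bsub>BGrp D2 i j\<^esub> h) f =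
        act i j (\<sigma> i j (d \<otimes>\<^bsub>BGrp D1 i j\<^esub> b)) (act i j h f)"
      using o d b f h by (intro act_mult sigma_closed mult_closed1) auto
    finally show ?thesis
      using o d b f h by (simp add: act_R act_closed mult_closed1)
  qed
  have 1: "h \<in> \<pi> i j h"
    unfolding coker_proj_def by (rule D2.rcos_self[OF h is_subgroup])
  have 2: "f \<in> R i j `` {f}"
    by (rule equiv_class_self[OF R_equiv[OF o] f])
  have "(\<Union>h'\<in>\<pi> i j h. \<Union>f'\<in>R i j `` {f}. R i j `` {act i j h' f'}) = R i j `` {act i j h f}"
  proof (rule UN_constant_eq[OF 1], rule ballI)
    fix h' assume "h' \<in> \<pi> i j h"
    then show "(\<Union>f'\<in>R i j `` {f}. R i j `` {act i j h' f'}) = R i j `` {act i j h f}"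
      using * by (intro UN_constant_eq[OF 2] ballI) blast
  qed
  moreover have "R i j `` {f} \<in> Hom E i j // R i j"
    using f by (rule quotientI)
  ultimately show ?thesis by simp
qed

text \<open>All clauses are checked on representatives, where they are the clauses for
  \<open>D2\<close> read modulo \<open>R\<close>. The exception is freeness: there \<open>h\<close>
  fixes the class of \<open>f\<close> only up to some \<open>\<sigma> i j a\<close>, and one has to
  conclude that \<open>h\<close> lies in the image of \<open>\<sigma>\<close>.\<close>

lemma linear_extension_coker:
  "linear_extension \<C> (quotient_cat E R) (quotient_cat E S) toS coker_act"
proof -
  note bif = natural_bifuncD(2)[OF natural_bifunc_coker[OF nat]]
  note simps = coker_group_simps[OF nat, unfolded quotient_cat_simps]
  note map_proj = coker_map_proj[OF nat, unfolded quotient_cat_simps]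
  note rep = quotient_hom_class[OF R_congruence]
  show ?thesis
    unfolding linear_extension_def quotient_cat_simps
  proof (intro conjI ballI impI)
    show "bifunctor (quotient_cat E S) \<C>" by (rule bif)
    show "full_functor (quotient_cat E R) (quotient_cat E S) toS"
      by (rule full_functor_to_S)
    show "identity_on_objects (quotient_cat E R) (quotient_cat E S) toS"
      by (rule identity_on_objects_induced_quotient)
  next
    fix i j assume o: "i \<in> Obj E" "j \<in> Obj E"
    note one = coker_proj_one[OF nat, unfolded quotient_cat_simps, OF o]
    interpret D2: comm_group "BGrp D2 i j" using group2[OF o] .
    show "group_action (BGrp \<C> i j) (Hom E i j // R i j) (coker_act i j)"
    proof (rule group_actionI)
      show "group (BGrp \<C> i j)"
        using bifunctorD(2)[OF bif] o by (simp add: comm_group.axioms(2))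
    next
      fix Y F assume Y: "Y \<in> carrier (BGrp \<C> i j)"
      show "coker_act i j Y \<in> extensional (Hom E i j // R i j)"
        by (rule restrict_extensional)
      assume F: "F \<in> Hom E i j // R i j"
      obtain h where h: "h \<in> carrier (BGrp D2 i j)" "Y = \<pi> i j h"
        using Y unfolding simps by blast
      obtain f where f: "f \<in> Hom E i j" "F = R i j `` {f}"
        using rep[OF F] by blast
      show "coker_act i j Y F \<in> Hom E i j // R i j"
        unfolding h(2) f(2) coker_act_class[OF o h(1) f(1)]
        by (rule quotientI[OF act_closed[OF o f(1) h(1)]])
    next
      fix F assume F: "F \<in> Hom E i j // R i j"
      obtain f where f: "f \<in> Hom E i j" "F = R i j `` {f}"
        using rep[OF F] by blast
      show "coker_act i j \<one>\<^bsub>BGrp \<C> i j\<^esub> F = F"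
        unfolding one[symmetric] f(2) coker_act_class[OF o D2.one_closed f(1)]
        by (simp add: act_one[OF o f(1)])
    next
      fix Y Y' F
      assume Y: "Y \<in> carrier (BGrp \<C> i j)" "Y' \<in> carrier (BGrp \<C> i j)" and F: "F \<in> Hom E i j // R i j"
      obtain h h' where h: "h \<in> carrier (BGrp D2 i j)" "Y = \<pi> i j h"
        and h': "h' \<in> carrier (BGrp D2 i j)" "Y' = \<pi> i j h'"
        using Y unfolding simps by blast
      obtain f where f: "f \<in> Hom E i j" "F = R i j `` {f}"
        using rep[OF F] by blast
      show "coker_act i j (Y \<otimes>\<^bsub>BGrp \<C> i j\<^esub> Y') F = coker_act i j Y (coker_act i j Y' F)"
        unfolding h(2) h'(2) f(2) simps(3)[OF o h(1) h'(1)] coker_act_class[OF o D2.m_closed[OF h(1) h'(1)] f(1)]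
          coker_act_class[OF o h'(1) f(1)] coker_act_class[OF o h(1) act_closed[OF o f(1) h'(1)]]
          act_mult[OF o f(1) h(1) h'(1)] ..
    qed
    fix F assume F: "F \<in> Hom E i j // R i j"
    obtain f where f: "f \<in> Hom E i j" "F = R i j `` {f}"
      using rep[OF F] by blast
    {
      fix Y assume Y: "Y \<in> carrier (BGrp \<C> i j)"
      obtain h where h: "h \<in> carrier (BGrp D2 i j)" "Y = \<pi> i j h"
        using Y unfolding simps by blast
      show "on_hom toS i j (coker_act i j Y F) = on_hom toS i j F"
        unfolding h(2) f(2) coker_act_class[OF o h(1) f(1)] induced_class[OF o f(1)]
          induced_class[OF o act_closed[OF o f(1) h(1)]]
        using linear_extension_fibre[OF ext o f(1) h(1)] by simp
      assume "coker_act i j Y F = F"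
      then have "R i j `` {act i j h f} = R i j `` {f}"
        unfolding h(2) f(2) coker_act_class[OF o h(1) f(1)] .
      then have "(f, act i j h f) \<in> R i j"
        using congruence_class_eq_iff[OF R_congruence o f(1) act_closed[OF o f(1) h(1)]] by simp
      then obtain a where a: "a \<in> carrier (BGrp D1 i j)" "act i j h f = act i j (\<sigma> i j a) f"
        by (auto simp: R_eq[OF o])
      have sa: "\<sigma> i j a \<in> carrier (BGrp D2 i j)"
        by (rule sigma_closed[OF o a(1)])
      \<comment> \<open>Equality of two actions on \<open>f\<close> becomes a fixed point of the
        quotient of \<open>h\<close> by \<open>\<sigma> i j a\<close>, the form to which freeness of
        the \<open>D2\<close>-action applies.\<close>
      have "act i j (inv\<^bsub>BGrp D2 i j\<^esub> (\<sigma> i j a) \<otimes>\<^bsub>BGrp D2 i j\<^esub> h) f = f"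
        using o f(1) h(1) a sa by (simp add: act_mult) (simp add: act_mult[symmetric] act_one)
      then have "inv\<^bsub>BGrp D2 i j\<^esub> (\<sigma> i j a) \<otimes>\<^bsub>BGrp D2 i j\<^esub> h = \<one>\<^bsub>BGrp D2 i j\<^esub>"
        using linear_extension_free[OF ext o f(1)] sa h(1) by simp
      then have "h = \<sigma> i j a"
        using sa h(1) D2.inv_solve_left'[OF D2.one_closed sa h(1)] by simp
      then have "h = \<sigma> i j a \<otimes>\<^bsub>BGrp D2 i j\<^esub> \<one>\<^bsub>BGrp D2 i j\<^esub>"
        using sa by simp
      then show "Y = \<one>\<^bsub>BGrp \<C> i j\<^esub>"
        unfolding h(2) one[symmetric]
        using coker_proj_eq_iff[OF nat, unfolded quotient_cat_simps, OF o D2.one_closed h(1)] a(1) by metis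
    }
    fix G assume G: "G \<in> Hom E i j // R i j"
      and eq: "on_hom toS i j F = on_hom toS i j G"
    obtain g where g: "g \<in> Hom E i j" "G = R i j `` {g}"
      using rep[OF G] by blast
    have "S i j `` {f} = S i j `` {g}"
      using eq unfolding f(2) g(2) induced_class[OF o f(1)] induced_class[OF o g(1)] .
    then obtain h where h: "h \<in> carrier (BGrp D2 i j)" "act i j h f = g"
      using linear_extension_transitive[OF ext o f(1) g(1)] by auto
    then have "coker_act i j (\<pi> i j h) F = G"
      unfolding f(2) g(2) coker_act_class[OF o h(1) f(1)] by simp
    then show "\<exists>Y\<in>carrier (BGrp \<C> i j). coker_act i j Y F = G"
      unfolding simps using h(1) by blast
  next
    fix i j k G F X Y
    assume o: "i \<in> Obj E" "j \<in> Obj E" "k \<in> Obj E" and G: "G \<in> Hom E j k // R j k"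
      and F: "F \<in> Hom E i j // R i j" and X: "X \<in> carrier (BGrp \<C> j k)" and Y: "Y \<in> carrier (BGrp \<C> i j)"
    obtain f where f: "f \<in> Hom E i j" "F = R i j `` {f}"
      using rep[OF F] by blast
    obtain g where g: "g \<in> Hom E j k" "G = R j k `` {g}"
      using rep[OF G] by blast
    obtain a where a: "a \<in> carrier (BGrp D2 j k)" "X = \<pi> j k a"
      using X unfolding simps by blast
    obtain b where b: "b \<in> carrier (BGrp D2 i j)" "Y = \<pi> i j b"
      using Y unfolding simps by blast
    have m: "BMap D2 i j i k (S i i `` {Ident E i}) (S j k `` {g}) b \<in> carrier (BGrp D2 i k)"
      "BMap D2 j k i k (S i j `` {f}) (S k k `` {Ident E k}) a \<in> carrier (BGrp D2 i k)"
      using o f(1) g(1) a(1) b(1) by (auto intro!: bmap_closed2 S_class_closed E_ident)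
    have gf: "Comp E i j k g f \<in> Hom E i k"
      using o f(1) g(1) by (intro E_comp)
    have "Comp (quotient_cat E R) i j k (coker_act j k X G) (coker_act i j Y F) =
        R i k `` {Comp E i j k (act j k a g) (act i j b f)}"
      unfolding a(2) b(2) f(2) g(2) coker_act_class[OF o(2,3) a(1) g(1)] coker_act_class[OF o(1,2) b(1) f(1)]
      by (rule quotient_comp[OF R_congruence o act_closed[OF o(1,2) f(1) b(1)] act_closed[OF o(2,3) g(1) a(1)]])
    also have "\<dots> = coker_act i k (\<pi> i k (BMap D2 i j i k (S i i `` {Ident E i}) (S j k `` {g}) b \<otimes>\<^bsub>BGrp D2 i k\<^esub>
           BMap D2 j k i k (S i j `` {f}) (S k k `` {Ident E k}) a)) (R i k `` {Comp E i j k g f})"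
      unfolding act_comp[OF o g(1) f(1) a(1) b(1)]
      by (rule coker_act_class[OF o(1,3) mult_closed2[OF o(1,3) m] gf, symmetric])
    also have "\<pi> i k (BMap D2 i j i k (S i i `` {Ident E i}) (S j k `` {g}) b \<otimes>\<^bsub>BGrp D2 i k\<^esub>
           BMap D2 j k i k (S i j `` {f}) (S k k `` {Ident E k}) a) =
        BMap \<C> i j i k (S i i `` {Ident E i}) (S j k `` {g}) Y \<otimes>\<^bsub>BGrp \<C> i k\<^esub>
        BMap \<C> j k i k (S i j `` {f}) (S k k `` {Ident E k}) X"
      using o f(1) g(1) a b m by (simp add: simps map_proj S_class_closed E_ident)
    also have "R i k `` {Comp E i j k g f} = Comp (quotient_cat E R) i j k G F"
      unfolding f(2) g(2) by (rule quotient_comp[OF R_congruence o f(1) g(1), symmetric])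
    finally show "Comp (quotient_cat E R) i j k (coker_act j k X G) (coker_act i j Y F) =
       coker_act i k (BMap \<C> i j i k (S i i `` {Ident E i}) (on_hom toS j k G) Y
          \<otimes>\<^bsub>BGrp \<C> i k\<^esub>
         BMap \<C> j k i k (on_hom toS i j F) (S k k `` {Ident E k}) X)
        (Comp (quotient_cat E R) i j k G F)"
      unfolding f(2) g(2) induced_class[OF o(1,2) f(1)] induced_class[OF o(2,3) g(1)] .
  qed
qed

end

section \<open>Groups of nilpotency class two\<close>

text \<open>A homomorphism carries the derived subgroup onto the derived subgroup of its image,
  which is trivial inside an abelian group. Applied to either variable of a bilinear map, this makes
  the map blind to commutators.\<close>

lemma hom_derived_eq_one:
  assumes G: "group G" and A: "comm_group A" and h: "h \<in> hom G A" and c: "c \<in> derived G (carrier G)"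
  shows "h c = \<one>\<^bsub>A\<^esub>"
proof -
  interpret A: comm_group A by fact
  interpret group_hom G A h
    using G h by (simp add: group_hom_def group_hom_axioms_def A.is_group)
  have "h ` carrier G \<subseteq> carrier A" by auto
  from A.derived_eq_singleton[OF this] show ?thesis
    using derived_img[of "carrier G"] c by auto
qed

text \<open>Class two is used as centrality of the commutator subgroup, the form in which it enters
  calculations; \<open>nil2_group_iff\<close> ties it to the definition by generated
  commutators.\<close>

locale nil2 = group G for G :: "'a monoid" (structure) +
  assumes central: "c \<in> derived G (carrier G) \<Longrightarrow> x \<in> carrier G \<Longrightarrow> c \<otimes> x = x \<otimes> c"

lemma (in group) commutator_eq_one_iff:
  assumes "a \<in> carrier G" "b \<in> carrier G"
  shows "inv a \<otimes> inv b \<otimes> a \<otimes> b = \<one> \<longleftrightarrow> a \<otimes> b = b \<otimes> a"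
proof -
  have "inv a \<otimes> inv b \<otimes> a \<otimes> b = inv (b \<otimes> a) \<otimes> (a \<otimes> b)"
    using assms by (simp add: inv_mult_group m_assoc)
  then show ?thesis
    using assms inv_solve_left'[of \<one> "b \<otimes> a" "a \<otimes> b"] by auto
qed

text \<open>A generated subgroup is trivial iff all its generators are, and a commutator is trivial
  iff its two entries commute.\<close>

lemma nil2_group_iff: "nil2_group G \<longleftrightarrow> nil2 G"
proof (cases "group G")
  case True
  then interpret group G .
  let ?D = "derived G (carrier G)"
  let ?C = "{commutator G a b | a b. a \<in> ?D \<and> b \<in> carrier G}"
  have D: "?D \<subseteq> carrier G" by (rule derived_in_carrier) simp
  have one: "\<one>\<^bsub>G\<^esub> \<in> ?D"
    using derived_is_subgroup[of "carrier G"] by (simp add: subgroup.one_closed)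
  have "commutator G a b = \<one>\<^bsub>G\<^esub> \<longleftrightarrow> a \<otimes>\<^bsub>G\<^esub> b = b \<otimes>\<^bsub>G\<^esub> a" if "a \<in> ?D" "b \<in> carrier G" for a b
    unfolding commutator_def by (rule commutator_eq_one_iff) (use that D in auto)
  moreover have "?C \<subseteq> {\<one>\<^bsub>G\<^esub>} \<longleftrightarrow>
      (\<forall>c x. c \<in> ?D \<longrightarrow> x \<in> carrier G \<longrightarrow> commutator G c x = \<one>\<^bsub>G\<^esub>)"
    by blast
  ultimately have C: "?C \<subseteq> {\<one>\<^bsub>G\<^esub>} \<longleftrightarrow> (\<forall>c x. c \<in> ?D \<longrightarrow> x \<in> carrier G \<longrightarrow> c \<otimes>\<^bsub>G\<^esub> x = x \<otimes>\<^bsub>G\<^esub> c)"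
    by simp
  have "generate G ?C = {\<one>\<^bsub>G\<^esub>} \<longleftrightarrow> ?C \<subseteq> {\<one>\<^bsub>G\<^esub>}"
  proof
    have "?C \<subseteq> generate G ?C"
      by (rule subsetI) (rule generate.incl)
    also assume "generate G ?C = {\<one>\<^bsub>G\<^esub>}"
    finally show "?C \<subseteq> {\<one>\<^bsub>G\<^esub>}" .
  next
    assume "?C \<subseteq> {\<one>\<^bsub>G\<^esub>}"
    then have "generate G ?C \<subseteq> {\<one>\<^bsub>G\<^esub>}"
      by (rule generate_subgroup_incl[OF _ triv_subgroup])
    then show "generate G ?C = {\<one>\<^bsub>G\<^esub>}"
      by (rule equalityI) (simp add: generate.one)
  qed
  then show ?thesis
    unfolding nil2_group_def mixed_commutator_subgroup_def nil2_def nil2_axioms_def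
    using C True by (simp only: simp_thms)
qed (simp add: nil2_group_def nil2_def)

lemma (in group) centre_subgroup:
  "subgroup {c \<in> carrier G. \<forall>z\<in>carrier G. c \<otimes> z = z \<otimes> c} G"
proof (rule subgroupI)
  fix c assume c: "c \<in> {c \<in> carrier G. \<forall>z\<in>carrier G. c \<otimes> z = z \<otimes> c}"
  have "inv c \<otimes> z = z \<otimes> inv c" if z: "z \<in> carrier G" for z
  proof -
    have "c \<otimes> z = z \<otimes> c"
      using c z by blast
    then have "c \<otimes> (z \<otimes> inv c) = z \<otimes> c \<otimes> inv c"
      using c z by (simp only: m_assoc[symmetric] mem_Collect_eq inv_closed)
    then have "z = c \<otimes> (z \<otimes> inv c)"
      using c z by (simp add: m_assoc)
    then show ?thesis
      using c z inv_solve_left[of "z \<otimes> inv c" c z] by (metis (no_types, lifting) inv_closed m_closed mem_Collect_eq)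
  qed
  then show "inv c \<in> {c \<in> carrier G. \<forall>z\<in>carrier G. c \<otimes> z = z \<otimes> c}"
    using c by simp
next
  fix c d assume cd: "c \<in> {c \<in> carrier G. \<forall>z\<in>carrier G. c \<otimes> z = z \<otimes> c}"
    "d \<in> {c \<in> carrier G. \<forall>z\<in>carrier G. c \<otimes> z = z \<otimes> c}"
  have "c \<otimes> d \<otimes> z = z \<otimes> (c \<otimes> d)" if z: "z \<in> carrier G" for z
  proof -
    have "c \<in> carrier G" "d \<in> carrier G" "c \<otimes> z = z \<otimes> c" "d \<otimes> z = z \<otimes> d"
      using cd z by blast+
    then show ?thesis
      using z by (metis m_assoc)
  qed
  then show "c \<otimes> d \<in> {c \<in> carrier G. \<forall>z\<in>carrier G. c \<otimes> z = z \<otimes> c}"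
    using cd m_closed[of c d] by blast
next
  show "{c \<in> carrier G. \<forall>z\<in>carrier G. c \<otimes> z = z \<otimes> c} \<noteq> {}"
  proof -
    have "\<one> \<in> {c \<in> carrier G. \<forall>z\<in>carrier G. c \<otimes> z = z \<otimes> c}"
      by simp
    then show ?thesis by (metis (no_types) empty_iff)
  qed
qed blast

text \<open>The centre is a subgroup, so it contains the whole derived subgroup as soon as it
  contains the generating commutators.\<close>

lemma nil2I:
  assumes "group G"
    and comm: "\<And>x y z. x \<in> carrier G \<Longrightarrow> y \<in> carrier G \<Longrightarrow> z \<in> carrier G \<Longrightarrow>
      x \<otimes>\<^bsub>G\<^esub> y \<otimes>\<^bsub>G\<^esub> inv\<^bsub>G\<^esub> x \<otimes>\<^bsub>G\<^esub> inv\<^bsub>G\<^esub> y \<otimes>\<^bsub>G\<^esub> z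
      = z \<otimes>\<^bsub>G\<^esub> (x \<otimes>\<^bsub>G\<^esub> y \<otimes>\<^bsub>G\<^esub> inv\<^bsub>G\<^esub> x \<otimes>\<^bsub>G\<^esub> inv\<^bsub>G\<^esub> y)"
  shows "nil2 G"
proof -
  interpret group G by fact
  have "derived_set G (carrier G) \<subseteq> {c \<in> carrier G. \<forall>z\<in>carrier G. c \<otimes>\<^bsub>G\<^esub> z = z \<otimes>\<^bsub>G\<^esub> c}"
    using comm by auto
  then have "derived G (carrier G) \<subseteq> {c \<in> carrier G. \<forall>z\<in>carrier G. c \<otimes>\<^bsub>G\<^esub> z = z \<otimes>\<^bsub>G\<^esub> c}"
    unfolding derived_def by (rule generate_subgroup_incl[OF _ centre_subgroup])
  then show ?thesis
    by unfold_locales blast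
qed

context nil2
begin

abbreviation "D \<equiv> derived G (carrier G)"

lemma derived_closed [simp]: "c \<in> D \<Longrightarrow> c \<in> carrier G"
  using derived_in_carrier[of "carrier G"] by auto

lemma derived_subgroup: "subgroup D G"
  by (rule derived_is_subgroup) simp

lemma derived_one [simp]: "\<one> \<in> D"
  and derived_mult [simp]: "c \<in> D \<Longrightarrow> d \<in> D \<Longrightarrow> c \<otimes> d \<in> D"
  and derived_inv [simp]: "c \<in> D \<Longrightarrow> inv c \<in> D"
  using derived_subgroup by (simp_all add: subgroup.one_closed subgroup.m_closed subgroup.m_inv_closed)

lemma central_left: "c \<in> D \<Longrightarrow> x \<in> carrier G \<Longrightarrow> y \<in> carrier G \<Longrightarrow> x \<otimes> (c \<otimes> y) = c \<otimes> (x \<otimes> y)"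
  by (simp add: m_assoc[symmetric] central[of c x])

lemma comm_group_ab_quot: "comm_group (ab_quot G)"
  unfolding ab_quot_def by (rule derived_quot_is_comm_group)

lemma derived_normal: "D \<lhd> G"
  by (rule derived_is_normal[OF normal_self])

lemma carrier_ab_quot: "carrier (ab_quot G) = ab_class G ` carrier G"
  by (simp add: ab_quot_def ab_class_def carrier_FactGroup)

lemma ab_class_hom: "ab_class G \<in> hom G (ab_quot G)"
  unfolding ab_quot_def ab_class_def using normal.r_coset_hom_Mod[OF derived_normal] by simp

lemma ab_class_closed [simp]: "x \<in> carrier G \<Longrightarrow> ab_class G x \<in> carrier (ab_quot G)"
  by (simp add: carrier_ab_quot)

lemma ab_class_mult [simp]:
  "x \<in> carrier G \<Longrightarrow> y \<in> carrier G \<Longrightarrow>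
    ab_class G x \<otimes>\<^bsub>ab_quot G\<^esub> ab_class G y = ab_class G (x \<otimes> y)"
  using hom_mult[OF ab_class_hom] by simp

lemma one_ab_quot: "\<one>\<^bsub>ab_quot G\<^esub> = ab_class G \<one>"
  using coset_mult_one[of D] derived_in_carrier[of "carrier G"] by (simp add: ab_quot_def ab_class_def)

text \<open>The library's cosets carry the subgroup on the left. Centrality moves the commutator to
  the right, where the deviation of a map also stands.\<close>

lemma mem_ab_class: "x \<in> carrier G \<Longrightarrow> y \<in> ab_class G x \<longleftrightarrow> (\<exists>c\<in>D. y = x \<otimes> c)"
proof -
  assume x: "x \<in> carrier G"
  have "y \<in> ab_class G x \<longleftrightarrow> (\<exists>c\<in>D. y = c \<otimes> x)"
    by (auto simp: ab_class_def r_coset_def)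
  then show ?thesis
    using central[OF _ x] by (metis (no_types))
qed

lemma ab_class_self: "x \<in> carrier G \<Longrightarrow> x \<in> ab_class G x"
  unfolding mem_ab_class by (rule bexI[of _ \<one>]) simp_all

lemma ab_class_eq_iff:
  assumes "x \<in> carrier G" "y \<in> carrier G"
  shows "ab_class G x = ab_class G y \<longleftrightarrow> (\<exists>c\<in>D. y = x \<otimes> c)"
proof -
  have "ab_class G x = ab_class G y \<longleftrightarrow> y \<in> ab_class G x"
    using assms repr_independence[OF _ assms(1) derived_subgroup] rcos_self[OF assms(2) derived_subgroup]
    unfolding ab_class_def by auto
  then show ?thesis using assms by (simp add: mem_ab_class)
qed

lemma ab_class_derived_iff: "x \<in> carrier G \<Longrightarrow> ab_class G x = ab_class G \<one> \<longleftrightarrow> x \<in> D"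
  using ab_class_eq_iff[of \<one> x] by auto

lemma ab_class_mult_derived [simp]: "x \<in> carrier G \<Longrightarrow> c \<in> D \<Longrightarrow> ab_class G (x \<otimes> c) = ab_class G x"
  using ab_class_eq_iff[of x "x \<otimes> c"] by auto

lemma comm_sub_simps [simp]:
  "carrier (comm_sub G) = D" "\<one>\<^bsub>comm_sub G\<^esub> = \<one>"
  "x \<otimes>\<^bsub>comm_sub G\<^esub> y = x \<otimes> y"
  by (simp_all add: comm_sub_def)

lemma comm_group_comm_sub: "comm_group (comm_sub G)"
proof -
  have "group (comm_sub G)"
    unfolding comm_sub_def by (rule subgroup_imp_group[OF derived_subgroup])
  then show ?thesis
    by (rule group.group_comm_groupI) (simp add: central)
qed

lemma inv_comm_sub [simp]: "c \<in> D \<Longrightarrow> inv\<^bsub>comm_sub G\<^esub> c = inv c"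
  unfolding comm_sub_def by (rule m_inv_consistent[OF derived_subgroup])

section \<open>The commutator pairing of a group of class two\<close>

lemma derived_commutator [simp]:
  "x \<in> carrier G \<Longrightarrow> y \<in> carrier G \<Longrightarrow> x \<otimes> y \<otimes> inv x \<otimes> inv y \<in> D"
  unfolding derived_def by (rule generate.incl) blast

text \<open>This is the form of the commutator that generates \<open>derived\<close>. Because it is
  central it coincides with \<open>commutator G x y\<close>.\<close>

definition pairing where "pairing x y = x \<otimes> y \<otimes> inv x \<otimes> inv y"

lemma pairing_closed [simp]: "x \<in> carrier G \<Longrightarrow> y \<in> carrier G \<Longrightarrow> pairing x y \<in> D"
  by (simp add: pairing_def)

lemma pairing_swap: "x \<in> carrier G \<Longrightarrow> y \<in> carrier G \<Longrightarrow> x \<otimes> y = y \<otimes> x \<otimes> pairing x y"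
proof -
  assume "x \<in> carrier G" "y \<in> carrier G"
  then have "x \<otimes> y = pairing x y \<otimes> (y \<otimes> x)"
    by (simp add: pairing_def m_assoc) (simp add: m_assoc[symmetric])
  then show ?thesis
    using \<open>x \<in> _\<close> \<open>y \<in> _\<close> central[of "pairing x y" "y \<otimes> x"] by simp
qed

lemma pairing_eqI:
  "x \<in> carrier G \<Longrightarrow> y \<in> carrier G \<Longrightarrow> c \<in> D \<Longrightarrow> x \<otimes> y = y \<otimes> x \<otimes> c \<Longrightarrow> pairing x y = c"
  using pairing_swap[of x y] by simp

text \<open>Moving \<open>z\<close> to the left past \<open>y\<close> and then past \<open>x\<close>
  leaves one pairing each time. Both are central, so they collect at the end without a further
  commutator; this is where class two makes the pairing bilinear.\<close>

lemma pairing_mult_left: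
  assumes "x \<in> carrier G" "y \<in> carrier G" "z \<in> carrier G"
  shows "pairing (x \<otimes> y) z = pairing x z \<otimes> pairing y z"
proof (rule pairing_eqI)
  have "x \<otimes> y \<otimes> z = x \<otimes> (y \<otimes> z)"
    using assms by (simp add: m_assoc)
  also have "y \<otimes> z = z \<otimes> y \<otimes> pairing y z"
    using assms by (rule_tac pairing_swap)
  also have "x \<otimes> (z \<otimes> y \<otimes> pairing y z) = x \<otimes> z \<otimes> y \<otimes> pairing y z"
    using assms by (simp add: m_assoc)
  also have "x \<otimes> z = z \<otimes> x \<otimes> pairing x z"
    using assms by (rule_tac pairing_swap)
  also have "z \<otimes> x \<otimes> pairing x z \<otimes> y \<otimes> pairing y z = z \<otimes> (x \<otimes> y) \<otimes> (pairing x z \<otimes> pairing y z)"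
    using assms central_left[of "pairing x z" y "pairing y z"] by (simp add: m_assoc)
  finally show "x \<otimes> y \<otimes> z = z \<otimes> (x \<otimes> y) \<otimes> (pairing x z \<otimes> pairing y z)" .
qed (use assms in simp_all)

lemma pairing_mult_right:
  assumes "x \<in> carrier G" "y \<in> carrier G" "z \<in> carrier G"
  shows "pairing z (x \<otimes> y) = pairing z x \<otimes> pairing z y"
proof (rule pairing_eqI)
  have "z \<otimes> (x \<otimes> y) = z \<otimes> x \<otimes> y"
    using assms by (simp add: m_assoc)
  also have "z \<otimes> x = x \<otimes> z \<otimes> pairing z x"
    using assms by (rule_tac pairing_swap)
  also have "x \<otimes> z \<otimes> pairing z x \<otimes> y = x \<otimes> (z \<otimes> y) \<otimes> pairing z x"
    using assms central[of "pairing z x" y] by (simp add: m_assoc)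
  also have "z \<otimes> y = y \<otimes> z \<otimes> pairing z y"
    using assms by (rule_tac pairing_swap)
  also have "x \<otimes> (y \<otimes> z \<otimes> pairing z y) \<otimes> pairing z x = x \<otimes> y \<otimes> z \<otimes> (pairing z x \<otimes> pairing z y)"
    using assms central[of "pairing z x" "pairing z y"] by (simp add: m_assoc)
  finally show "z \<otimes> (x \<otimes> y) = x \<otimes> y \<otimes> z \<otimes> (pairing z x \<otimes> pairing z y)" .
qed (use assms in simp_all)

lemma pairing_derived_left: "c \<in> D \<Longrightarrow> x \<in> carrier G \<Longrightarrow> pairing c x = \<one>"
  and pairing_derived_right: "c \<in> D \<Longrightarrow> x \<in> carrier G \<Longrightarrow> pairing x c = \<one>"
  using central[of c x] by (auto intro!: pairing_eqI)

end

lemma (in nil2) nil2_group: "nil2_group G"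
  using nil2_axioms by (simp add: nil2_group_iff)

section \<open>Groups of maps\<close>

lemma pointwise_group_simps [simp]:
  "carrier (pointwise_group F S B) = F"
  "f \<otimes>\<^bsub>pointwise_group F S B\<^esub> g = (\<lambda>x\<in>S. f x \<otimes>\<^bsub>B\<^esub> g x)"
  "\<one>\<^bsub>pointwise_group F S B\<^esub> = (\<lambda>x\<in>S. \<one>\<^bsub>B\<^esub>)"
  by (simp_all add: pointwise_group_def)

text \<open>The members of \<open>F\<close> are extensional on \<open>S\<close>, which turns
  identities between values into equalities of maps; neutral element and inverses are restricted to
  \<open>S\<close> for the same reason.\<close>

lemma comm_group_pointwise:
  assumes B: "comm_group B" and F: "F \<subseteq> S \<rightarrow>\<^sub>E carrier B"
    and one: "(\<lambda>x\<in>S. \<one>\<^bsub>B\<^esub>) \<in> F"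
    and mult: "\<And>f g. f \<in> F \<Longrightarrow> g \<in> F \<Longrightarrow> (\<lambda>x\<in>S. f x \<otimes>\<^bsub>B\<^esub> g x) \<in> F"
    and inv: "\<And>f. f \<in> F \<Longrightarrow> (\<lambda>x\<in>S. inv\<^bsub>B\<^esub> (f x)) \<in> F"
  shows "comm_group (pointwise_group F S B)"
proof (rule comm_groupI)
  interpret B: comm_group B by fact
  have cl: "f x \<in> carrier B" if "f \<in> F" "x \<in> S" for f x
    using F that by (auto dest: PiE_mem)
  fix f assume f: "f \<in> carrier (pointwise_group F S B)"
  then have ext: "f \<in> extensional S"
    using F by (auto simp: PiE_def)
  show "\<one>\<^bsub>pointwise_group F S B\<^esub> \<otimes>\<^bsub>pointwise_group F S B\<^esub> f = f"
    by (rule extensionalityI[OF _ ext]) (use f cl in simp_all)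
  show "\<exists>g\<in>carrier (pointwise_group F S B). g \<otimes>\<^bsub>pointwise_group F S B\<^esub> f = \<one>\<^bsub>pointwise_group F S B\<^esub>"
    by (rule bexI[of _ "\<lambda>x\<in>S. inv\<^bsub>B\<^esub> (f x)"]) (use f cl inv in \<open>auto intro!: restrict_ext\<close>)
  fix g assume g: "g \<in> carrier (pointwise_group F S B)"
  with f show "f \<otimes>\<^bsub>pointwise_group F S B\<^esub> g \<in> carrier (pointwise_group F S B)"
    by (simp add: mult)
  show "f \<otimes>\<^bsub>pointwise_group F S B\<^esub> g = g \<otimes>\<^bsub>pointwise_group F S B\<^esub> f"
    using f g cl by (auto intro!: restrict_ext B.m_comm)
  fix h assume h: "h \<in> carrier (pointwise_group F S B)"
  with f g show "f \<otimes>\<^bsub>pointwise_group F S B\<^esub> g \<otimes>\<^bsub>pointwise_group F S B\<^esub> h =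
      f \<otimes>\<^bsub>pointwise_group F S B\<^esub> (g \<otimes>\<^bsub>pointwise_group F S B\<^esub> h)"
    using cl by (auto intro!: restrict_ext B.m_assoc)
qed (use one in simp)

lemma comm_group_hom_group:
  assumes A: "group A" and B: "comm_group B"
  shows "comm_group (hom_group A B)"
  unfolding hom_group_def
proof (rule comm_group_pointwise[OF B])
  interpret A: group A by fact
  interpret B: comm_group B by fact
  show "hom A B \<inter> extensional (carrier A) \<subseteq> carrier A \<rightarrow>\<^sub>E carrier B"
    by (auto simp: hom_def PiE_def)
  fix f assume f: "f \<in> hom A B \<inter> extensional (carrier A)"
  then have cl: "\<And>x. x \<in> carrier A \<Longrightarrow> f x \<in> carrier B"
    by (auto simp: hom_def)
  show "(\<lambda>x\<in>carrier A. inv\<^bsub>B\<^esub> f x) \<in> hom A B \<inter> extensional (carrier A)"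
    using f cl by (auto simp: hom_def B.inv_mult)
  fix g assume "g \<in> hom A B \<inter> extensional (carrier A)"
  with f show "(\<lambda>x\<in>carrier A. f x \<otimes>\<^bsub>B\<^esub> g x) \<in> hom A B \<inter> extensional (carrier A)"
    by (auto simp: hom_def B.m_ac Pi_iff)
next
  interpret A: group A by fact
  interpret B: comm_group B by fact
  show "(\<lambda>x\<in>carrier A. \<one>\<^bsub>B\<^esub>) \<in> hom A B \<inter> extensional (carrier A)"
    by (auto simp: hom_def)
qed

section \<open>Bilinear maps into abelian groups\<close>

definition bihom :: "('a, 'c) monoid_scheme \<Rightarrow> ('b, 'd) monoid_scheme \<Rightarrow> ('a \<Rightarrow> 'a \<Rightarrow> 'b) \<Rightarrow> bool" where
  "bihom G A \<delta> \<longleftrightarrow>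
     (\<forall>x\<in>carrier G. \<delta> x \<in> hom G A) \<and> (\<forall>y\<in>carrier G. (\<lambda>x. \<delta> x y) \<in> hom G A)"

lemma bihom_closed: "bihom G A \<delta> \<Longrightarrow> x \<in> carrier G \<Longrightarrow> y \<in> carrier G \<Longrightarrow> \<delta> x y \<in> carrier A"
  by (auto simp: bihom_def hom_def)

lemma bihom_mult_left:
  "bihom G A \<delta> \<Longrightarrow> x \<in> carrier G \<Longrightarrow> y \<in> carrier G \<Longrightarrow> z \<in> carrier G \<Longrightarrow>
    \<delta> (x \<otimes>\<^bsub>G\<^esub> y) z = \<delta> x z \<otimes>\<^bsub>A\<^esub> \<delta> y z"
  and bihom_mult_right:
  "bihom G A \<delta> \<Longrightarrow> x \<in> carrier G \<Longrightarrow> y \<in> carrier G \<Longrightarrow> z \<in> carrier G \<Longrightarrow>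
    \<delta> x (y \<otimes>\<^bsub>G\<^esub> z) = \<delta> x y \<otimes>\<^bsub>A\<^esub> \<delta> x z"
  by (auto simp: bihom_def hom_def)

lemma bihomI:
  assumes "\<And>x y. x \<in> carrier G \<Longrightarrow> y \<in> carrier G \<Longrightarrow> \<delta> x y \<in> carrier A"
    and "\<And>x y z. x \<in> carrier G \<Longrightarrow> y \<in> carrier G \<Longrightarrow> z \<in> carrier G \<Longrightarrow>
      \<delta> (x \<otimes>\<^bsub>G\<^esub> y) z = \<delta> x z \<otimes>\<^bsub>A\<^esub> \<delta> y z"
    and "\<And>x y z. x \<in> carrier G \<Longrightarrow> y \<in> carrier G \<Longrightarrow> z \<in> carrier G \<Longrightarrow>
      \<delta> x (y \<otimes>\<^bsub>G\<^esub> z) = \<delta> x y \<otimes>\<^bsub>A\<^esub> \<delta> x z"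
  shows "bihom G A \<delta>"
  unfolding bihom_def using assms by (auto intro!: homI)

lemma bihom_one: "comm_group A \<Longrightarrow> bihom G A (\<lambda>x y. \<one>\<^bsub>A\<^esub>)"
  by (rule bihomI) (simp_all add: comm_group_def comm_monoid_def monoid.one_closed monoid.l_one)

lemma bihom_prod:
  assumes A: "comm_group A" and \<delta>: "bihom G A \<delta>" "bihom G A \<epsilon>"
  shows "bihom G A (\<lambda>x y. \<delta> x y \<otimes>\<^bsub>A\<^esub> \<epsilon> x y)"
proof -
  interpret A: comm_group A by fact
  show ?thesis
    by (rule bihomI) (use \<delta> in \<open>simp_all add: bihom_closed bihom_mult_left bihom_mult_right A.m_ac\<close>)
qed

lemma bihom_inv:
  assumes A: "comm_group A" and \<delta>: "bihom G A \<delta>"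
  shows "bihom G A (\<lambda>x y. inv\<^bsub>A\<^esub> (\<delta> x y))"
proof -
  interpret A: comm_group A by fact
  show ?thesis
    by (rule bihomI) (use \<delta> in \<open>simp_all add: bihom_closed bihom_mult_left bihom_mult_right A.inv_mult\<close>)
qed

lemma bihom_compose:
  assumes "bihom G A \<delta>" "u \<in> hom G' G" "v \<in> hom A B"
  shows "bihom G' B (\<lambda>x y. v (\<delta> (u x) (u y)))"
  by (rule bihomI) (use assms in \<open>simp_all add: bihom_closed bihom_mult_left bihom_mult_right
      hom_in_carrier hom_mult\<close>)


section \<open>Quadratic maps\<close>

lemma deviation_eqI:
  assumes "group H" "f x \<in> carrier H" "f y \<in> carrier H" "d \<in> carrier H"
    and eq: "f (x \<otimes>\<^bsub>G\<^esub> y) = f x \<otimes>\<^bsub>H\<^esub> f y \<otimes>\<^bsub>H\<^esub> d"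
  shows "deviation G H f x y = d"
proof -
  interpret group H by fact
  have "inv\<^bsub>H\<^esub> c \<otimes>\<^bsub>H\<^esub> (c \<otimes>\<^bsub>H\<^esub> d) = d" if "c \<in> carrier H" for c
    using that assms(4) by (simp add: m_assoc[symmetric])
  then show ?thesis
    unfolding deviation_def eq using assms by simp
qed

lemma deviation_eq:
  assumes "group H" "f x \<in> carrier H" "f y \<in> carrier H" "f (x \<otimes>\<^bsub>G\<^esub> y) \<in> carrier H"
  shows "f (x \<otimes>\<^bsub>G\<^esub> y) = f x \<otimes>\<^bsub>H\<^esub> f y \<otimes>\<^bsub>H\<^esub> deviation G H f x y"
proof -
  interpret group H by fact
  have "c \<otimes>\<^bsub>H\<^esub> (inv\<^bsub>H\<^esub> c \<otimes>\<^bsub>H\<^esub> d) = d" if "c \<in> carrier H" "d \<in> carrier H" for c d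
    using that by (simp add: m_assoc[symmetric])
  then show ?thesis
    unfolding deviation_def using assms by simp
qed

text \<open>Any bilinear \<open>\<delta>\<close> that corrects multiplicativity on the right must be
  the deviation, by cancellation. It is thus enough to exhibit such a correction, without
  calculating with the inverses in \<open>deviation\<close>; centrality is automatic in an abelian
  target.\<close>

lemma quadraticI:
  assumes G: "group G" and H: "comm_group H" and f: "f \<in> carrier G \<rightarrow> carrier H"
    and \<delta>: "bihom G H \<delta>"
    and eq: "\<And>x y. x \<in> carrier G \<Longrightarrow> y \<in> carrier G \<Longrightarrow> f (x \<otimes>\<^bsub>G\<^esub> y) = f x \<otimes>\<^bsub>H\<^esub> f y \<otimes>\<^bsub>H\<^esub> \<delta> x y"
  shows "quadratic G H f"
proof -
  interpret G: group G by fact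
  interpret H: comm_group H by fact
  have dev: "deviation G H f x y = \<delta> x y" if "x \<in> carrier G" "y \<in> carrier G" for x y
    using that f by (intro deviation_eqI) (auto simp: bihom_closed[OF \<delta>] eq)
  have fcl: "\<And>x. x \<in> carrier G \<Longrightarrow> f x \<in> carrier H"
    using f by auto
  show ?thesis
    unfolding quadratic_def weakly_quadratic_def
    using f by (simp add: dev fcl bihom_closed[OF \<delta>] bihom_mult_left[OF \<delta>] bihom_mult_right[OF \<delta>] H.m_comm)
qed

lemma quadraticD:
  assumes H: "group H" and G: "group G" and q: "quadratic G H f"
  shows "f \<in> carrier G \<rightarrow> carrier H" and "bihom G H (deviation G H f)"
    and "\<And>x y. x \<in> carrier G \<Longrightarrow> y \<in> carrier G \<Longrightarrow>
      f (x \<otimes>\<^bsub>G\<^esub> y) = f x \<otimes>\<^bsub>H\<^esub> f y \<otimes>\<^bsub>H\<^esub> deviation G H f x y"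
proof -
  interpret G: group G by fact
  interpret H: group H by fact
  show f: "f \<in> carrier G \<rightarrow> carrier H"
    using q by (simp add: quadratic_def weakly_quadratic_def)
  have cl: "deviation G H f x y \<in> carrier H" if "x \<in> carrier G" "y \<in> carrier G" for x y
    using f that by (simp add: deviation_def Pi_iff)
  show "bihom G H (deviation G H f)"
    by (rule bihomI[OF cl]) (use q in \<open>(unfold quadratic_def weakly_quadratic_def, blast)+\<close>)
  show "f (x \<otimes>\<^bsub>G\<^esub> y) = f x \<otimes>\<^bsub>H\<^esub> f y \<otimes>\<^bsub>H\<^esub> deviation G H f x y"
    if "x \<in> carrier G" "y \<in> carrier G" for x y
    using f that by (intro deviation_eq[OF H]) auto
qed

lemma quadratic_compose:
  assumes A': "group A'" and A: "group A" and B: "group B" and B': "comm_group B'"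
    and u: "u \<in> hom A' A" and f: "quadratic A B f" and v: "v \<in> hom B B'"
  shows "quadratic A' B' (\<lambda>x. v (f (u x)))"
proof (rule quadraticI[OF A' B'])
  note f' = quadraticD[OF B A f]
  interpret B: group B by fact
  have fcl: "\<And>x. x \<in> carrier A \<Longrightarrow> f x \<in> carrier B"
    using f'(1) by auto
  show "(\<lambda>x. v (f (u x))) \<in> carrier A' \<rightarrow> carrier B'"
    by (simp add: Pi_iff fcl hom_in_carrier[OF u] hom_in_carrier[OF v])
  show "bihom A' B' (\<lambda>x y. v (deviation A B f (u x) (u y)))"
    by (rule bihom_compose[OF f'(2) u v])
  show "v (f (u (x \<otimes>\<^bsub>A'\<^esub> y))) = v (f (u x)) \<otimes>\<^bsub>B'\<^esub> v (f (u y)) \<otimes>\<^bsub>B'\<^esub> v (deviation A B f (u x) (u y))"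
    if "x \<in> carrier A'" "y \<in> carrier A'" for x y
    using that by (simp add: f'(3) fcl bihom_closed[OF f'(2)] hom_mult[OF u] hom_mult[OF v] hom_in_carrier[OF u])
qed

text \<open>The deviation at elements of the carrier evaluates the map only on the carrier, by
  closure under products. This permits passing between a map and its restriction.\<close>

lemma quadratic_cong:
  assumes "\<And>x. x \<in> carrier G \<Longrightarrow> f x = g x" and "group G"
  shows "quadratic G H f \<longleftrightarrow> quadratic G H g"
proof -
  interpret group G by fact
  have "deviation G H f x y = deviation G H g x y" if "x \<in> carrier G" "y \<in> carrier G" for x y
    using that by (simp add: deviation_def assms(1))
  then show ?thesis
    unfolding quadratic_def weakly_quadratic_def using assms(1) by (simp add: Pi_iff)
qed

lemma comm_group_quad_group:
  assumes A: "group A" and B: "comm_group B"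
  shows "comm_group (quad_group A B)"
  unfolding quad_group_def
proof (rule comm_group_pointwise[OF B])
  interpret A: group A by fact
  interpret B: comm_group B by fact
  note qD = quadraticD[OF B.is_group A]
  show "{f. quadratic A B f} \<inter> extensional (carrier A) \<subseteq> carrier A \<rightarrow>\<^sub>E carrier B"
    using qD(1) by (auto simp: PiE_def)
  have r: "quadratic A B (restrict f (carrier A)) \<longleftrightarrow> quadratic A B f" for f
    by (rule quadratic_cong[OF _ A]) simp
  have "quadratic A B (\<lambda>x. \<one>\<^bsub>B\<^esub>)"
    by (rule quadraticI[OF A B _ bihom_one[OF B]]) auto
  then show "(\<lambda>x\<in>carrier A. \<one>\<^bsub>B\<^esub>) \<in> {f. quadratic A B f} \<inter> extensional (carrier A)"
    using r by simp
  fix f assume f: "f \<in> {f. quadratic A B f} \<inter> extensional (carrier A)"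
  then have cl: "\<And>x. x \<in> carrier A \<Longrightarrow> f x \<in> carrier B" and b: "bihom A B (deviation A B f)"
    and q: "quadratic A B f"
    using qD(1,2) by blast+
  have "quadratic A B (\<lambda>x. inv\<^bsub>B\<^esub> (f x))"
    by (rule quadraticI[OF A B _ bihom_inv[OF B b]])
      (simp_all add: cl qD(3)[OF q] bihom_closed[OF b] B.inv_mult)
  then show "(\<lambda>x\<in>carrier A. inv\<^bsub>B\<^esub> f x) \<in> {f. quadratic A B f} \<inter> extensional (carrier A)"
    using r by simp
  fix g assume g: "g \<in> {f. quadratic A B f} \<inter> extensional (carrier A)"
  then have cl': "\<And>x. x \<in> carrier A \<Longrightarrow> g x \<in> carrier B" and b': "bihom A B (deviation A B g)"
    and q': "quadratic A B g"
    using qD(1,2) by blast+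
  have "quadratic A B (\<lambda>x. f x \<otimes>\<^bsub>B\<^esub> g x)"
    by (rule quadraticI[OF A B _ bihom_prod[OF B b b']])
      (simp_all add: cl cl' qD(3)[OF q] qD(3)[OF q'] bihom_closed[OF b] bihom_closed[OF b'] B.m_ac)
  then show "(\<lambda>x\<in>carrier A. f x \<otimes>\<^bsub>B\<^esub> g x) \<in> {f. quadratic A B f} \<inter> extensional (carrier A)"
    using r by simp
qed

section \<open>q-maps\<close>

text \<open>As for quadratic maps, a bilinear correction term is forced to be the deviation. The
  commutation condition follows because \<open>\<delta>\<close> takes values in the commutator
  subgroup of \<open>H\<close>, which is central.\<close>

lemma q_mapI:
  assumes G: "nil2 G" and H: "nil2 H" and f: "f \<in> carrier G \<rightarrow> carrier H"
    and \<delta>: "bihom G (comm_sub H) \<delta>"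
    and eq: "\<And>x y. x \<in> carrier G \<Longrightarrow> y \<in> carrier G \<Longrightarrow> f (x \<otimes>\<^bsub>G\<^esub> y) = f x \<otimes>\<^bsub>H\<^esub> f y \<otimes>\<^bsub>H\<^esub> \<delta> x y"
  shows "q_map G H f"
proof -
  interpret G: nil2 G by fact
  interpret H: nil2 H by fact
  have fcl: "\<And>x. x \<in> carrier G \<Longrightarrow> f x \<in> carrier H"
    using f by auto
  have \<delta>cl: "\<And>x y. x \<in> carrier G \<Longrightarrow> y \<in> carrier G \<Longrightarrow> \<delta> x y \<in> derived H (carrier H)"
    using bihom_closed[OF \<delta>] by simp
  have dev: "deviation G H f x y = \<delta> x y" if "x \<in> carrier G" "y \<in> carrier G" for x y
    using that by (intro deviation_eqI) (simp_all add: fcl \<delta>cl eq)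
  show ?thesis
    unfolding q_map_def weakly_quadratic_def
    using f bihom_mult_left[OF \<delta>] bihom_mult_right[OF \<delta>]
    by (simp add: G.nil2_group H.nil2_group dev fcl \<delta>cl H.central)
qed

lemma q_map_hom:
  assumes G: "nil2 G" and H: "nil2 H" and f: "f \<in> hom G H"
  shows "q_map G H f"
proof -
  interpret H: nil2 H by fact
  show ?thesis
    by (rule q_mapI[OF G H _ bihom_one[OF H.comm_group_comm_sub]])
      (use f in \<open>auto simp: hom_def Pi_iff\<close>)
qed

lemma q_map_cong:
  assumes "\<And>x. x \<in> carrier G \<Longrightarrow> f x = g x" and f: "q_map G H f"
  shows "q_map G H g"
proof -
  interpret G: group G
    using f by (simp add: q_map_def nil2_group_def)
  have "deviation G H f x y = deviation G H g x y" if "x \<in> carrier G" "y \<in> carrier G" for x y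
    using that by (simp add: deviation_def assms(1))
  then show ?thesis
    using f assms(1) by (simp add: q_map_def weakly_quadratic_def Pi_iff)
qed

locale q_mapping = G: nil2 G + H: nil2 H for G :: "'a monoid" (structure) and H :: "'b monoid" (structure) +
  fixes f assumes q_map: "q_map G H f"
begin

lemma f_funcset: "f \<in> carrier G \<rightarrow> carrier H"
  using q_map by (simp add: q_map_def weakly_quadratic_def)

lemma f_closed [simp]: "x \<in> carrier G \<Longrightarrow> f x \<in> carrier H"
  using f_funcset by auto

definition "dev = deviation G H f"

lemma dev_bihom: "bihom G (comm_sub H) dev"
  unfolding dev_def
  by (rule bihomI; use q_map in \<open>unfold q_map_def weakly_quadratic_def, simp\<close>)

lemma dev_closed [simp]: "x \<in> carrier G \<Longrightarrow> y \<in> carrier G \<Longrightarrow> dev x y \<in> derived H (carrier H)"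
  using bihom_closed[OF dev_bihom] by simp

lemma f_mult: "x \<in> carrier G \<Longrightarrow> y \<in> carrier G \<Longrightarrow> f (x \<otimes> y) = f x \<otimes>\<^bsub>H\<^esub> f y \<otimes>\<^bsub>H\<^esub> dev x y"
  unfolding dev_def by (rule deviation_eq) simp_all

lemma dev_derived_right: "x \<in> carrier G \<Longrightarrow> c \<in> derived G (carrier G) \<Longrightarrow> dev x c = \<one>\<^bsub>H\<^esub>"
  and dev_derived_left: "x \<in> carrier G \<Longrightarrow> c \<in> derived G (carrier G) \<Longrightarrow> dev c x = \<one>\<^bsub>H\<^esub>"
  using hom_derived_eq_one[OF G.is_group H.comm_group_comm_sub, of "dev x" c]
    hom_derived_eq_one[OF G.is_group H.comm_group_comm_sub, of "\<lambda>y. dev y x" c] dev_bihom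
  by (simp_all add: bihom_def)

lemma f_mult_derived:
  "x \<in> carrier G \<Longrightarrow> c \<in> derived G (carrier G) \<Longrightarrow> f (x \<otimes> c) = f x \<otimes>\<^bsub>H\<^esub> f c"
  by (simp add: f_mult dev_derived_right)

text \<open>The neutral element lies in the commutator subgroup, so \<open>f \<one>\<close> equals
  its own square.\<close>

lemma f_one [simp]: "f \<one> = \<one>\<^bsub>H\<^esub>"
  using f_mult_derived[of \<one> \<one>] H.r_cancel_one[of "f \<one>" "f \<one>"] by simp

lemma ab_class_f_hom: "(\<lambda>x. ab_class H (f x)) \<in> hom G (ab_quot H)"
  by (rule homI) (simp_all add: f_mult)

text \<open>Deviations become trivial in the abelianisation of \<open>H\<close>, so \<open>f\<close>
  followed by \<open>ab_class H\<close> is a homomorphism into an abelian group and kills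
  commutators. A trivial class means that the value itself lies in the commutator subgroup.\<close>

lemma f_derived [simp]:
  assumes "c \<in> derived G (carrier G)" shows "f c \<in> derived H (carrier H)"
  using hom_derived_eq_one[OF G.is_group H.comm_group_ab_quot ab_class_f_hom assms] assms
  by (simp add: H.one_ab_quot H.ab_class_derived_iff)

lemma ab_map_class: 
  assumes x: "x \<in> carrier G" shows "ab_map G H f (ab_class G x) = ab_class H (f x)"
proof -
  have "ab_class H (f y) = ab_class H (f x)" if "y \<in> ab_class G x" for y
    using that x by (auto simp: G.mem_ab_class f_mult_derived)
  then have "(\<lambda>y. ab_class H (f y)) ` ab_class G x = {ab_class H (f x)}"
    using G.ab_class_self[OF x] by blast
  then show ?thesis
    using x by (simp add: ab_map_def)
qed

lemma ab_map_hom: "ab_map G H f \<in> hom (ab_quot G) (ab_quot H)"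
  by (rule homI) (auto simp: G.carrier_ab_quot ab_map_class f_mult)

lemma comm_map_derived: "c \<in> derived G (carrier G) \<Longrightarrow> comm_map G f c = f c"
  by (simp add: comm_map_def)

lemma comm_map_hom: "comm_map G f \<in> hom (comm_sub G) (comm_sub H)"
  by (rule homI) (simp_all add: comm_map_derived f_mult_derived)

end

lemma q_mappingI: "q_map G H f \<Longrightarrow> q_mapping G H f"
  by (simp add: q_mapping_def q_mapping_axioms_def q_map_def nil2_group_iff)

text \<open>The deviation of the composite is
  \<open>g.dev (f x) (f y) \<otimes> g (f.dev x y)\<close>. The first factor is bilinear because
  \<open>g.dev\<close> ignores the commutator by which \<open>f\<close> fails to be multiplicative;
  the second because \<open>g\<close> is multiplicative on commutators.\<close>

lemma q_map_compose:
  assumes f: "q_map G H f" and g: "q_map H K g"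
  shows "q_map G K (\<lambda>x. g (f x))"
proof -
  interpret f: q_mapping G H f using f by (rule q_mappingI)
  interpret g: q_mapping H K g using g by (rule q_mappingI)
  interpret K: comm_group "comm_sub K" by (rule g.H.comm_group_comm_sub)
  have 1: "bihom G (comm_sub K) (\<lambda>x y. g.dev (f x) (f y))"
  proof (rule bihomI)
    fix x y z assume xyz: "x \<in> carrier G" "y \<in> carrier G" "z \<in> carrier G"
    show "g.dev (f (x \<otimes>\<^bsub>G\<^esub> y)) (f z) = g.dev (f x) (f z) \<otimes>\<^bsub>comm_sub K\<^esub> g.dev (f y) (f z)"
      using xyz by (simp add: f.f_mult bihom_mult_left[OF g.dev_bihom] g.dev_derived_left)
    show "g.dev (f x) (f (y \<otimes>\<^bsub>G\<^esub> z)) = g.dev (f x) (f y) \<otimes>\<^bsub>comm_sub K\<^esub> g.dev (f x) (f z)"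
      using xyz by (simp add: f.f_mult bihom_mult_right[OF g.dev_bihom] g.dev_derived_right)
  qed simp
  have 2: "bihom G (comm_sub K) (\<lambda>x y. g (f.dev x y))"
    by (rule bihomI)
      (simp_all add: bihom_mult_left[OF f.dev_bihom] bihom_mult_right[OF f.dev_bihom] g.f_mult_derived)
  show ?thesis
  proof (rule q_mapI[OF f.G.nil2_axioms g.H.nil2_axioms _ bihom_prod[OF K.comm_group_axioms 1 2]])
    fix x y assume xy: "x \<in> carrier G" "y \<in> carrier G"
    then show "g (f (x \<otimes>\<^bsub>G\<^esub> y)) =
        g (f x) \<otimes>\<^bsub>K\<^esub> g (f y) \<otimes>\<^bsub>K\<^esub> (g.dev (f x) (f y) \<otimes>\<^bsub>comm_sub K\<^esub> g (f.dev x y))"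
      by (simp add: f.f_mult g.f_mult_derived g.f_mult g.H.m_assoc)
  qed simp
qed

section \<open>Pointwise products and inverses of q-maps\<close>

lemma (in nil2) mult_central_swap:
  assumes "a \<in> carrier G" "b \<in> carrier G" "c \<in> D" "d \<in> D"
  shows "(a \<otimes> c) \<otimes> (b \<otimes> d) = (a \<otimes> b) \<otimes> (c \<otimes> d)"
  using assms central_left[of c b d] by (simp add: m_assoc)

context
  fixes H :: "'b monoid"
begin

private abbreviation mult_H (infixl "\<cdot>" 70) where "x \<cdot> y \<equiv> x \<otimes>\<^bsub>H\<^esub> y"

text \<open>The values of \<open>h\<close> are central and can be collected at the end, so the
  deviation of the product is \<open>f.dev\<close> times the deviation of \<open>h\<close> pulled
  back along \<open>ab_class G\<close>.\<close>

lemma q_map_mult_quadratic: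
  assumes f: "q_map G H f" and h: "quadratic (ab_quot G) (comm_sub H) h"
  shows "q_map G H (\<lambda>x. f x \<cdot> h (ab_class G x))"
proof -
  interpret f: q_mapping G H f using f by (rule q_mappingI)
  interpret H': comm_group "comm_sub H" by (rule f.H.comm_group_comm_sub)
  interpret A: comm_group "ab_quot G" by (rule f.G.comm_group_ab_quot)
  note h' = quadraticD[OF H'.is_group A.is_group h]
  let ?d = "deviation (ab_quot G) (comm_sub H) h"
  have hcl: "x \<in> carrier G \<Longrightarrow> h (ab_class G x) \<in> derived H (carrier H)" for x
    using h'(1) f.G.ab_class_closed by (simp add: Pi_iff)
  have 1: "bihom G (comm_sub H) (\<lambda>x y. ?d (ab_class G x) (ab_class G y))"
    using bihom_compose[OF h'(2) f.G.ab_class_hom, of "\<lambda>x. x" "comm_sub H"] by (simp add: hom_def)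
  have dcl: "x \<in> carrier G \<Longrightarrow> y \<in> carrier G \<Longrightarrow> ?d (ab_class G x) (ab_class G y) \<in> derived H (carrier H)" for x y
    using bihom_closed[OF 1] by simp
  show ?thesis
  proof (rule q_mapI[OF f.G.nil2_axioms f.H.nil2_axioms _ bihom_prod[OF H'.comm_group_axioms f.dev_bihom 1]])
    fix x y assume xy: "x \<in> carrier G" "y \<in> carrier G"
    have h_xy: "h (ab_class G (x \<otimes>\<^bsub>G\<^esub> y)) = h (ab_class G x) \<cdot> h (ab_class G y) \<cdot> ?d (ab_class G x) (ab_class G y)"
      using h'(3)[of "ab_class G x" "ab_class G y"] xy by simp
    show "f (x \<otimes>\<^bsub>G\<^esub> y) \<cdot> h (ab_class G (x \<otimes>\<^bsub>G\<^esub> y)) =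
        f x \<cdot> h (ab_class G x) \<cdot> (f y \<cdot> h (ab_class G y)) \<cdot>
        (f.dev x y \<otimes>\<^bsub>comm_sub H\<^esub> ?d (ab_class G x) (ab_class G y))"
      using xy by (simp add: h_xy f.f_mult hcl dcl f.H.mult_central_swap)
  qed (simp add: hcl)
qed

text \<open>Reordering \<open>f x \<otimes> f y \<otimes> g x \<otimes> g y\<close> costs the commutator of \<open>f y\<close> and \<open>g x\<close>, which is bilinear in
  \<open>(x, y)\<close> because \<open>H\<close> has class two.\<close>

lemma q_map_mult:
  assumes f: "q_map G H f" and g: "q_map G H g"
  shows "q_map G H (\<lambda>x. f x \<cdot> g x)"
proof -
  interpret f: q_mapping G H f using f by (rule q_mappingI)
  interpret g: q_mapping G H g using g by (rule q_mappingI)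
  interpret H': comm_group "comm_sub H" by (rule f.H.comm_group_comm_sub)
  let ?c = "\<lambda>x y. f.H.pairing (f y) (g x)"
  have 1: "bihom G (comm_sub H) ?c"
    by (rule bihomI)
      (simp_all add: f.f_mult g.f_mult f.H.pairing_mult_left f.H.pairing_mult_right f.H.pairing_derived_left f.H.pairing_derived_right)
  show ?thesis
  proof (rule q_mapI[OF f.G.nil2_axioms f.H.nil2_axioms _
        bihom_prod[OF H'.comm_group_axioms 1 bihom_prod[OF H'.comm_group_axioms f.dev_bihom g.dev_bihom]]])
    fix x y assume xy: "x \<in> carrier G" "y \<in> carrier G"
    have "f x \<cdot> f y \<cdot> (g x \<cdot> g y) = f x \<cdot> (f y \<cdot> g x) \<cdot> g y"
      using xy by (simp add: f.H.m_assoc)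
    also have "f y \<cdot> g x = g x \<cdot> f y \<cdot> ?c x y"
      using xy by (simp add: f.H.pairing_swap[symmetric])
    also have "f x \<cdot> (g x \<cdot> f y \<cdot> ?c x y) \<cdot> g y =
        f x \<cdot> g x \<cdot> (f y \<cdot> g y) \<cdot> ?c x y"
      using xy f.H.central[of "?c x y" "g y"] by (simp add: f.H.m_assoc)
    finally have "f x \<cdot> f y \<cdot> (g x \<cdot> g y) = f x \<cdot> g x \<cdot> (f y \<cdot> g y) \<cdot> ?c x y" .
    then show "f (x \<otimes>\<^bsub>G\<^esub> y) \<cdot> g (x \<otimes>\<^bsub>G\<^esub> y) = f x \<cdot> g x \<cdot> (f y \<cdot> g y) \<cdot>
        (?c x y \<otimes>\<^bsub>comm_sub H\<^esub> (f.dev x y \<otimes>\<^bsub>comm_sub H\<^esub> g.dev x y))"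
      using xy by (simp add: f.f_mult g.f_mult f.H.mult_central_swap) (simp add: f.H.m_assoc)
  qed simp
qed

text \<open>Inversion reverses \<open>f x \<otimes> f y\<close>. Restoring the order costs the
  pairing of \<open>f y\<close> and \<open>f x\<close>, which is bilinear in \<open>x\<close> and
  \<open>y\<close> because the pairing does not see the deviations of \<open>f\<close>; the
  remaining correction is the inverse deviation.\<close>

lemma q_map_inv:
  assumes f: "q_map G H f"
  shows "q_map G H (\<lambda>x. inv\<^bsub>H\<^esub> (f x))"
proof -
  interpret f: q_mapping G H f using f by (rule q_mappingI)
  interpret H': comm_group "comm_sub H" by (rule f.H.comm_group_comm_sub)
  let ?c = "\<lambda>x y. f.H.pairing (f y) (f x)"
  have 1: "bihom G (comm_sub H) ?c"
    by (rule bihomI)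
      (simp_all add: f.f_mult f.H.pairing_mult_left f.H.pairing_mult_right f.H.pairing_derived_left f.H.pairing_derived_right)
  show ?thesis
  proof (rule q_mapI[OF f.G.nil2_axioms f.H.nil2_axioms _
        bihom_prod[OF H'.comm_group_axioms 1 bihom_inv[OF H'.comm_group_axioms f.dev_bihom]]])
    fix x y assume xy: "x \<in> carrier G" "y \<in> carrier G"
    have "inv\<^bsub>H\<^esub> (f x \<cdot> f y) = inv\<^bsub>H\<^esub> (f y \<cdot> f x) \<cdot> ?c x y"
    proof (rule f.H.inv_equality)
      have "inv\<^bsub>H\<^esub> (f y \<cdot> f x) \<cdot> ?c x y \<cdot> (f x \<cdot> f y) =
          inv\<^bsub>H\<^esub> (f y \<cdot> f x) \<cdot> (f x \<cdot> f y \<cdot> ?c x y)"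
        using xy f.H.central[of "?c x y" "f x \<cdot> f y"] f.H.m_assoc by simp
      also have "f x \<cdot> f y \<cdot> ?c x y = f y \<cdot> f x"
        using xy by (simp add: f.H.pairing_swap[symmetric])
      finally show "inv\<^bsub>H\<^esub> (f y \<cdot> f x) \<cdot> ?c x y \<cdot> (f x \<cdot> f y) = \<one>\<^bsub>H\<^esub>"
        using xy by simp
    qed (use xy in simp_all)
    also have "inv\<^bsub>H\<^esub> (f y \<cdot> f x) = inv\<^bsub>H\<^esub> (f x) \<cdot> inv\<^bsub>H\<^esub> (f y)"
      using xy by (simp add: f.H.inv_mult_group)
    finally have "inv\<^bsub>H\<^esub> (f x \<cdot> f y) = inv\<^bsub>H\<^esub> (f x) \<cdot> inv\<^bsub>H\<^esub> (f y) \<cdot> ?c x y" .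
    moreover have "inv\<^bsub>H\<^esub> (f (x \<otimes>\<^bsub>G\<^esub> y)) = inv\<^bsub>H\<^esub> (f x \<cdot> f y) \<cdot> inv\<^bsub>H\<^esub> (f.dev x y)"
      using xy f.H.central[of "inv\<^bsub>H\<^esub> (f.dev x y)" "inv\<^bsub>H\<^esub> (f x \<cdot> f y)"]
      by (simp add: f.f_mult f.H.inv_mult_group[of _ "f.dev x y"])
    ultimately show "inv\<^bsub>H\<^esub> (f (x \<otimes>\<^bsub>G\<^esub> y)) = inv\<^bsub>H\<^esub> (f x) \<cdot> inv\<^bsub>H\<^esub> (f y) \<cdot>
        (?c x y \<otimes>\<^bsub>comm_sub H\<^esub> inv\<^bsub>comm_sub H\<^esub> (f.dev x y))"
      using xy by (simp add: f.H.m_assoc)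
  qed simp
qed

end

section \<open>Tensor products\<close>

abbreviation "free_pairs A B \<equiv> free_Abelian_group (carrier A \<times> carrier B)"

lemma tensor_relations_closed:
  assumes "group A" "group B"
  shows "tensor_relations A B \<subseteq> carrier (free_pairs A B)"
proof -
  interpret A: group A by fact
  interpret B: group B by fact
  show ?thesis
    by (auto simp: tensor_relations_def dest!: subsetD[OF keys_diff])
qed

lemma tensor_kernel_normal:
  assumes "group A" "group B"
  shows "tensor_kernel A B \<lhd> free_pairs A B"
  unfolding tensor_kernel_def
  by (intro comm_group.subgroup_imp_normal abelian_free_Abelian_group
      group.generate_is_subgroup group_free_Abelian_group tensor_relations_closed assms)

lemma comm_group_tensor_group:
  assumes "group A" "group B" shows "comm_group (tensor_group A B)"
  unfolding tensor_group_def
  by (rule comm_group.abelian_FactGroup[OF abelian_free_Abelian_group])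
    (rule normal_imp_subgroup[OF tensor_kernel_normal[OF assms]])

lemma tensor_carrier:
  "carrier (tensor_group A B) =
     (\<lambda>c. tensor_kernel A B #>\<^bsub>free_pairs A B\<^esub> c) `
       carrier (free_pairs A B)"
  by (simp add: tensor_group_def carrier_FactGroup)

lemma pure_tensor_closed:
  "a \<in> carrier A \<Longrightarrow> b \<in> carrier B \<Longrightarrow> pure_tensor A B a b \<in> carrier (tensor_group A B)"
  unfolding tensor_carrier pure_tensor_def by (rule imageI) simp

lemma tensor_coset_eqI:
  assumes AB: "group A" "group B" and c: "c \<in> carrier (free_pairs A B)"
    and r: "c' - c \<in> tensor_relations A B"
  shows "tensor_kernel A B #>\<^bsub>free_pairs A B\<^esub> c' =
    tensor_kernel A B #>\<^bsub>free_pairs A B\<^esub> c"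
proof -
  interpret normal "tensor_kernel A B" "free_pairs A B"
    by (rule tensor_kernel_normal[OF AB])
  have "c' - c \<in> tensor_kernel A B"
    unfolding tensor_kernel_def using r by (rule generate.incl)
  then have "c' \<in> tensor_kernel A B #>\<^bsub>free_pairs A B\<^esub> c"
    by (auto simp: r_coset_def intro!: bexI[of _ "c' - c"])
  then show ?thesis
    using repr_independence[OF _ c is_subgroup] by simp
qed

lemma pure_tensor_mult:
  assumes AB: "group A" "group B"
  shows "a \<in> carrier A \<Longrightarrow> a' \<in> carrier A \<Longrightarrow> b \<in> carrier B \<Longrightarrow>
      pure_tensor A B (a \<otimes>\<^bsub>A\<^esub> a') b = pure_tensor A B a b \<otimes>\<^bsub>tensor_group A B\<^esub> pure_tensor A B a' b"
    and "a \<in> carrier A \<Longrightarrow> b \<in> carrier B \<Longrightarrow> b' \<in> carrier B \<Longrightarrow>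
      pure_tensor A B a (b \<otimes>\<^bsub>B\<^esub> b') = pure_tensor A B a b \<otimes>\<^bsub>tensor_group A B\<^esub> pure_tensor A B a b'"
proof -
  interpret normal "tensor_kernel A B" "free_pairs A B"
    by (rule tensor_kernel_normal[OF AB])
  have sum: "pure_tensor A B a b \<otimes>\<^bsub>tensor_group A B\<^esub> pure_tensor A B a' b' =
      tensor_kernel A B #>\<^bsub>free_pairs A B\<^esub> (frag_of (a, b) + frag_of (a', b'))"
    if "a \<in> carrier A" "b \<in> carrier B" "a' \<in> carrier A" "b' \<in> carrier B" for a b a' b'
    using rcos_sum[of "frag_of (a, b)" "frag_of (a', b')"] that
    by (simp add: pure_tensor_def tensor_group_def)
  have keys: "Poly_Mapping.keys (frag_of (a, b) + frag_of (a', b')) \<subseteq> carrier A \<times> carrier B"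
    if "a \<in> carrier A" "b \<in> carrier B" "a' \<in> carrier A" "b' \<in> carrier B" for a b a' b'
    using that by (auto dest!: subsetD[OF keys_add])
  show "pure_tensor A B (a \<otimes>\<^bsub>A\<^esub> a') b = pure_tensor A B a b \<otimes>\<^bsub>tensor_group A B\<^esub> pure_tensor A B a' b"
    if "a \<in> carrier A" "a' \<in> carrier A" "b \<in> carrier B"
    unfolding sum[OF that(1,3,2,3)] unfolding pure_tensor_def
  proof (rule tensor_coset_eqI[OF AB])
    show "frag_of (a \<otimes>\<^bsub>A\<^esub> a', b) - (frag_of (a, b) + frag_of (a', b)) \<in> tensor_relations A B"
      unfolding tensor_relations_def diff_diff_eq[symmetric] using that by blast
  qed (use keys that in simp)
  show "pure_tensor A B a (b \<otimes>\<^bsub>B\<^esub> b') = pure_tensor A B a b \<otimes>\<^bsub>tensor_group A B\<^esub> pure_tensor A B a b'"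
    if "a \<in> carrier A" "b \<in> carrier B" "b' \<in> carrier B"
    unfolding sum[OF that(1,2,1,3)] unfolding pure_tensor_def
  proof (rule tensor_coset_eqI[OF AB])
    show "frag_of (a, b \<otimes>\<^bsub>B\<^esub> b') - (frag_of (a, b) + frag_of (a, b')) \<in> tensor_relations A B"
      unfolding tensor_relations_def diff_diff_eq[symmetric] using that by blast
  qed (use keys that in simp)
qed

lemma bihom_pure_tensor: "group A \<Longrightarrow> bihom A (tensor_group A A) (pure_tensor A A)"
  by (rule bihomI) (simp_all add: pure_tensor_closed pure_tensor_mult)

section \<open>Functoriality of the tensor product\<close>

context
  fixes A :: "'a monoid" and B :: "'b monoid" and A' :: "'c monoid" and B' :: "'d monoid" and u v
  assumes grp: "group A" "group B" "group A'" "group B'"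
    and u: "u \<in> hom A A'" and v: "v \<in> hom B B'"
begin

private abbreviation "fe \<equiv> frag_extend (\<lambda>(a, b). frag_of (u a, v b))"
private abbreviation "FA \<equiv> free_pairs A B"
private abbreviation "FB \<equiv> free_pairs A' B'"

private lemma fe_closed: "Poly_Mapping.keys c \<subseteq> carrier A \<times> carrier B \<Longrightarrow>
    Poly_Mapping.keys (fe c) \<subseteq> carrier A' \<times> carrier B'"
proof (rule free_Abelian_group_induct[where P = "\<lambda>c. Poly_Mapping.keys (fe c) \<subseteq> carrier A' \<times> carrier B'"])
  fix x y assume "Poly_Mapping.keys (fe x) \<subseteq> carrier A' \<times> carrier B'"
    "Poly_Mapping.keys (fe y) \<subseteq> carrier A' \<times> carrier B'"
  then show "Poly_Mapping.keys (fe (x - y)) \<subseteq> carrier A' \<times> carrier B'"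
    using keys_diff[of "fe x" "fe y"] by (auto simp: frag_extend_diff)
qed (auto simp: hom_in_carrier[OF u] hom_in_carrier[OF v])

private lemma fe_hom: "fe \<in> hom FA FB"
  by (rule homI) (use fe_closed in \<open>simp_all add: frag_extend_add\<close>)

text \<open>Since \<open>u\<close> and \<open>v\<close> are homomorphisms, each biadditivity
  relation for \<open>A\<close> and \<open>B\<close> is sent to one of the same shape for
  \<open>A'\<close> and \<open>B'\<close>; images of generated subgroups are generated by the
  images.\<close>

private lemma fe_kernel: "k \<in> tensor_kernel A B \<Longrightarrow> fe k \<in> tensor_kernel A' B'"
proof -
  interpret A: group A by (rule grp)
  interpret B: group B by (rule grp)
  interpret group_hom FA FB fe
    by (simp add: group_hom_def group_hom_axioms_def fe_hom)
  have "fe ` tensor_relations A B \<subseteq> tensor_relations A' B'"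
  proof
    fix r assume "r \<in> fe ` tensor_relations A B"
    then obtain x where x: "x \<in> tensor_relations A B" "r = fe x" by blast
    from x(1) consider
      a a' b where "x = frag_of (a \<otimes>\<^bsub>A\<^esub> a', b) - frag_of (a, b) - frag_of (a', b)"
        "a \<in> carrier A" "a' \<in> carrier A" "b \<in> carrier B"
      | a b b' where "x = frag_of (a, b \<otimes>\<^bsub>B\<^esub> b') - frag_of (a, b) - frag_of (a, b')"
        "a \<in> carrier A" "b \<in> carrier B" "b' \<in> carrier B"
      unfolding tensor_relations_def by blast
    then show "r \<in> tensor_relations A' B'"
    proof cases
      case 1
      then have "r = frag_of (u a \<otimes>\<^bsub>A'\<^esub> u a', v b) - frag_of (u a, v b) - frag_of (u a', v b)"
        using x(2) by (simp add: frag_extend_diff Group.hom_mult[OF u])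
      then show ?thesis
        unfolding tensor_relations_def using 1 hom_in_carrier[OF u] hom_in_carrier[OF v] by blast
    next
      case 2
      then have "r = frag_of (u a, v b \<otimes>\<^bsub>B'\<^esub> v b') - frag_of (u a, v b) - frag_of (u a, v b')"
        using x(2) by (simp add: frag_extend_diff Group.hom_mult[OF v])
      then show ?thesis
        unfolding tensor_relations_def using 2 hom_in_carrier[OF u] hom_in_carrier[OF v] by blast
    qed
  qed
  then have "generate FB (fe ` tensor_relations A B) \<subseteq> tensor_kernel A' B'"
    unfolding tensor_kernel_def by (rule H.mono_generate)
  then show "fe k \<in> tensor_kernel A' B'" if "k \<in> tensor_kernel A B"
    using that generate_img[OF tensor_relations_closed[OF grp(1,2)]] unfolding tensor_kernel_def by blast
qed

text \<open>Representatives of a coset differ by the kernel, which \<open>fe\<close> maps into the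
  target kernel, so the union in \<open>tensor_map\<close> is a single coset.\<close>

private lemma tensor_map_coset:
  assumes c: "c \<in> carrier FA"
  shows "tensor_map A B A' B' u v (tensor_kernel A B #>\<^bsub>FA\<^esub> c) = tensor_kernel A' B' #>\<^bsub>FB\<^esub> fe c"
proof -
  interpret K: normal "tensor_kernel A B" FA
    by (rule tensor_kernel_normal[OF grp(1,2)])
  interpret K': normal "tensor_kernel A' B'" FB
    by (rule tensor_kernel_normal[OF grp(3,4)])
  have fc: "fe c \<in> carrier FB"
    using c fe_closed by simp
  have "(\<Union>c'\<in>tensor_kernel A B #>\<^bsub>FA\<^esub> c. tensor_kernel A' B' #>\<^bsub>FB\<^esub> fe c') = tensor_kernel A' B' #>\<^bsub>FB\<^esub> fe c"
  proof (rule UN_constant_eq[OF K.rcos_self[OF c K.is_subgroup]], rule ballI)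
    fix c' assume "c' \<in> tensor_kernel A B #>\<^bsub>FA\<^esub> c"
    then obtain k where "k \<in> tensor_kernel A B" "c' = k + c"
      by (auto simp: r_coset_def)
    then have "fe c' \<in> tensor_kernel A' B' #>\<^bsub>FB\<^esub> fe c"
      using fe_kernel by (auto simp: r_coset_def frag_extend_add)
    then show "tensor_kernel A' B' #>\<^bsub>FB\<^esub> fe c' = tensor_kernel A' B' #>\<^bsub>FB\<^esub> fe c"
      using K'.repr_independence[OF _ fc K'.is_subgroup] by simp
  qed
  moreover have "tensor_kernel A B #>\<^bsub>FA\<^esub> c \<in> carrier (tensor_group A B)"
    unfolding tensor_carrier using c by (rule imageI)
  ultimately show ?thesis
    by (simp add: tensor_map_def)
qed

lemma tensor_map_pure:
  "a \<in> carrier A \<Longrightarrow> b \<in> carrier B \<Longrightarrow>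
    tensor_map A B A' B' u v (pure_tensor A B a b) = pure_tensor A' B' (u a) (v b)"
  unfolding pure_tensor_def by (subst tensor_map_coset) simp_all

lemma tensor_map_hom: "tensor_map A B A' B' u v \<in> hom (tensor_group A B) (tensor_group A' B')"
proof (rule homI)
  interpret K: normal "tensor_kernel A B" FA
    by (rule tensor_kernel_normal[OF grp(1,2)])
  interpret K': normal "tensor_kernel A' B'" FB
    by (rule tensor_kernel_normal[OF grp(3,4)])
  note fcl = hom_in_carrier[OF fe_hom]
  fix X assume "X \<in> carrier (tensor_group A B)"
  then obtain c where c: "c \<in> carrier FA" "X = tensor_kernel A B #>\<^bsub>FA\<^esub> c"
    unfolding tensor_carrier by blast
  then show "tensor_map A B A' B' u v X \<in> carrier (tensor_group A' B')"
    unfolding c(2) tensor_map_coset[OF c(1)] tensor_carrier by (intro imageI fcl)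
  fix Y assume "Y \<in> carrier (tensor_group A B)"
  then obtain d where d: "d \<in> carrier FA" "Y = tensor_kernel A B #>\<^bsub>FA\<^esub> d"
    unfolding tensor_carrier by blast
  have "X \<otimes>\<^bsub>tensor_group A B\<^esub> Y = tensor_kernel A B #>\<^bsub>FA\<^esub> (c \<otimes>\<^bsub>FA\<^esub> d)"
    unfolding c(2) d(2) tensor_group_def mult_FactGroup by (rule K.rcos_sum[OF c(1) d(1)])
  moreover have "tensor_map A B A' B' u v X \<otimes>\<^bsub>tensor_group A' B'\<^esub> tensor_map A B A' B' u v Y =
      tensor_kernel A' B' #>\<^bsub>FB\<^esub> (fe c \<otimes>\<^bsub>FB\<^esub> fe d)"
    unfolding c(2) d(2) tensor_map_coset[OF c(1)] tensor_map_coset[OF d(1)] tensor_group_def mult_FactGroup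
    by (rule K'.rcos_sum[OF fcl[OF c(1)] fcl[OF d(1)]])
  ultimately show "tensor_map A B A' B' u v (X \<otimes>\<^bsub>tensor_group A B\<^esub> Y) =
      tensor_map A B A' B' u v X \<otimes>\<^bsub>tensor_group A' B'\<^esub> tensor_map A B A' B' u v Y"
    using tensor_map_coset[OF K.m_closed[OF c(1) d(1)]] hom_mult[OF fe_hom c(1) d(1)] by simp
qed

end

text \<open>Expanding \<open>\<beta>\<close> at \<open>(x \<otimes> y, x \<otimes> y)\<close> leaves
  the cross terms \<open>\<beta> x y \<otimes> \<beta> y x\<close>: the deviation is the
  symmetrisation of \<open>\<beta>\<close>.\<close>

lemma quadratic_diagonal:
  assumes A: "group A" and B: "comm_group B" and \<beta>: "bihom A B \<beta>"
  shows "quadratic A B (\<lambda>x. \<beta> x x)"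
proof -
  interpret A: group A by fact
  interpret B: comm_group B by fact
  have "bihom A B (\<lambda>x y. \<beta> y x)"
    using \<beta> by (auto simp: bihom_def)
  from bihom_prod[OF B \<beta> this] show ?thesis
    by (rule quadraticI[OF A B, rotated])
      (use \<beta> in \<open>auto simp: bihom_closed bihom_mult_left bihom_mult_right B.m_ac\<close>)
qed

section \<open>The category of nil-2 groups and its quotient by the coarse relation\<close>

lemma Niq_Obj [simp]: "G \<in> Obj Niq \<longleftrightarrow> nil2 G"
  by (simp add: Niq_def nil2_group_iff)

lemma Niq_Hom: "f \<in> Hom Niq G H \<longleftrightarrow> q_map G H f \<and> f \<in> extensional (carrier G)"
  by (simp add: Niq_def)

lemma Niq_Ident [simp]: "Ident Niq G = (\<lambda>x\<in>carrier G. x)"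
  and Niq_Comp [simp]: "Comp Niq G H K g f = compose (carrier G) g f"
  by (simp_all add: Niq_def)

lemma Niq_HomD: "f \<in> Hom Niq G H \<Longrightarrow> q_mapping G H f" "f \<in> Hom Niq G H \<Longrightarrow> f \<in> extensional (carrier G)"
  by (simp_all add: Niq_Hom q_mappingI)

lemma Niq_restrictI: "q_map G H f \<Longrightarrow> (\<lambda>x\<in>carrier G. f x) \<in> Hom Niq G H"
  by (simp add: Niq_Hom) (rule q_map_cong[of G f], simp_all)

lemma Niq_eqI:
  "f \<in> Hom Niq G H \<Longrightarrow> g \<in> Hom Niq G H \<Longrightarrow> (\<And>x. x \<in> carrier G \<Longrightarrow> f x = g x) \<Longrightarrow> f = g"
  by (rule extensionalityI[of _ "carrier G"]) (simp_all add: Niq_Hom)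

lemma category_Niq: "category Niq"
  unfolding category_def
proof (intro conjI ballI)
  fix G :: "'a monoid" assume "G \<in> Obj Niq"
  then show "Ident Niq G \<in> Hom Niq G G"
    unfolding Niq_Ident by (intro Niq_restrictI q_map_hom) (simp_all add: hom_def)
next
  fix G H K :: "'a monoid" and f g assume "f \<in> Hom Niq G H" "g \<in> Hom Niq H K"
  then have "q_map G H f" "q_map H K g"
    by (simp_all add: Niq_Hom)
  then show "Comp Niq G H K g f \<in> Hom Niq G K"
    unfolding Niq_Comp compose_def by (rule Niq_restrictI[OF q_map_compose])
next
  fix G H :: "'a monoid" and f assume f: "f \<in> Hom Niq G H"
  then interpret f: q_mapping G H f by (rule Niq_HomD)
  show "Comp Niq G G H f (Ident Niq G) = f"
    by (rule extensionalityI[OF _ Niq_HomD(2)[OF f]]) (simp_all add: compose_eq)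
  show "Comp Niq G H H (Ident Niq H) f = f"
    by (rule extensionalityI[OF _ Niq_HomD(2)[OF f]]) (simp_all add: compose_eq)
next
  fix G H K L :: "'a monoid" and f g h assume f: "f \<in> Hom Niq G H"
  then interpret f: q_mapping G H f by (rule Niq_HomD)
  show "Comp Niq G K L h (Comp Niq G H K g f) = Comp Niq G H L (Comp Niq H K L h g) f"
    by (simp add: compose_assoc[OF f.f_funcset])
qed

section \<open>The invariants \<open>ab_map\<close> and \<open>comm_map\<close> and the relation
  they define\<close>

lemma ab_map_ext: "ab_map G H f \<in> extensional (carrier (ab_quot G))"
  by (simp add: ab_map_def)

lemma comm_map_ext: "comm_map G f \<in> extensional (derived G (carrier G))"
  by (simp add: comm_map_def)

text \<open>Every element of the abelianisation is the class of an element of \<open>G\<close>, so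
  an extensional map with the right values on classes must be \<open>ab_map\<close>.\<close>

lemma ab_map_eqI:
  assumes "f \<in> Hom Niq G H" "nil2 G" "u \<in> extensional (carrier (ab_quot G))"
    and "\<And>x. x \<in> carrier G \<Longrightarrow> u (ab_class G x) = ab_class H (f x)"
  shows "ab_map G H f = u"
proof (rule extensionalityI[OF ab_map_ext assms(3)])
  interpret q_mapping G H f using Niq_HomD(1)[OF assms(1)] .
  show "ab_map G H f \<xi> = u \<xi>" if "\<xi> \<in> carrier (ab_quot G)" for \<xi>
    using that by (auto simp: G.carrier_ab_quot ab_map_class assms(4))
qed

lemma ab_map_compose:
  assumes f: "f \<in> Hom Niq G H" and g: "g \<in> Hom Niq H K"
  shows "ab_map G K (compose (carrier G) g f) =
    compose (carrier (ab_quot G)) (ab_map H K g) (ab_map G H f)"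
proof -
  interpret f: q_mapping G H f using f by (rule Niq_HomD)
  interpret g: q_mapping H K g using g by (rule Niq_HomD)
  have "compose (carrier G) g f \<in> Hom Niq G K"
    using comp_closed[OF category_Niq, of G H K] f g f.G.nil2_axioms f.H.nil2_axioms g.H.nil2_axioms by simp
  then show ?thesis
    by (rule ab_map_eqI)
      (simp_all add: f.G.nil2_axioms compose_eq f.ab_map_class g.ab_map_class compose_extensional)
qed

lemma comm_map_compose:
  assumes f: "f \<in> Hom Niq G H"
  shows "comm_map G (compose (carrier G) g f) =
    compose (derived G (carrier G)) (comm_map H g) (comm_map G f)"
proof -
  interpret f: q_mapping G H f using f by (rule Niq_HomD)
  show ?thesis
    by (rule extensionalityI[OF comm_map_ext compose_extensional])
      (simp add: comm_map_def compose_eq)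
qed

lemma ab_map_Ident:
  assumes "nil2 G" shows "ab_map G G (\<lambda>x\<in>carrier G. x) = (\<lambda>\<xi>\<in>carrier (ab_quot G). \<xi>)"
proof -
  interpret nil2 G by fact
  show ?thesis
    by (rule ab_map_eqI) (use ident_closed[OF category_Niq, of G] assms in simp_all)
qed

lemma comm_map_Ident:
  assumes "nil2 G" shows "comm_map G (\<lambda>x\<in>carrier G. x) = (\<lambda>c\<in>derived G (carrier G). c)"
proof -
  interpret nil2 G by fact
  show ?thesis
    by (auto simp: comm_map_def intro!: restrict_ext)
qed

lemma approx_relI:
  "f \<in> Hom Niq G H \<Longrightarrow> g \<in> Hom Niq G H \<Longrightarrow> ab_map G H f = ab_map G H g \<Longrightarrow> comm_map G f = comm_map G g
    \<Longrightarrow> (f, g) \<in> approx_rel G H"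
  by (simp add: approx_rel_def)

text \<open>The relation is equality of two invariants, and the invariants of a composite are the
  composites of the invariants.\<close>

lemma approx_congruence: "congruence Niq approx_rel"
  unfolding congruence_def
proof (intro conjI ballI allI impI category_Niq)
  fix G H :: "'a monoid"
  show "equiv (Hom Niq G H) (approx_rel G H)"
    by (rule equivI) (auto simp: approx_rel_def refl_on_def sym_def trans_def)
next
  fix G H K :: "'a monoid" and f f' g g'
  assume o: "G \<in> Obj Niq" "H \<in> Obj Niq" "K \<in> Obj Niq"
    and r: "(f, f') \<in> approx_rel G H" "(g, g') \<in> approx_rel H K"
  note cl = comp_closed[OF category_Niq o]
  from r show "(Comp Niq G H K g f, Comp Niq G H K g' f') \<in> approx_rel G K"
    using cl[of f g] cl[of f' g'] by (auto simp: approx_rel_def ab_map_compose comm_map_compose)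
qed

lemmas approx_equiv = congruence_equiv[OF approx_congruence]

lemma the_elem_image_class:
  assumes "equiv A r" "f \<in> A" "\<And>g. (f, g) \<in> r \<Longrightarrow> u g = u f"
  shows "the_elem (u ` (r `` {f})) = u f"
proof -
  have "u ` (r `` {f}) = {u f}"
    using assms(3) equiv_class_self[OF assms(1,2)] by blast
  then show ?thesis by simp
qed

lemma class_ab_map_class:
  "nil2 G \<Longrightarrow> nil2 H \<Longrightarrow> f \<in> Hom Niq G H \<Longrightarrow> class_ab_map G H (approx_rel G H `` {f}) = ab_map G H f"
  unfolding class_ab_map_def
  by (rule the_elem_image_class[OF approx_equiv]) (auto simp: approx_rel_def)

lemma class_comm_map_class:
  "nil2 G \<Longrightarrow> nil2 H \<Longrightarrow> f \<in> Hom Niq G H \<Longrightarrow> class_comm_map G (approx_rel G H `` {f}) = comm_map G f"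
  unfolding class_comm_map_def
  by (rule the_elem_image_class[OF approx_equiv]) (auto simp: approx_rel_def)

section \<open>The linear extension by quadratic maps\<close>

lemma D_approx_group: "BGrp D_approx G H = quad_group (ab_quot G) (comm_sub H)"
  by (simp add: D_approx_def)

lemma quad_group_simps:
  "h \<in> carrier (quad_group A B) \<longleftrightarrow> quadratic A B h \<and> h \<in> extensional (carrier A)"
  "h \<otimes>\<^bsub>quad_group A B\<^esub> h' = (\<lambda>x\<in>carrier A. h x \<otimes>\<^bsub>B\<^esub> h' x)"
  "\<one>\<^bsub>quad_group A B\<^esub> = (\<lambda>x\<in>carrier A. \<one>\<^bsub>B\<^esub>)"
  by (simp_all add: quad_group_def)

context
  fixes G H :: "'a monoid"
  assumes GH: "nil2 G" "nil2 H"
begin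

interpretation G: nil2 G by (rule GH)
interpretation H: nil2 H by (rule GH)
interpretation A: comm_group "ab_quot G" by (rule G.comm_group_ab_quot)
interpretation H': comm_group "comm_sub H" by (rule H.comm_group_comm_sub)

private abbreviation times_H (infixl "\<cdot>" 70) where "x \<cdot> y \<equiv> x \<otimes>\<^bsub>H\<^esub> y"
private abbreviation "\<Q> \<equiv> carrier (BGrp D_approx G H)"

lemma D_approx_closed:
  "h \<in> \<Q> \<Longrightarrow> \<xi> \<in> carrier (ab_quot G) \<Longrightarrow> h \<xi> \<in> derived H (carrier H)"
  using quadraticD(1)[OF H'.is_group A.is_group] by (auto simp: D_approx_group quad_group_simps)

text \<open>A bilinear deviation vanishes at the pair of neutral elements, so the value there equals
  its own square. It is needed because commutators of \<open>G\<close> have the neutral class: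
  adding \<open>h\<close> must leave the restriction to them unchanged.\<close>

lemma D_approx_one:
  assumes h: "h \<in> \<Q>"
  shows "h \<one>\<^bsub>ab_quot G\<^esub> = \<one>\<^bsub>H\<^esub>"
proof -
  have q: "quadratic (ab_quot G) (comm_sub H) h"
    using h by (simp add: D_approx_group quad_group_simps)
  let ?d = "deviation (ab_quot G) (comm_sub H) h"
  have "?d \<one>\<^bsub>ab_quot G\<^esub> \<in> hom (ab_quot G) (comm_sub H)"
    using quadraticD(2)[OF H'.is_group A.is_group q] by (simp add: bihom_def)
  then have "?d \<one>\<^bsub>ab_quot G\<^esub> \<one>\<^bsub>ab_quot G\<^esub> = \<one>\<^bsub>H\<^esub>"
    using hom_one[OF _ A.is_group H'.is_group] by simp
  then have "h \<one>\<^bsub>ab_quot G\<^esub> = h \<one>\<^bsub>ab_quot G\<^esub> \<cdot> h \<one>\<^bsub>ab_quot G\<^esub>"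
    using quadraticD(3)[OF H'.is_group A.is_group q, of "\<one>\<^bsub>ab_quot G\<^esub>" "\<one>\<^bsub>ab_quot G\<^esub>"]
      D_approx_closed[OF h A.one_closed] by simp
  then show ?thesis
    using D_approx_closed[OF h A.one_closed] H.r_cancel_one[of "h \<one>\<^bsub>ab_quot G\<^esub>" "h \<one>\<^bsub>ab_quot G\<^esub>"] by simp
qed

lemma add_quad_closed:
  "f \<in> Hom Niq G H \<Longrightarrow> h \<in> \<Q> \<Longrightarrow> add_quad G H f h \<in> Hom Niq G H"
  unfolding add_quad_def
  by (rule Niq_restrictI, rule q_map_mult_quadratic) (simp_all add: Niq_Hom D_approx_group quad_group_simps)

text \<open>The values of \<open>h\<close> are commutators, hence invisible to
  \<open>ab_map\<close>; on commutators of \<open>G\<close> the added value is \<open>h\<close> at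
  the neutral class, hence invisible to \<open>comm_map\<close>.\<close>

lemma add_quad_approx:
  assumes f: "f \<in> Hom Niq G H" and h: "h \<in> \<Q>"
  shows "(f, add_quad G H f h) \<in> approx_rel G H"
proof -
  interpret f: q_mapping G H f using f by (rule Niq_HomD)
  note hcl = D_approx_closed[OF h]
  show ?thesis
  proof (rule approx_relI[OF f add_quad_closed[OF f h]])
    show "ab_map G H f = ab_map G H (add_quad G H f h)"
      by (rule sym, rule ab_map_eqI[OF add_quad_closed[OF f h] GH(1) ab_map_ext])
        (simp add: f.ab_map_class add_quad_def hcl)
    have "h (ab_class G c) = \<one>\<^bsub>H\<^esub>" if "c \<in> derived G (carrier G)" for c
      using D_approx_one[OF h] that G.ab_class_derived_iff[of c] by (simp add: G.one_ab_quot)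
    then show "comm_map G f = comm_map G (add_quad G H f h)"
      by (auto simp: comm_map_def add_quad_def intro!: restrict_ext)
  qed
qed

text \<open>Two q-maps with the same invariants differ by the quadratic map \<open>x \<mapsto> -f(x) + g(x)\<close>, whose
  deviation is the difference of the deviations of \<open>g\<close> and \<open>f\<close>.\<close>

lemma approx_difference:
  assumes r: "(f, g) \<in> approx_rel G H"
  shows "\<exists>h\<in>\<Q>. add_quad G H f h = g"
proof -
  have fg: "f \<in> Hom Niq G H" "g \<in> Hom Niq G H" "ab_map G H f = ab_map G H g" "comm_map G f = comm_map G g"
    using r by (auto simp: approx_rel_def)
  interpret f: q_mapping G H f using fg(1) by (rule Niq_HomD)
  interpret g: q_mapping G H g using fg(2) by (rule Niq_HomD)
  define u where "u = (\<lambda>x. inv\<^bsub>H\<^esub> (f x) \<cdot> g x)"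
  have gu: "g x = f x \<cdot> u x" if "x \<in> carrier G" for x
    using that by (simp add: u_def H.m_assoc[symmetric])
  have ucl: "u x \<in> derived H (carrier H)" if x: "x \<in> carrier G" for x
  proof -
    have "ab_class H (f x) = ab_class H (g x)"
      using x fg(3) by (metis f.ab_map_class g.ab_map_class)
    then obtain d where "d \<in> derived H (carrier H)" "g x = f x \<cdot> d"
      using x H.ab_class_eq_iff by auto
    moreover from this have "u x = d"
      using x by (simp add: u_def H.m_assoc[symmetric])
    ultimately show ?thesis by simp
  qed
  have umult: "u (x \<otimes>\<^bsub>G\<^esub> y) = u x \<cdot> u y \<cdot> (inv\<^bsub>H\<^esub> (f.dev x y) \<cdot> g.dev x y)"
    if xy: "x \<in> carrier G" "y \<in> carrier G" for x y
  proof -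
    have "f x \<cdot> f y \<cdot> (f.dev x y \<cdot> u (x \<otimes>\<^bsub>G\<^esub> y)) = g (x \<otimes>\<^bsub>G\<^esub> y)"
      using xy by (simp add: gu[of "x \<otimes>\<^bsub>G\<^esub> y"] f.f_mult ucl H.m_assoc)
    also have "\<dots> = (f x \<cdot> u x) \<cdot> (f y \<cdot> u y) \<cdot> g.dev x y"
      using xy by (simp add: g.f_mult gu[OF xy(1)] gu[OF xy(2)])
    also have "\<dots> = f x \<cdot> f y \<cdot> (u x \<cdot> u y \<cdot> g.dev x y)"
      using xy by (simp add: H.mult_central_swap ucl) (simp add: H.m_assoc ucl)
    finally have "f.dev x y \<cdot> u (x \<otimes>\<^bsub>G\<^esub> y) = u x \<cdot> u y \<cdot> g.dev x y"
      using xy by (simp add: ucl)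
    then have "u (x \<otimes>\<^bsub>G\<^esub> y) = inv\<^bsub>H\<^esub> (f.dev x y) \<cdot> (u x \<cdot> u y \<cdot> g.dev x y)"
      using xy H.inv_solve_left[of "u (x \<otimes>\<^bsub>G\<^esub> y)" "f.dev x y" "u x \<cdot> u y \<cdot> g.dev x y"] by (simp add: ucl)
    then show ?thesis
      using xy H.central_left[of "inv\<^bsub>H\<^esub> (f.dev x y)" "u x \<cdot> u y" "g.dev x y"] by (simp add: ucl H.m_assoc)
  qed
  \<comment> \<open>Equality of the maps on abelianisations has put \<open>u\<close> into the
    commutator subgroup. Equality on commutators now gives \<open>u c = \<one>\<close>, so
    \<open>u\<close> is constant on classes.\<close>
  have uclass: "u y = u x" if xy: "x \<in> carrier G" "y \<in> carrier G" "ab_class G x = ab_class G y" for x y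
  proof -
    obtain c where c: "c \<in> derived G (carrier G)" "y = x \<otimes>\<^bsub>G\<^esub> c"
      using xy G.ab_class_eq_iff by auto
    have "f c = g c"
      using fg(4) c f.comm_map_derived g.comm_map_derived by metis
    then have "u c = \<one>\<^bsub>H\<^esub>"
      using c by (simp add: u_def)
    then show ?thesis
      using c xy(1) umult[of x c] by (simp add: f.dev_derived_right g.dev_derived_right ucl)
  qed
  define h where "h = (\<lambda>\<xi>\<in>carrier (ab_quot G). u (SOME x. x \<in> carrier G \<and> ab_class G x = \<xi>))"
  have h: "h (ab_class G x) = u x" if x: "x \<in> carrier G" for x
  proof -
    have "\<exists>y. y \<in> carrier G \<and> ab_class G y = ab_class G x"
      using x by blast
    from someI_ex[OF this] show ?thesis
      using x uclass[of x "SOME y. y \<in> carrier G \<and> ab_class G y = ab_class G x"] by (simp add: h_def)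
  qed
  \<comment> \<open>Written through \<open>h\<close> alone, \<open>\<delta>\<close> is a function of
    classes without a second choice of representatives. On representatives it is the quotient of the
    deviations of \<open>g\<close> and \<open>f\<close>, from which it takes its
    bilinearity.\<close>
  define \<delta> where "\<delta> = (\<lambda>\<xi> \<eta>. h (\<xi> \<otimes>\<^bsub>ab_quot G\<^esub> \<eta>) \<cdot> inv\<^bsub>H\<^esub> (h \<xi> \<cdot> h \<eta>))"
  have \<delta>: "\<delta> (ab_class G x) (ab_class G y) = inv\<^bsub>H\<^esub> (f.dev x y) \<cdot> g.dev x y"
    if xy: "x \<in> carrier G" "y \<in> carrier G" for x y
    using xy ucl H.central[of "u x \<cdot> u y" "inv\<^bsub>H\<^esub> (f.dev x y) \<cdot> g.dev x y"]
    by (simp add: \<delta>_def h umult H.m_assoc)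
  have b: "bihom G (comm_sub H) (\<lambda>x y. inv\<^bsub>comm_sub H\<^esub> (f.dev x y) \<otimes>\<^bsub>comm_sub H\<^esub> g.dev x y)"
    by (intro bihom_prod bihom_inv H'.comm_group_axioms f.dev_bihom g.dev_bihom)
  have "bihom (ab_quot G) (comm_sub H) \<delta>"
  proof (rule bihomI)
    fix \<xi> \<eta> \<zeta> assume "\<xi> \<in> carrier (ab_quot G)" "\<eta> \<in> carrier (ab_quot G)" "\<zeta> \<in> carrier (ab_quot G)"
    then obtain x y z where "x \<in> carrier G" "y \<in> carrier G" "z \<in> carrier G"
      "\<xi> = ab_class G x" "\<eta> = ab_class G y" "\<zeta> = ab_class G z"
      by (auto simp: G.carrier_ab_quot)
    then show "\<delta> (\<xi> \<otimes>\<^bsub>ab_quot G\<^esub> \<eta>) \<zeta> = \<delta> \<xi> \<zeta> \<otimes>\<^bsub>comm_sub H\<^esub> \<delta> \<eta> \<zeta>"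
      "\<delta> \<xi> (\<eta> \<otimes>\<^bsub>ab_quot G\<^esub> \<zeta>) = \<delta> \<xi> \<eta> \<otimes>\<^bsub>comm_sub H\<^esub> \<delta> \<xi> \<zeta>"
      using bihom_mult_left[OF b, of x y z] bihom_mult_right[OF b, of x y z] by (simp_all add: \<delta>)
  qed (auto simp: G.carrier_ab_quot \<delta>)
  then have "quadratic (ab_quot G) (comm_sub H) h"
    by (rule quadraticI[OF A.is_group H'.comm_group_axioms, rotated])
      (auto simp: G.carrier_ab_quot h \<delta> ucl umult)
  then have "h \<in> \<Q>"
    by (simp add: D_approx_group quad_group_simps h_def)
  moreover have "add_quad G H f h = g"
    by (rule extensionalityI[OF _ Niq_HomD(2)[OF fg(2)]]) (simp_all add: add_quad_def h gu)
  ultimately show ?thesis by blast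
qed

lemma act_approx_action: "group_action (BGrp D_approx G H) (Hom Niq G H) (act_approx G H)"
proof (rule group_actionI)
  show "group (BGrp D_approx G H)"
    unfolding D_approx_group
    by (rule comm_group.axioms(2)[OF comm_group_quad_group[OF A.is_group H'.comm_group_axioms]])
next
  fix h f assume "h \<in> \<Q>" "f \<in> Hom Niq G H"
  then show "act_approx G H h f \<in> Hom Niq G H"
    by (simp add: act_approx_def add_quad_closed)
next
  fix f assume f: "f \<in> Hom Niq G H"
  then interpret f: q_mapping G H f by (rule Niq_HomD)
  show "act_approx G H \<one>\<^bsub>BGrp D_approx G H\<^esub> f = f"
    by (rule extensionalityI[OF _ Niq_HomD(2)[OF f]])
      (simp_all add: act_approx_def f add_quad_def D_approx_group quad_group_simps)
  fix h h' assume h: "h \<in> \<Q>" and h': "h' \<in> \<Q>"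
  have "add_quad G H f (h \<otimes>\<^bsub>BGrp D_approx G H\<^esub> h') = add_quad G H (add_quad G H f h') h"
    using H.central D_approx_closed[OF h] D_approx_closed[OF h']
    by (auto simp: add_quad_def D_approx_group quad_group_simps H.m_assoc intro!: restrict_ext)
  then show "act_approx G H (h \<otimes>\<^bsub>BGrp D_approx G H\<^esub> h') f = act_approx G H h (act_approx G H h' f)"
    using f h' by (simp add: act_approx_def add_quad_closed)
qed (simp add: act_approx_def)

lemma act_approx_free:
  assumes f: "f \<in> Hom Niq G H" and h: "h \<in> \<Q>" and eq: "act_approx G H h f = f"
  shows "h = \<one>\<^bsub>BGrp D_approx G H\<^esub>"
proof -
  interpret f: q_mapping G H f using f by (rule Niq_HomD)
  have "h (ab_class G x) = \<one>\<^bsub>H\<^esub>" if x: "x \<in> carrier G" for x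
  proof -
    have "f x \<cdot> h (ab_class G x) = f x"
      using fun_cong[OF eq, of x] x f by (simp add: act_approx_def add_quad_def)
    then show ?thesis
      using x D_approx_closed[OF h] by simp
  qed
  then show ?thesis
    using h by (intro extensionalityI[of h "carrier (ab_quot G)"])
      (auto simp: D_approx_group quad_group_simps G.carrier_ab_quot)
qed

end

lemma quadratic_restrict: "group A \<Longrightarrow> quadratic A B (restrict f (carrier A)) \<longleftrightarrow> quadratic A B f"
  by (rule quadratic_cong) simp_all

lemma approx_rep:
  "F \<in> Hom Niq_approx G H \<Longrightarrow> \<exists>f\<in>Hom Niq G H. F = approx_rel G H `` {f}"
  unfolding Niq_approx_def quotient_cat_simps by (rule quotient_hom_class[OF approx_congruence])

lemma Niq_approx_Obj [simp]: "G \<in> Obj Niq_approx \<longleftrightarrow> nil2 G"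
  by (simp add: Niq_approx_def)

lemma D_approx_map:
  assumes o: "nil2 G" "nil2 H" "nil2 G'" "nil2 H'" and f: "f \<in> Hom Niq G' G" and g: "g \<in> Hom Niq H H'"
  shows "BMap D_approx G H G' H' (approx_rel G' G `` {f}) (approx_rel H H' `` {g}) h =
    (\<lambda>\<xi>\<in>carrier (ab_quot G'). comm_map H g (h (ab_map G' G f \<xi>)))"
  using assms by (auto simp: D_approx_def class_ab_map_class class_comm_map_class compose_def)

lemma D_approx_map_closed:
  assumes o: "nil2 G" "nil2 H" "nil2 G'" "nil2 H'" and f: "f \<in> Hom Niq G' G" and g: "g \<in> Hom Niq H H'"
    and h: "h \<in> carrier (BGrp D_approx G H)"
  shows "(\<lambda>\<xi>\<in>carrier (ab_quot G'). comm_map H g (h (ab_map G' G f \<xi>))) \<in> carrier (BGrp D_approx G' H')"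
proof -
  interpret f: q_mapping G' G f using f by (rule Niq_HomD)
  interpret g: q_mapping H H' g using g by (rule Niq_HomD)
  note grp = comm_group.axioms(2)[OF f.G.comm_group_ab_quot] comm_group.axioms(2)[OF f.H.comm_group_ab_quot]
    comm_group.axioms(2)[OF g.G.comm_group_comm_sub] g.H.comm_group_comm_sub
  have "quadratic (ab_quot G') (comm_sub H') (\<lambda>\<xi>. comm_map H g (h (ab_map G' G f \<xi>)))"
    by (rule quadratic_compose[OF grp f.ab_map_hom _ g.comm_map_hom])
      (use h in \<open>simp add: D_approx_group quad_group_simps\<close>)
  then show ?thesis
    by (simp add: D_approx_group quad_group_simps quadratic_restrict grp(1))
qed

text \<open>On representatives the maps are precomposition with \<open>ab_map\<close> and
  postcomposition with \<open>comm_map\<close>, so identity and composition laws reduce to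
  functoriality of these two; additivity uses that \<open>comm_map\<close> is a
  homomorphism.\<close>

lemma bifunctor_D_approx: "bifunctor Niq_approx D_approx"
  unfolding bifunctor_def
proof (intro conjI ballI homI)
  show "category Niq_approx"
    unfolding Niq_approx_def by (rule category_quotient[OF approx_congruence])
next
  fix G H :: "'a monoid" assume "G \<in> Obj Niq_approx" "H \<in> Obj Niq_approx"
  then have o: "nil2 G" "nil2 H" by simp_all
  interpret G: nil2 G by (rule o)
  interpret H: nil2 H by (rule o)
  show "comm_group (BGrp D_approx G H)"
    unfolding D_approx_group
    by (rule comm_group_quad_group[OF comm_group.axioms(2)[OF G.comm_group_ab_quot] H.comm_group_comm_sub])
  fix h assume h: "h \<in> carrier (BGrp D_approx G H)"
  have id: "Ident Niq_approx K = approx_rel K K `` {Ident Niq K}" for K :: "'a monoid"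
    by (simp add: Niq_approx_def)
  have idH: "Ident Niq K \<in> Hom Niq K K" if "nil2 K" for K :: "'a monoid"
    using that by (intro ident_closed[OF category_Niq]) simp
  show "BMap D_approx G H G H (Ident Niq_approx G) (Ident Niq_approx H) h = h"
    unfolding id D_approx_map[OF o o idH[OF o(1)] idH[OF o(2)]]
    using h D_approx_closed[OF o h]
    by (intro extensionalityI[of _ "carrier (ab_quot G)"])
      (simp_all add: ab_map_Ident o comm_map_Ident D_approx_group quad_group_simps)
next
  fix G H G' H' :: "'a monoid" and \<Phi> \<Psi> h h'
  assume "G \<in> Obj Niq_approx" "H \<in> Obj Niq_approx" "G' \<in> Obj Niq_approx" "H' \<in> Obj Niq_approx"
    and \<Phi>: "\<Phi> \<in> Hom Niq_approx G' G" and \<Psi>: "\<Psi> \<in> Hom Niq_approx H H'"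
    and h: "h \<in> carrier (BGrp D_approx G H)"
  then have o: "nil2 G" "nil2 H" "nil2 G'" "nil2 H'" by simp_all
  obtain f where f: "f \<in> Hom Niq G' G" "\<Phi> = approx_rel G' G `` {f}" using approx_rep[OF \<Phi>] by blast
  obtain g where g: "g \<in> Hom Niq H H'" "\<Psi> = approx_rel H H' `` {g}" using approx_rep[OF \<Psi>] by blast
  interpret f: q_mapping G' G f using f(1) by (rule Niq_HomD)
  interpret g: q_mapping H H' g using g(1) by (rule Niq_HomD)
  show "BMap D_approx G H G' H' \<Phi> \<Psi> h \<in> carrier (BGrp D_approx G' H')"
    unfolding f(2) g(2) D_approx_map[OF o f(1) g(1)] by (rule D_approx_map_closed[OF o f(1) g(1) h])
  assume h': "h' \<in> carrier (BGrp D_approx G H)"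
  show "BMap D_approx G H G' H' \<Phi> \<Psi> (h \<otimes>\<^bsub>BGrp D_approx G H\<^esub> h') =
      BMap D_approx G H G' H' \<Phi> \<Psi> h \<otimes>\<^bsub>BGrp D_approx G' H'\<^esub> BMap D_approx G H G' H' \<Phi> \<Psi> h'"
    unfolding f(2) g(2) D_approx_map[OF o f(1) g(1)]
    using D_approx_closed[OF o(1,2) h] D_approx_closed[OF o(1,2) h'] hom_mult[OF g.comm_map_hom]
    by (auto simp: D_approx_group quad_group_simps hom_in_carrier[OF f.ab_map_hom] intro!: restrict_ext)
next
  fix G H G' H' G'' H'' :: "'a monoid" and \<Phi> \<Phi>' \<Psi> \<Psi>' h
  assume "G \<in> Obj Niq_approx" "H \<in> Obj Niq_approx" "G' \<in> Obj Niq_approx" "H' \<in> Obj Niq_approx"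
    "G'' \<in> Obj Niq_approx" "H'' \<in> Obj Niq_approx"
    and \<Phi>: "\<Phi> \<in> Hom Niq_approx G' G" and \<Phi>': "\<Phi>' \<in> Hom Niq_approx G'' G'"
    and \<Psi>: "\<Psi> \<in> Hom Niq_approx H H'" and \<Psi>': "\<Psi>' \<in> Hom Niq_approx H' H''"
    and h: "h \<in> carrier (BGrp D_approx G H)"
  then have o: "nil2 G" "nil2 H" "nil2 G'" "nil2 H'" "nil2 G''" "nil2 H''" by simp_all
  obtain f where f: "f \<in> Hom Niq G' G" "\<Phi> = approx_rel G' G `` {f}" using approx_rep[OF \<Phi>] by blast
  obtain f' where f': "f' \<in> Hom Niq G'' G'" "\<Phi>' = approx_rel G'' G' `` {f'}" using approx_rep[OF \<Phi>'] by blast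
  obtain g where g: "g \<in> Hom Niq H H'" "\<Psi> = approx_rel H H' `` {g}" using approx_rep[OF \<Psi>] by blast
  obtain g' where g': "g' \<in> Hom Niq H' H''" "\<Psi>' = approx_rel H' H'' `` {g'}" using approx_rep[OF \<Psi>'] by blast
  interpret f: q_mapping G' G f using f(1) by (rule Niq_HomD)
  interpret f': q_mapping G'' G' f' using f'(1) by (rule Niq_HomD)
  have cf: "Comp Niq_approx G'' G' G \<Phi> \<Phi>' = approx_rel G'' G `` {Comp Niq G'' G' G f f'}"
    "Comp Niq G'' G' G f f' \<in> Hom Niq G'' G"
    unfolding f(2) f'(2) Niq_approx_def
    using quotient_comp[OF approx_congruence _ _ _ f'(1) f(1)] comp_closed[OF category_Niq _ _ _ f'(1) f(1)] o
    by simp_all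
  have cg: "Comp Niq_approx H H' H'' \<Psi>' \<Psi> = approx_rel H H'' `` {Comp Niq H H' H'' g' g}"
    "Comp Niq H H' H'' g' g \<in> Hom Niq H H''"
    unfolding g(2) g'(2) Niq_approx_def
    using quotient_comp[OF approx_congruence _ _ _ g(1) g'(1)] comp_closed[OF category_Niq _ _ _ g(1) g'(1)] o
    by simp_all
  have L: "BMap D_approx G H G'' H'' (Comp Niq_approx G'' G' G \<Phi> \<Phi>') (Comp Niq_approx H H' H'' \<Psi>' \<Psi>) h =
      (\<lambda>\<xi>\<in>carrier (ab_quot G''). comm_map H (Comp Niq H H' H'' g' g) (h (ab_map G'' G (Comp Niq G'' G' G f f') \<xi>)))"
    unfolding cf(1) cg(1) by (rule D_approx_map[OF o(1,2,5,6) cf(2) cg(2)])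
  have R: "BMap D_approx G' H' G'' H'' \<Phi>' \<Psi>' (BMap D_approx G H G' H' \<Phi> \<Psi> h) =
      (\<lambda>\<xi>\<in>carrier (ab_quot G''). comm_map H' g' ((\<lambda>\<xi>\<in>carrier (ab_quot G'). comm_map H g (h (ab_map G' G f \<xi>))) (ab_map G'' G' f' \<xi>)))"
    unfolding f(2) g(2) f'(2) g'(2) D_approx_map[OF o(1-4) f(1) g(1)]
    by (rule D_approx_map[OF o(3-6) f'(1) g'(1)])
  show "BMap D_approx G H G'' H'' (Comp Niq_approx G'' G' G \<Phi> \<Phi>') (Comp Niq_approx H H' H'' \<Psi>' \<Psi>) h =
      BMap D_approx G' H' G'' H'' \<Phi>' \<Psi>' (BMap D_approx G H G' H' \<Phi> \<Psi> h)"
    unfolding L R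
    by (rule restrict_ext)
      (simp add: ab_map_compose[OF f'(1) f(1)] comm_map_compose[OF g(1)] compose_eq
        hom_in_carrier[OF f.ab_map_hom] hom_in_carrier[OF f'.ab_map_hom] D_approx_closed[OF o(1,2) h])
qed

text \<open>For the composition law, evaluate \<open>g\<close> corrected by \<open>a\<close> at
  \<open>f x \<otimes> b\<close>, where \<open>b\<close> abbreviates the value of the second
  correction. As that value is a commutator, \<open>g\<close> splits into
  \<open>g (f x) \<otimes> g b\<close>, and \<open>a\<close> is evaluated at the class of
  \<open>f x\<close> alone. The two terms are the pushforward of \<open>b\<close> under
  \<open>g\<close> and the pullback of \<open>a\<close> along \<open>f\<close>.\<close>

lemma linear_extension_D_approx: "linear_extension D_approx Niq Niq_approx to_approx act_approx"
  unfolding linear_extension_def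
proof (intro conjI ballI impI)
  show "bifunctor Niq_approx D_approx" by (rule bifunctor_D_approx)
  show "full_functor Niq Niq_approx to_approx"
    unfolding Niq_approx_def to_approx_def by (rule full_functor_quotient[OF approx_congruence])
  show "identity_on_objects Niq Niq_approx to_approx"
    unfolding Niq_approx_def to_approx_def by (rule identity_on_objects_quotient)
next
  fix G H :: "'a monoid" assume "G \<in> Obj Niq" "H \<in> Obj Niq"
  then have o: "nil2 G" "nil2 H" by simp_all
  show "group_action (BGrp D_approx G H) (Hom Niq G H) (act_approx G H)"
    by (rule act_approx_action[OF o])
  fix f assume f: "f \<in> Hom Niq G H"
  {
    fix h assume h: "h \<in> carrier (BGrp D_approx G H)"
    have "approx_rel G H `` {f} = approx_rel G H `` {add_quad G H f h}"
      using o by (intro equiv_class_eq[OF approx_equiv] add_quad_approx f h) simp_all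
    then show "on_hom to_approx G H (act_approx G H h f) = on_hom to_approx G H f"
      using f by (simp add: to_approx_def act_approx_def)
    show "act_approx G H h f = f \<Longrightarrow> h = \<one>\<^bsub>BGrp D_approx G H\<^esub>"
      by (rule act_approx_free[OF o f h])
  }
  fix g assume g: "g \<in> Hom Niq G H" and "on_hom to_approx G H f = on_hom to_approx G H g"
  then have "(f, g) \<in> approx_rel G H"
    using o f by (simp add: to_approx_def congruence_class_eq_iff[OF approx_congruence])
  from approx_difference[OF o this] show "\<exists>h\<in>carrier (BGrp D_approx G H). act_approx G H h f = g"
    using f by (simp add: act_approx_def)
next
  fix G H K :: "'a monoid" and g f a b
  assume "G \<in> Obj Niq" "H \<in> Obj Niq" "K \<in> Obj Niq"
    and g: "g \<in> Hom Niq H K" and f: "f \<in> Hom Niq G H"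
    and a: "a \<in> carrier (BGrp D_approx H K)" and b: "b \<in> carrier (BGrp D_approx G H)"
  then have o: "nil2 G" "nil2 H" "nil2 K" by simp_all
  interpret f: q_mapping G H f using f by (rule Niq_HomD)
  interpret g: q_mapping H K g using g by (rule Niq_HomD)
  have id: "Ident Niq_approx L = approx_rel L L `` {Ident Niq L}" for L :: "'a monoid"
    by (simp add: Niq_approx_def)
  have idH: "Ident Niq L \<in> Hom Niq L L" if "nil2 L" for L :: "'a monoid"
    using that by (intro ident_closed[OF category_Niq]) simp
  have gf: "compose (carrier G) g f \<in> Hom Niq G K"
    using comp_closed[OF category_Niq, of G H K] f g o by simp
  note acl = D_approx_closed[OF o(2,3) a] and bcl = D_approx_closed[OF o(1,2) b]
  \<comment> \<open>The identity acts trivially on the abelianisation, and on the commutator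
    \<open>b \<xi>\<close> the map \<open>comm_map H g\<close> is \<open>g\<close> itself.\<close>
  have B: "BMap D_approx G H G K (Ident Niq_approx G) (on_hom to_approx H K g) b =
      (\<lambda>\<xi>\<in>carrier (ab_quot G). g (b \<xi>))"
    unfolding id to_approx_def quotient_func_simps D_approx_map[OF o(1,2) o(1,3) idH[OF o(1)] g]
    by (rule restrict_ext) (simp add: ab_map_Ident o g.comm_map_derived bcl)
  have A: "BMap D_approx H K G K (on_hom to_approx G H f) (Ident Niq_approx K) a =
      (\<lambda>\<xi>\<in>carrier (ab_quot G). a (ab_map G H f \<xi>))"
    unfolding id to_approx_def quotient_func_simps D_approx_map[OF o(2,3) o(1,3) f idH[OF o(3)]]
    by (rule restrict_ext) (simp add: comm_map_Ident o acl hom_in_carrier[OF f.ab_map_hom])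
  show "Comp Niq G H K (act_approx H K a g) (act_approx G H b f) =
       act_approx G K (BMap D_approx G H G K (Ident Niq_approx G) (on_hom to_approx H K g) b
          \<otimes>\<^bsub>BGrp D_approx G K\<^esub> BMap D_approx H K G K (on_hom to_approx G H f) (Ident Niq_approx K) a)
        (Comp Niq G H K g f)"
    unfolding A B
    using f g gf
    by (auto simp: act_approx_def add_quad_def compose_def D_approx_group quad_group_simps
        g.f_mult_derived bcl acl f.ab_map_class g.H.m_assoc intro!: restrict_ext)
qed

section \<open>The bifunctor of bilinear maps modulo alternating ones\<close>

text \<open>The quadratic form of the bilinear map \<open>\<alpha>\<close>. It is \<open>rho\<close>
  before passing to the quotient, and thus an honest map on single homomorphisms rather than on
  cosets.\<close>

definition diag :: "'a monoid \<Rightarrow> (('a set \<times> 'a set \<Rightarrow>\<^sub>0 int) set \<Rightarrow> 'a) \<Rightarrow> 'a set \<Rightarrow> 'a" where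
  "diag G \<alpha> = (\<lambda>\<xi>\<in>carrier (ab_quot G). \<alpha> (pure_tensor (ab_quot G) (ab_quot G) \<xi> \<xi>))"

abbreviation "alt_class G H \<alpha> \<equiv> alternating G H #>\<^bsub>tensor_hom G H\<^esub> \<alpha>"

lemma hom_group_simps:
  "\<alpha> \<in> carrier (hom_group A B) \<longleftrightarrow> \<alpha> \<in> hom A B \<and> \<alpha> \<in> extensional (carrier A)"
  "\<alpha> \<otimes>\<^bsub>hom_group A B\<^esub> \<beta> = (\<lambda>x\<in>carrier A. \<alpha> x \<otimes>\<^bsub>B\<^esub> \<beta> x)"
  by (simp_all add: hom_group_def)

context
  fixes G H :: "'a monoid"
  assumes GH: "nil2 G" "nil2 H"
begin

interpretation G: nil2 G by (rule GH)
interpretation H: nil2 H by (rule GH)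
interpretation A: comm_group "ab_quot G" by (rule G.comm_group_ab_quot)
interpretation H': comm_group "comm_sub H" by (rule H.comm_group_comm_sub)

private abbreviation "\<T> \<equiv> carrier (tensor_hom G H)"
private abbreviation "\<S> \<equiv> carrier (BGrp D_sim G H)"
private abbreviation "pt \<equiv> pure_tensor (ab_quot G) (ab_quot G)"

lemma comm_group_tensor_hom: "comm_group (tensor_hom G H)"
  unfolding tensor_hom_def tensor_ab_def
  by (intro comm_group_hom_group comm_group.axioms(2) comm_group_tensor_group
      A.is_group H'.comm_group_axioms)

lemma diag_hom: "diag G \<in> hom (tensor_hom G H) (BGrp D_approx G H)"
proof (rule homI)
  fix \<alpha> assume "\<alpha> \<in> \<T>"
  then have \<alpha>: "\<alpha> \<in> hom (tensor_group (ab_quot G) (ab_quot G)) (comm_sub H)"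
    by (simp add: tensor_hom_def tensor_ab_def hom_group_simps)
  have "(\<lambda>x. x) \<in> hom (ab_quot G) (ab_quot G)"
    by (simp add: hom_def)
  from quadratic_diagonal[OF A.is_group H'.comm_group_axioms bihom_compose[OF bihom_pure_tensor[OF A.is_group] this \<alpha>]]
  show "diag G \<alpha> \<in> carrier (BGrp D_approx G H)"
    by (simp add: D_approx_group quad_group_simps diag_def quadratic_restrict)
next
  fix \<alpha> \<beta>
  show "diag G (\<alpha> \<otimes>\<^bsub>tensor_hom G H\<^esub> \<beta>) = diag G \<alpha> \<otimes>\<^bsub>BGrp D_approx G H\<^esub> diag G \<beta>"
    by (auto simp: diag_def tensor_hom_def tensor_ab_def hom_group_simps D_approx_group quad_group_simps
        pure_tensor_closed intro!: restrict_ext)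
qed

interpretation diag: group_hom "tensor_hom G H" "BGrp D_approx G H" "diag G"
  unfolding group_hom_def group_hom_axioms_def
  using diag_hom comm_group.axioms(2)[OF comm_group_tensor_hom]
    comm_group.axioms(2)[OF bifunctorD(2)[OF bifunctor_D_approx]] GH
  by simp

text \<open>Both sides ask that \<open>\<alpha>\<close> vanish on the tensor squares of all classes.
  Seeing \<open>alternating\<close> as a kernel makes it a subgroup and brings \<open>D_sim\<close>
  under the first isomorphism theorem.\<close>

lemma diag_kernel: "kernel (tensor_hom G H) (BGrp D_approx G H) (diag G) = alternating G H"
proof -
  have "diag G \<alpha> = \<one>\<^bsub>BGrp D_approx G H\<^esub> \<longleftrightarrow>
      (\<forall>x\<in>carrier G. \<alpha> (pt (ab_class G x) (ab_class G x)) = \<one>\<^bsub>H\<^esub>)" for \<alpha>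
    by (auto simp: diag_def D_approx_group quad_group_simps restrict_def fun_eq_iff G.carrier_ab_quot)
  then show ?thesis
    by (simp add: kernel_def alternating_def)
qed

lemma D_sim_group:
  "BGrp D_sim G H = tensor_hom G H Mod kernel (tensor_hom G H) (BGrp D_approx G H) (diag G)"
  unfolding diag_kernel by (simp add: D_sim_def)

lemma comm_group_D_sim: "comm_group (BGrp D_sim G H)"
  unfolding D_sim_group
  by (rule comm_group.abelian_FactGroup[OF comm_group_tensor_hom diag.subgroup_kernel])

lemma D_sim_rep:
  "X \<in> \<S> \<Longrightarrow>
    \<exists>\<alpha>\<in>\<T>. X = alt_class G H \<alpha>"
  by (auto simp: D_sim_group diag_kernel carrier_FactGroup)

lemma D_sim_class:
  "\<alpha> \<in> \<T> \<Longrightarrow> alt_class G H \<alpha> \<in> \<S>"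
  by (auto simp: D_sim_group diag_kernel carrier_FactGroup)

lemma D_sim_class_self:
  "\<alpha> \<in> \<T> \<Longrightarrow> \<alpha> \<in> alt_class G H \<alpha>"
  unfolding diag_kernel[symmetric] 
  by (rule group.rcos_self[OF comm_group.axioms(2)[OF comm_group_tensor_hom] _ diag.subgroup_kernel])

lemma D_sim_mem_class:
  assumes "\<alpha> \<in> \<T>" "\<beta> \<in> alt_class G H \<alpha>"
  shows "\<beta> \<in> \<T>" "diag G \<beta> = diag G \<alpha>"
  using assms unfolding diag_kernel[symmetric] by (auto simp: r_coset_def kernel_def)

text \<open>Members of a coset of \<open>alternating\<close> have the same diagonal, so
  \<open>the_elem\<close> is taken of a singleton at every argument.\<close>

lemma rho_class:
  assumes \<alpha>: "\<alpha> \<in> \<T>"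
  shows "rho G H (alt_class G H \<alpha>) = diag G \<alpha>"
proof -
  have "(\<lambda>\<alpha>. \<alpha> (pt \<xi> \<xi>)) ` (alt_class G H \<alpha>)
      = {diag G \<alpha> \<xi>}" if \<xi>: "\<xi> \<in> carrier (ab_quot G)" for \<xi>
  proof -
    have eq: "\<beta> (pt \<xi> \<xi>) = diag G \<alpha> \<xi>"
      if "\<beta> \<in> alt_class G H \<alpha>" for \<beta>
      using fun_cong[OF D_sim_mem_class(2)[OF \<alpha> that], of \<xi>] \<xi> by (simp add: diag_def)
    have "(\<lambda>\<alpha>. \<alpha> (pt \<xi> \<xi>)) ` (alt_class G H \<alpha>)
        = (\<lambda>_. diag G \<alpha> \<xi>) ` (alt_class G H \<alpha>)"
      by (rule image_cong[OF refl]) (rule eq)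
    also have "\<dots> = {diag G \<alpha> \<xi>}"
      by (rule image_constant[OF D_sim_class_self[OF \<alpha>]])
    finally show ?thesis .
  qed
  then show ?thesis
    by (auto simp: rho_def diag_def intro!: restrict_ext)
qed

text \<open>\<open>rho\<close> picks the common value separately at each argument, the library's
  factor homomorphism picks the common map at once. Their agreement gives access to the isomorphism
  theorem.\<close>

lemma rho_the_elem:
  assumes "X \<in> \<S>" shows "rho G H X = the_elem (diag G ` X)"
proof -
  obtain \<alpha> where \<alpha>: "\<alpha> \<in> \<T>" "X = alt_class G H \<alpha>"
    using D_sim_rep[OF assms] by blast
  have "diag G ` X = {diag G \<alpha>}"
    using D_sim_mem_class(2)[OF \<alpha>(1)] D_sim_class_self[OF \<alpha>(1)] unfolding \<alpha>(2) by blast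
  then show ?thesis
    unfolding \<alpha>(2) rho_class[OF \<alpha>(1)] by simp
qed

lemma rho_hom: "rho G H \<in> hom (BGrp D_sim G H) (BGrp D_approx G H)"
  by (rule group.hom_eq[OF comm_group.axioms(2)[OF comm_group_D_sim]
        diag.FactGroup_hom[folded D_sim_group] rho_the_elem])

lemma rho_inj: "inj_on (rho G H) (\<S>)"
  using diag.FactGroup_inj_on inj_on_cong[of "\<S>" "rho G H", OF rho_the_elem]
  by (simp add: D_sim_group)

lemma add_tensor_diag:
  "f \<in> Hom Niq G H \<Longrightarrow> add_tensor G H f \<alpha> = add_quad G H f (diag G \<alpha>)"
  by (auto simp: add_tensor_def add_quad_def diag_def intro!: restrict_ext)

text \<open>The sum of \<open>f\<close> and \<open>\<alpha>\<close> depends only on the diagonal of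
  \<open>\<alpha>\<close>, which is constant on \<open>X\<close> and equal to
  \<open>rho G H X\<close>.\<close>

lemma act_sim_eq:
  assumes "X \<in> \<S>"
  shows "act_sim G H X = act_approx G H (rho G H X)"
  unfolding act_sim_def act_approx_def
proof (rule restrict_ext)
  fix f assume f: "f \<in> Hom Niq G H"
  obtain \<alpha> where \<alpha>: "\<alpha> \<in> \<T>" "X = alt_class G H \<alpha>"
    using D_sim_rep[OF assms] by blast
  have "add_tensor G H f ` X = {add_quad G H f (diag G \<alpha>)}"
  proof -
    have "add_tensor G H f ` X = (\<lambda>_. add_quad G H f (diag G \<alpha>)) ` X"
      unfolding add_tensor_diag[OF f]
      by (rule image_cong[OF refl]) (use D_sim_mem_class(2)[OF \<alpha>(1)] \<alpha>(2) in simp)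
    also have "\<dots> = {add_quad G H f (diag G \<alpha>)}"
      unfolding \<alpha>(2) by (rule image_constant[OF D_sim_class_self[OF \<alpha>(1)]])
    finally show ?thesis .
  qed
  then show "the_elem (add_tensor G H f ` X) = add_quad G H f (rho G H X)"
    by (simp add: \<alpha> rho_class)
qed

text \<open>This is the orbit description demanded by \<open>sub_extension\<close>. The requirement
  in \<open>sim_rel\<close> that \<open>g\<close> be a morphism is automatic here, because adding a
  quadratic map to a q-map yields a q-map.\<close>

lemma sim_rel_eq:
  "sim_rel G H = {(f, g). f \<in> Hom Niq G H \<and> (\<exists>X\<in>\<S>. g = act_approx G H (rho G H X) f)}"
proof -
  have "(\<exists>X\<in>\<S>. g = act_approx G H (rho G H X) f) \<longleftrightarrow>
      g \<in> Hom Niq G H \<and> (\<exists>\<alpha>\<in>\<T>. g = add_tensor G H f \<alpha>)"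
    if f: "f \<in> Hom Niq G H" for f g
  proof -
    have "(\<exists>X\<in>\<S>. g = act_approx G H (rho G H X) f) \<longleftrightarrow>
        (\<exists>\<alpha>\<in>\<T>. g = add_quad G H f (diag G \<alpha>))"
    proof
      assume "\<exists>X\<in>\<S>. g = act_approx G H (rho G H X) f"
      then obtain X where X: "X \<in> \<S>" "g = act_approx G H (rho G H X) f" by blast
      obtain \<alpha> where \<alpha>: "\<alpha> \<in> \<T>" "X = alt_class G H \<alpha>"
        using D_sim_rep[OF X(1)] by blast
      have "g = add_quad G H f (diag G \<alpha>)"
        using X(2) f by (simp add: \<alpha>(2) rho_class[OF \<alpha>(1)] act_approx_def)
      with \<alpha>(1) show "\<exists>\<alpha>\<in>\<T>. g = add_quad G H f (diag G \<alpha>)" by blast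
    next
      assume "\<exists>\<alpha>\<in>\<T>. g = add_quad G H f (diag G \<alpha>)"
      then obtain \<alpha> where \<alpha>: "\<alpha> \<in> \<T>" "g = add_quad G H f (diag G \<alpha>)" by blast
      have "g = act_approx G H (rho G H (alt_class G H \<alpha>)) f"
        using f by (simp add: \<alpha>(2) rho_class[OF \<alpha>(1)] act_approx_def)
      with D_sim_class[OF \<alpha>(1)] show "\<exists>X\<in>\<S>. g = act_approx G H (rho G H X) f"
        by blast
    qed
    also have "\<dots> \<longleftrightarrow> g \<in> Hom Niq G H \<and> (\<exists>\<alpha>\<in>\<T>. g = add_tensor G H f \<alpha>)"
      using add_quad_closed[OF GH f] hom_in_carrier[OF diag_hom] add_tensor_diag[OF f] by auto
    finally show ?thesis .
  qed
  then show ?thesis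
    unfolding sim_rel_def by blast
qed

end

section \<open>The maps of \<open>D_sim\<close> on representatives\<close>

context
  fixes G H G' H' :: "'a monoid" and f g
  assumes nil2: "nil2 G" "nil2 H" "nil2 G'" "nil2 H'" and f: "f \<in> Hom Niq G' G" and g: "g \<in> Hom Niq H H'"
begin

interpretation f: q_mapping G' G f using f by (rule Niq_HomD)
interpretation g: q_mapping H H' g using g by (rule Niq_HomD)

definition tensor_pull where
  "tensor_pull \<alpha> = compose (carrier (tensor_ab G')) (comm_map H g)
     (compose (carrier (tensor_ab G')) \<alpha>
       (tensor_map (ab_quot G') (ab_quot G') (ab_quot G) (ab_quot G) (ab_map G' G f) (ab_map G' G f)))"

lemma ab_comm_groups:
  "group (ab_quot G)" "group (ab_quot G')" "comm_group (comm_sub H)" "comm_group (comm_sub H')"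
  by (simp_all add: comm_group.axioms(2) f.G.comm_group_ab_quot f.H.comm_group_ab_quot
      g.G.comm_group_comm_sub g.H.comm_group_comm_sub)

lemma tensor_pull_closed:
  assumes \<alpha>: "\<alpha> \<in> carrier (tensor_hom G H)"
  shows "tensor_pull \<alpha> \<in> carrier (tensor_hom G' H')"
proof -
  note t = tensor_map_hom[OF ab_comm_groups(2,2,1,1) f.ab_map_hom f.ab_map_hom]
  have \<alpha>': "\<alpha> \<in> hom (tensor_ab G) (comm_sub H)"
    using \<alpha> by (simp add: tensor_hom_def hom_group_simps)
  have T': "group (tensor_ab G')"
    unfolding tensor_ab_def by (rule comm_group.axioms(2)[OF comm_group_tensor_group[OF ab_comm_groups(2,2)]])
  have "compose (carrier (tensor_ab G')) \<alpha>
       (tensor_map (ab_quot G') (ab_quot G') (ab_quot G) (ab_quot G) (ab_map G' G f) (ab_map G' G f))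
     \<in> hom (tensor_ab G') (comm_sub H)"
    using group.hom_compose[OF T'] t \<alpha>' unfolding tensor_ab_def by blast
  then have "tensor_pull \<alpha> \<in> hom (tensor_ab G') (comm_sub H')"
    unfolding tensor_pull_def using group.hom_compose[OF T'] g.comm_map_hom by blast
  then show ?thesis
    by (simp add: tensor_hom_def hom_group_simps tensor_pull_def)
qed

text \<open>The tensor square of \<open>ab_map G' G f\<close> sends the square of
  \<open>\<xi>\<close> to the square of its image, so restriction to the diagonal turns the maps of
  \<open>D_sim\<close> into those of \<open>D_approx\<close>.\<close>

lemma diag_tensor_pull:
  "diag G' (tensor_pull \<alpha>) = (\<lambda>\<xi>\<in>carrier (ab_quot G'). comm_map H g (diag G \<alpha> (ab_map G' G f \<xi>)))"
  unfolding diag_def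
  by (rule restrict_ext)
    (simp add: tensor_pull_def compose_eq pure_tensor_closed tensor_ab_def
      tensor_map_pure[OF ab_comm_groups(2,2,1,1) f.ab_map_hom f.ab_map_hom] hom_in_carrier[OF f.ab_map_hom])

text \<open>Representatives of one class have equal diagonals, hence so do their images under
  \<open>tensor_pull\<close>. Injectivity of \<open>rho\<close> in the target then identifies the
  image classes, and the union defining the map collapses.\<close>

lemma D_sim_map:
  assumes \<alpha>: "\<alpha> \<in> carrier (tensor_hom G H)"
  shows "BMap D_sim G H G' H' (approx_rel G' G `` {f}) (approx_rel H H' `` {g})
      (alt_class G H \<alpha>) =
    alt_class G' H' (tensor_pull \<alpha>)"
proof -
  have "(\<Union>\<beta>\<in>alt_class G H \<alpha>. alt_class G' H' (tensor_pull \<beta>)) =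
      alt_class G' H' (tensor_pull \<alpha>)"
  proof (rule UN_constant_eq[OF D_sim_class_self[OF nil2(1,2) \<alpha>]], rule ballI)
    fix \<beta> assume "\<beta> \<in> alt_class G H \<alpha>"
    note \<beta> = D_sim_mem_class[OF nil2(1,2) \<alpha> this]
    have "rho G' H' (alt_class G' H' (tensor_pull \<beta>)) =
        rho G' H' (alt_class G' H' (tensor_pull \<alpha>))"
      using \<beta> \<alpha> by (simp add: rho_class[OF nil2(3,4)] tensor_pull_closed diag_tensor_pull)
    then show "alt_class G' H' (tensor_pull \<beta>) =
        alt_class G' H' (tensor_pull \<alpha>)"
      by (rule inj_onD[OF rho_inj[OF nil2(3,4)]])
        (simp_all add: D_sim_class[OF nil2(3,4)] tensor_pull_closed \<alpha> \<beta>)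
  qed
  then show ?thesis
    using nil2 f g by (simp add: D_sim_def class_ab_map_class class_comm_map_class tensor_pull_def)
qed

lemma D_sim_map_closed:
  assumes X: "X \<in> carrier (BGrp D_sim G H)"
  shows "BMap D_sim G H G' H' (approx_rel G' G `` {f}) (approx_rel H H' `` {g}) X \<in> carrier (BGrp D_sim G' H')"
proof -
  obtain \<alpha> where \<alpha>: "\<alpha> \<in> carrier (tensor_hom G H)" "X = alt_class G H \<alpha>"
    using D_sim_rep[OF nil2(1,2) X] by blast
  show ?thesis
    unfolding \<alpha>(2) D_sim_map[OF \<alpha>(1)] by (rule D_sim_class[OF nil2(3,4) tensor_pull_closed[OF \<alpha>(1)]])
qed

lemma rho_natural:
  assumes X: "X \<in> carrier (BGrp D_sim G H)"
  shows "rho G' H' (BMap D_sim G H G' H' (approx_rel G' G `` {f}) (approx_rel H H' `` {g}) X) =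
    BMap D_approx G H G' H' (approx_rel G' G `` {f}) (approx_rel H H' `` {g}) (rho G H X)"
proof -
  obtain \<alpha> where \<alpha>: "\<alpha> \<in> carrier (tensor_hom G H)" "X = alt_class G H \<alpha>"
    using D_sim_rep[OF nil2(1,2) X] by blast
  show ?thesis
    unfolding \<alpha>(2) D_sim_map[OF \<alpha>(1)] rho_class[OF nil2(3,4) tensor_pull_closed[OF \<alpha>(1)]]
      rho_class[OF nil2(1,2) \<alpha>(1)] D_approx_map[OF nil2 f g] by (rule diag_tensor_pull)
qed

end

text \<open>That \<open>D_sim\<close> is a bifunctor at all is part of the conclusion; it is
  transported from \<open>D_approx\<close> through the injective \<open>rho\<close>.\<close>

lemma natural_bifunc_rho: "natural_bifunc Niq_approx D_sim D_approx rho"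
proof (rule natural_bifunc_of_injective[OF bifunctor_D_approx])
  fix G H :: "'a monoid" assume "G \<in> Obj Niq_approx" "H \<in> Obj Niq_approx"
  then have o: "nil2 G" "nil2 H" by simp_all
  show "comm_group (BGrp D_sim G H)" by (rule comm_group_D_sim[OF o])
  show "rho G H \<in> hom (BGrp D_sim G H) (BGrp D_approx G H)" by (rule rho_hom[OF o])
  show "inj_on (rho G H) (carrier (BGrp D_sim G H))" by (rule rho_inj[OF o])
next
  fix G H G' H' :: "'a monoid" and \<Phi> \<Psi> X
  assume "G \<in> Obj Niq_approx" "H \<in> Obj Niq_approx" "G' \<in> Obj Niq_approx" "H' \<in> Obj Niq_approx"
    and \<Phi>: "\<Phi> \<in> Hom Niq_approx G' G" and \<Psi>: "\<Psi> \<in> Hom Niq_approx H H'"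
    and X: "X \<in> carrier (BGrp D_sim G H)"
  then have o: "nil2 G" "nil2 H" "nil2 G'" "nil2 H'" by simp_all
  obtain f where f: "f \<in> Hom Niq G' G" "\<Phi> = approx_rel G' G `` {f}" using approx_rep[OF \<Phi>] by blast
  obtain g where g: "g \<in> Hom Niq H H'" "\<Psi> = approx_rel H H' `` {g}" using approx_rep[OF \<Psi>] by blast
  show "BMap D_sim G H G' H' \<Phi> \<Psi> X \<in> carrier (BGrp D_sim G' H')"
    unfolding f(2) g(2) by (rule D_sim_map_closed[OF o f(1) g(1) X])
  show "rho G' H' (BMap D_sim G H G' H' \<Phi> \<Psi> X) = BMap D_approx G H G' H' \<Phi> \<Psi> (rho G H X)"
    unfolding f(2) g(2) by (rule rho_natural[OF o f(1) g(1) X])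
qed

section \<open>Assembly of the diagram of linear extensions\<close>

interpretation Niq: sub_extension Niq approx_rel D_approx act_approx D_sim rho sim_rel
proof
  show "congruence Niq approx_rel" by (rule approx_congruence)
  show "linear_extension D_approx Niq (quotient_cat Niq approx_rel) (quotient_func approx_rel) act_approx"
    using linear_extension_D_approx unfolding Niq_approx_def to_approx_def .
  show "natural_bifunc (quotient_cat Niq approx_rel) D_sim D_approx rho"
    using natural_bifunc_rho unfolding Niq_approx_def .
next
  fix G H :: "'a monoid" assume "G \<in> Obj Niq" "H \<in> Obj Niq"
  then have o: "nil2 G" "nil2 H" by simp_all
  show "inj_on (rho G H) (carrier (BGrp D_sim G H))" by (rule rho_inj[OF o])
  show "sim_rel G H = {(f, g). f \<in> Hom Niq G H \<and> (\<exists>a\<in>carrier (BGrp D_sim G H). g = act_approx G H (rho G H a) f)}"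
    by (rule sim_rel_eq[OF o])
qed

lemma act_tilde_eq:
  "act_tilde = (\<lambda>G H Y. \<lambda>F\<in>Hom Niq G H // sim_rel G H. \<Union>h\<in>Y. \<Union>f\<in>F. sim_rel G H `` {act_approx G H h f})"
  by (simp add: act_tilde_def Niq_sim_def fun_eq_iff)

lemma linear_extension_D_sim:
  "linear_extension (pullback_bifunc sim_to_approx D_sim) Niq Niq_sim to_sim act_sim"
  unfolding Niq_sim_def to_sim_def sim_to_approx_def
  by (rule Niq.linear_extension_quotient) (simp add: act_sim_eq)

lemma linear_extension_D_tilde: "linear_extension D_tilde Niq_sim Niq_approx sim_to_approx act_tilde"
  unfolding Niq_sim_def Niq_approx_def D_tilde_def sim_to_approx_def act_tilde_eq
  by (rule Niq.linear_extension_coker)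

lemma short_exact_rho: "short_exact_bifunc Niq_approx D_sim D_approx D_tilde rho rho_coker"
  unfolding D_tilde_def rho_coker_def
  by (rule short_exact_coker[OF natural_bifunc_rho rho_inj]) simp_all

lemma act_tilde_induced:
  assumes "nil2 G" "nil2 H" "f \<in> Hom Niq G H" "h \<in> carrier (BGrp D_approx G H)"
  shows "act_tilde G H (rho_coker G H h) (on_hom to_sim G H f) = on_hom to_sim G H (act_approx G H h f)"
  unfolding act_tilde_eq rho_coker_def to_sim_def quotient_func_simps
  by (rule Niq.coker_act_class) (use assms in simp_all)

lemma same_functor_Niq: "same_functor Niq to_approx (comp_func sim_to_approx to_sim)"
  unfolding to_approx_def to_sim_def sim_to_approx_def
  by (rule same_functor_induced_quotient[OF Niq.R_congruence approx_congruence Niq.R_subset])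

section \<open>The additive structure\<close>

definition plus_map :: "'a monoid \<Rightarrow> 'b monoid \<Rightarrow> ('a \<Rightarrow> 'b) \<Rightarrow> ('a \<Rightarrow> 'b) \<Rightarrow> 'a \<Rightarrow> 'b" where
  "plus_map G H f g = (\<lambda>x\<in>carrier G. f x \<otimes>\<^bsub>H\<^esub> g x)"

definition one_map :: "'a monoid \<Rightarrow> 'b monoid \<Rightarrow> 'a \<Rightarrow> 'b" where
  "one_map G H = (\<lambda>x\<in>carrier G. \<one>\<^bsub>H\<^esub>)"

definition Niq_add :: "'a monoid \<Rightarrow> 'a monoid \<Rightarrow> ('a \<Rightarrow> 'a) set monoid" where
  "Niq_add G H = \<lparr>carrier = Hom Niq_approx G H,
     monoid.mult = (\<lambda>F F'. \<Union>f\<in>F. \<Union>f'\<in>F'. approx_rel G H `` {plus_map G H f f'}),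
     one = approx_rel G H `` {one_map G H}\<rparr>"

lemma plus_map_closed: "f \<in> Hom Niq G H \<Longrightarrow> g \<in> Hom Niq G H \<Longrightarrow> plus_map G H f g \<in> Hom Niq G H"
  unfolding plus_map_def by (rule Niq_restrictI, rule q_map_mult) (simp_all add: Niq_Hom)

lemma one_map_closed:
  assumes "nil2 G" "nil2 H" shows "one_map G H \<in> Hom Niq G H"
proof -
  interpret nil2 H by fact
  show ?thesis
    unfolding one_map_def
    by (rule Niq_restrictI, rule q_map_hom[OF assms]) (simp add: hom_def)
qed

lemma ab_map_plus:
  assumes f: "f \<in> Hom Niq G H" and g: "g \<in> Hom Niq G H"
  shows "ab_map G H (plus_map G H f g) =
    (\<lambda>\<xi>\<in>carrier (ab_quot G). ab_map G H f \<xi> \<otimes>\<^bsub>ab_quot H\<^esub> ab_map G H g \<xi>)"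
proof -
  interpret f: q_mapping G H f using f by (rule Niq_HomD)
  interpret g: q_mapping G H g using g by (rule Niq_HomD)
  show ?thesis
    by (rule ab_map_eqI[OF plus_map_closed[OF f g] f.G.nil2_axioms])
      (simp_all add: f.ab_map_class g.ab_map_class plus_map_def)
qed

lemma comm_map_plus:
  assumes "f \<in> Hom Niq G H"
  shows "comm_map G (plus_map G H f g) =
    (\<lambda>c\<in>derived G (carrier G). comm_map G f c \<otimes>\<^bsub>H\<^esub> comm_map G g c)"
proof -
  interpret f: q_mapping G H f using assms by (rule Niq_HomD)
  show ?thesis
    by (auto simp: comm_map_def plus_map_def intro!: restrict_ext)
qed

text \<open>Both invariants of a pointwise product are pointwise products of the invariants, so the
  product descends to classes.\<close>

lemma plus_map_approx:
  assumes "(f, f') \<in> approx_rel G H" "(g, g') \<in> approx_rel G H"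
  shows "(plus_map G H f g, plus_map G H f' g') \<in> approx_rel G H"
  using assms by (auto simp: approx_rel_def plus_map_closed ab_map_plus comm_map_plus)

lemma Niq_add_class:
  assumes "nil2 G" "nil2 H" "f \<in> Hom Niq G H" "g \<in> Hom Niq G H"
  shows "approx_rel G H `` {f} \<otimes>\<^bsub>Niq_add G H\<^esub> approx_rel G H `` {g} =
    approx_rel G H `` {plus_map G H f g}"
proof -
  have e: "equiv (Hom Niq G H) (approx_rel G H)"
    using assms(1,2) by (intro approx_equiv) simp_all
  have "congruent2 (approx_rel G H) (approx_rel G H) (\<lambda>f f'. approx_rel G H `` {plus_map G H f f'})"
    by (rule congruent2I') (rule equiv_class_eq[OF e plus_map_approx])
  from UN_equiv_class2[OF e e this assms(3,4)] show ?thesis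
    by (simp add: Niq_add_def)
qed

lemma approx_class_eqI:
  assumes "nil2 G" "nil2 H" "f \<in> Hom Niq G H" "g \<in> Hom Niq G H"
    "ab_map G H f = ab_map G H g" "comm_map G f = comm_map G g"
  shows "approx_rel G H `` {f} = approx_rel G H `` {g}"
  using assms by (intro equiv_class_eq[OF approx_equiv] approx_relI) simp_all

lemma approx_class_closed: "f \<in> Hom Niq G H \<Longrightarrow> approx_rel G H `` {f} \<in> Hom Niq_approx G H"
  by (simp add: Niq_approx_def quotientI)

lemma Niq_approx_comp:
  "nil2 G \<Longrightarrow> nil2 H \<Longrightarrow> nil2 K \<Longrightarrow> f \<in> Hom Niq G H \<Longrightarrow> g \<in> Hom Niq H K \<Longrightarrow>
    Comp Niq_approx G H K (approx_rel H K `` {g}) (approx_rel G H `` {f}) =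
    approx_rel G K `` {compose (carrier G) g f}"
  using quotient_comp[OF approx_congruence, of G H K f g] by (simp add: Niq_approx_def)

lemma Niq_approx_Ident: "Ident Niq_approx G = approx_rel G G `` {\<lambda>x\<in>carrier G. x}"
  by (simp add: Niq_approx_def)

lemma Niq_compose_closed:
  "f \<in> Hom Niq G H \<Longrightarrow> g \<in> Hom Niq H K \<Longrightarrow> compose (carrier G) g f \<in> Hom Niq G K"
  unfolding compose_def by (rule Niq_restrictI, rule q_map_compose[of G H f K g]) (simp_all add: Niq_Hom)

text \<open>Unit, inverses and associativity are equalities of q-maps before passing to classes.
  Commutativity alone uses the quotient: on invariants it is commutativity of the abelianisation and
  of the commutator subgroup of \<open>H\<close>.\<close>

lemma comm_group_Niq_add:
  assumes o: "nil2 G" "nil2 H"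
  shows "comm_group (Niq_add G H)"
proof (rule comm_groupI)
  interpret H: nil2 H by (rule o)
  interpret A: comm_group "ab_quot H" by (rule H.comm_group_ab_quot)
  interpret H': comm_group "comm_sub H" by (rule H.comm_group_comm_sub)
  have carrier: "carrier (Niq_add G H) = Hom Niq_approx G H"
    and one: "\<one>\<^bsub>Niq_add G H\<^esub> = approx_rel G H `` {one_map G H}"
    by (simp_all add: Niq_add_def)
  show "\<one>\<^bsub>Niq_add G H\<^esub> \<in> carrier (Niq_add G H)"
    unfolding carrier one by (rule approx_class_closed[OF one_map_closed[OF o]])
  fix X assume "X \<in> carrier (Niq_add G H)"
  then obtain f where f: "f \<in> Hom Niq G H" "X = approx_rel G H `` {f}"
    unfolding carrier using approx_rep by blast
  interpret f: q_mapping G H f using f(1) by (rule Niq_HomD)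
  have "plus_map G H (one_map G H) f = f"
    by (rule Niq_eqI[OF plus_map_closed[OF one_map_closed[OF o] f(1)] f(1)])
      (simp add: plus_map_def one_map_def)
  then show "\<one>\<^bsub>Niq_add G H\<^esub> \<otimes>\<^bsub>Niq_add G H\<^esub> X = X"
    unfolding one f(2) Niq_add_class[OF o one_map_closed[OF o] f(1)] by simp
  have i: "(\<lambda>x\<in>carrier G. inv\<^bsub>H\<^esub> (f x)) \<in> Hom Niq G H"
    by (rule Niq_restrictI[OF q_map_inv[OF f.q_map]])
  have "plus_map G H (\<lambda>x\<in>carrier G. inv\<^bsub>H\<^esub> (f x)) f = one_map G H"
    by (rule Niq_eqI[OF plus_map_closed[OF i f(1)] one_map_closed[OF o]])
      (simp add: plus_map_def one_map_def)
  then show "\<exists>Y\<in>carrier (Niq_add G H). Y \<otimes>\<^bsub>Niq_add G H\<^esub> X = \<one>\<^bsub>Niq_add G H\<^esub>"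
    unfolding carrier one f(2)
    by (intro bexI[OF _ approx_class_closed[OF i]]) (simp add: Niq_add_class[OF o i f(1)])
  fix Y assume "Y \<in> carrier (Niq_add G H)"
  then obtain g where g: "g \<in> Hom Niq G H" "Y = approx_rel G H `` {g}"
    unfolding carrier using approx_rep by blast
  interpret g: q_mapping G H g using g(1) by (rule Niq_HomD)
  show "X \<otimes>\<^bsub>Niq_add G H\<^esub> Y \<in> carrier (Niq_add G H)"
    unfolding carrier f(2) g(2) Niq_add_class[OF o f(1) g(1)]
    by (rule approx_class_closed[OF plus_map_closed[OF f(1) g(1)]])
  show "X \<otimes>\<^bsub>Niq_add G H\<^esub> Y = Y \<otimes>\<^bsub>Niq_add G H\<^esub> X"
    unfolding f(2) g(2) Niq_add_class[OF o f(1) g(1)] Niq_add_class[OF o g(1) f(1)]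
  proof (rule approx_class_eqI[OF o plus_map_closed[OF f(1) g(1)] plus_map_closed[OF g(1) f(1)]])
    show "ab_map G H (plus_map G H f g) = ab_map G H (plus_map G H g f)"
      unfolding ab_map_plus[OF f(1) g(1)] ab_map_plus[OF g(1) f(1)]
      by (rule restrict_ext, rule A.m_comm)
        (simp_all add: hom_in_carrier[OF f.ab_map_hom] hom_in_carrier[OF g.ab_map_hom])
    show "comm_map G (plus_map G H f g) = comm_map G (plus_map G H g f)"
      unfolding comm_map_plus[OF f(1)] comm_map_plus[OF g(1)]
      by (rule restrict_ext, rule H.central) (simp_all add: f.comm_map_derived g.comm_map_derived)
  qed
  fix Z assume "Z \<in> carrier (Niq_add G H)"
  then obtain h where h: "h \<in> Hom Niq G H" "Z = approx_rel G H `` {h}"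
    unfolding carrier using approx_rep by blast
  interpret h: q_mapping G H h using h(1) by (rule Niq_HomD)
  have "plus_map G H (plus_map G H f g) h = plus_map G H f (plus_map G H g h)"
    by (auto simp: plus_map_def H.m_assoc intro!: restrict_ext)
  then show "X \<otimes>\<^bsub>Niq_add G H\<^esub> Y \<otimes>\<^bsub>Niq_add G H\<^esub> Z = X \<otimes>\<^bsub>Niq_add G H\<^esub> (Y \<otimes>\<^bsub>Niq_add G H\<^esub> Z)"
    unfolding f(2) g(2) h(2) Niq_add_class[OF o f(1) g(1)] Niq_add_class[OF o g(1) h(1)]
      Niq_add_class[OF o plus_map_closed[OF f(1) g(1)] h(1)]
      Niq_add_class[OF o f(1) plus_map_closed[OF g(1) h(1)]] by simp
qed

text \<open>A product of outer maps composed with \<open>f\<close> is an equality of q-maps. For an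
  outer \<open>g\<close> applied to a product of inner maps, equality holds only for the invariants,
  where \<open>ab_map\<close> and \<open>comm_map\<close> of \<open>g\<close> are
  homomorphisms.\<close>

lemma preadditive_Niq_approx: "preadditive Niq_approx Niq_add"
  unfolding preadditive_def
proof (intro conjI ballI)
  show "category Niq_approx"
    by (rule bifunctorD(1)[OF bifunctor_D_approx])
next
  fix G H :: "'a monoid" assume "G \<in> Obj Niq_approx" "H \<in> Obj Niq_approx"
  then show "comm_group (Niq_add G H)" by (simp add: comm_group_Niq_add)
  show "carrier (Niq_add G H) = Hom Niq_approx G H" by (simp add: Niq_add_def)
next
  fix G H K :: "'a monoid" and X Y Y'
  assume "G \<in> Obj Niq_approx" "H \<in> Obj Niq_approx" "K \<in> Obj Niq_approx"
  then have o: "nil2 G" "nil2 H" "nil2 K" by simp_all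
  assume "X \<in> Hom Niq_approx G H"
  then obtain f where f: "f \<in> Hom Niq G H" "X = approx_rel G H `` {f}"
    using approx_rep by blast
  assume "Y \<in> Hom Niq_approx H K"
  then obtain g where g: "g \<in> Hom Niq H K" "Y = approx_rel H K `` {g}"
    using approx_rep by blast
  assume "Y' \<in> Hom Niq_approx H K"
  then obtain g' where g': "g' \<in> Hom Niq H K" "Y' = approx_rel H K `` {g'}"
    using approx_rep by blast
  interpret f: q_mapping G H f using f(1) by (rule Niq_HomD)
  have "compose (carrier G) (plus_map H K g g') f =
      plus_map G K (compose (carrier G) g f) (compose (carrier G) g' f)"
    by (auto simp: plus_map_def compose_def intro!: restrict_ext)
  then show "Comp Niq_approx G H K (Y \<otimes>\<^bsub>Niq_add H K\<^esub> Y') X =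
      Comp Niq_approx G H K Y X \<otimes>\<^bsub>Niq_add G K\<^esub> Comp Niq_approx G H K Y' X"
    unfolding f(2) g(2) g'(2) using o f(1) g(1) g'(1)
    by (simp add: Niq_add_class Niq_approx_comp Niq_compose_closed plus_map_closed)
next
  fix G H K :: "'a monoid" and X X' Y
  assume "G \<in> Obj Niq_approx" "H \<in> Obj Niq_approx" "K \<in> Obj Niq_approx"
  then have o: "nil2 G" "nil2 H" "nil2 K" by simp_all
  assume "X \<in> Hom Niq_approx G H"
  then obtain f where f: "f \<in> Hom Niq G H" "X = approx_rel G H `` {f}"
    using approx_rep by blast
  assume "X' \<in> Hom Niq_approx G H"
  then obtain f' where f': "f' \<in> Hom Niq G H" "X' = approx_rel G H `` {f'}"
    using approx_rep by blast
  assume "Y \<in> Hom Niq_approx H K"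
  then obtain g where g: "g \<in> Hom Niq H K" "Y = approx_rel H K `` {g}"
    using approx_rep by blast
  interpret f: q_mapping G H f using f(1) by (rule Niq_HomD)
  interpret f': q_mapping G H f' using f'(1) by (rule Niq_HomD)
  interpret g: q_mapping H K g using g(1) by (rule Niq_HomD)
  note cl = Niq_compose_closed plus_map_closed
  have "approx_rel G K `` {compose (carrier G) g (plus_map G H f f')} =
      approx_rel G K `` {plus_map G K (compose (carrier G) g f) (compose (carrier G) g f')}"
  proof (rule approx_class_eqI[OF o(1,3)])
    show "compose (carrier G) g (plus_map G H f f') \<in> Hom Niq G K"
      "plus_map G K (compose (carrier G) g f) (compose (carrier G) g f') \<in> Hom Niq G K"
      using f(1) f'(1) g(1) by (auto intro: cl)
    show "ab_map G K (compose (carrier G) g (plus_map G H f f')) =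
        ab_map G K (plus_map G K (compose (carrier G) g f) (compose (carrier G) g f'))"
      unfolding ab_map_compose[OF plus_map_closed[OF f(1) f'(1)] g(1)] ab_map_plus[OF f(1) f'(1)]
        ab_map_plus[OF Niq_compose_closed[OF f(1) g(1)] Niq_compose_closed[OF f'(1) g(1)]]
        ab_map_compose[OF f(1) g(1)] ab_map_compose[OF f'(1) g(1)]
      unfolding compose_def
      by (rule restrict_ext)
        (simp add: hom_mult[OF g.ab_map_hom] hom_in_carrier[OF f.ab_map_hom] hom_in_carrier[OF f'.ab_map_hom])
    show "comm_map G (compose (carrier G) g (plus_map G H f f')) =
        comm_map G (plus_map G K (compose (carrier G) g f) (compose (carrier G) g f'))"
      by (auto simp: comm_map_def plus_map_def compose_eq g.f_mult_derived intro!: restrict_ext)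
  qed
  then show "Comp Niq_approx G H K Y (X \<otimes>\<^bsub>Niq_add G H\<^esub> X') =
      Comp Niq_approx G H K Y X \<otimes>\<^bsub>Niq_add G K\<^esub> Comp Niq_approx G H K Y X'"
    unfolding f(2) f'(2) g(2) using o f(1) f'(1) g(1)
    by (simp add: Niq_add_class Niq_approx_comp cl)
qed

text \<open>A q-map out of a one-element group is determined by preserving the neutral element, and
  a map into it has no choice. Uniqueness therefore holds already for q-maps and passes to
  classes.\<close>

lemma zero_object_Niq_approx: "\<exists>z :: 'a monoid. zero_object Niq_approx z"
proof
  \<comment> \<open>The trivial group needs one element of the type \<open>'a\<close>, and
    \<open>undefined\<close> is one that is always at hand.\<close>
  define z :: "'a monoid" where "z = \<lparr>carrier = {undefined}, monoid.mult = (\<lambda>x y. undefined), one = undefined\<rparr>"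
  have z: "group z"
    by (rule groupI) (auto simp: z_def)
  have "nil2 z"
  proof (rule nil2I[OF z])
    interpret z: group z by (rule z)
    have c: "carrier z = {undefined}" by (simp add: z_def)
    fix x y t assume "x \<in> carrier z" "y \<in> carrier z" "t \<in> carrier z"
    then have "x \<otimes>\<^bsub>z\<^esub> y \<otimes>\<^bsub>z\<^esub> inv\<^bsub>z\<^esub> x \<otimes>\<^bsub>z\<^esub> inv\<^bsub>z\<^esub> y \<otimes>\<^bsub>z\<^esub> t \<in> carrier z"
      "t \<otimes>\<^bsub>z\<^esub> (x \<otimes>\<^bsub>z\<^esub> y \<otimes>\<^bsub>z\<^esub> inv\<^bsub>z\<^esub> x \<otimes>\<^bsub>z\<^esub> inv\<^bsub>z\<^esub> y) \<in> carrier z"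
      by simp_all
    then show "x \<otimes>\<^bsub>z\<^esub> y \<otimes>\<^bsub>z\<^esub> inv\<^bsub>z\<^esub> x \<otimes>\<^bsub>z\<^esub> inv\<^bsub>z\<^esub> y \<otimes>\<^bsub>z\<^esub> t =
        t \<otimes>\<^bsub>z\<^esub> (x \<otimes>\<^bsub>z\<^esub> y \<otimes>\<^bsub>z\<^esub> inv\<^bsub>z\<^esub> x \<otimes>\<^bsub>z\<^esub> inv\<^bsub>z\<^esub> y)"
      unfolding c by simp
  qed
  have unique: "\<exists>!F. F \<in> Hom Niq_approx G H" if o: "nil2 G" "nil2 H"
    and eq: "\<And>f. f \<in> Hom Niq G H \<Longrightarrow> f = one_map G H" for G H :: "'a monoid"
  proof
    show "approx_rel G H `` {one_map G H} \<in> Hom Niq_approx G H"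
      by (rule approx_class_closed[OF one_map_closed[OF o]])
    show "F = approx_rel G H `` {one_map G H}" if "F \<in> Hom Niq_approx G H" for F
      using approx_rep[OF that] eq by blast
  qed
  show "zero_object Niq_approx z"
    unfolding zero_object_def
  proof (intro conjI ballI unique)
    show "z \<in> Obj Niq_approx" "nil2 z" "nil2 z" using \<open>nil2 z\<close> by simp_all
    fix G :: "'a monoid" assume "G \<in> Obj Niq_approx"
    then show o: "nil2 G" "nil2 G" by simp_all
    show "f = one_map z G" if f: "f \<in> Hom Niq z G" for f
    proof (rule Niq_eqI[OF f one_map_closed[OF \<open>nil2 z\<close> o(1)]])
      interpret f: q_mapping z G f using f by (rule Niq_HomD)
      fix x assume "x \<in> carrier z"
      then show "f x = one_map z G x"
        using f.f_one by (simp add: z_def one_map_def)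
    qed
    show "f = one_map G z" if f: "f \<in> Hom Niq G z" for f
    proof (rule Niq_eqI[OF f one_map_closed[OF o(1) \<open>nil2 z\<close>]])
      interpret f: q_mapping G z f using f by (rule Niq_HomD)
      fix x assume "x \<in> carrier G"
      then show "f x = one_map G z x"
        using f.f_closed[of x] by (simp add: z_def one_map_def)
    qed
  qed
qed

text \<open>Objects of \<open>Niq\<close> live on the type \<open>'a\<close>, so the product has to be transported along an injection
  \<open>e\<close> of pairs; this is the only place where the universe must be infinite.\<close>

definition coded_prod :: "('a \<times> 'a \<Rightarrow> 'a) \<Rightarrow> 'a monoid \<Rightarrow> 'a monoid \<Rightarrow> 'a monoid" where
  "coded_prod e G H =
     \<lparr>carrier = e ` (carrier G \<times> carrier H),
      monoid.mult = (\<lambda>p q. e (fst (inv_into UNIV e p) \<otimes>\<^bsub>G\<^esub> fst (inv_into UNIV e q), snd (inv_into UNIV e p) \<otimes>\<^bsub>H\<^esub> snd (inv_into UNIV e q))),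
      one = e (\<one>\<^bsub>G\<^esub>, \<one>\<^bsub>H\<^esub>)\<rparr>"

context
  fixes e :: "'a \<times> 'a \<Rightarrow> 'a" and G H :: "'a monoid"
  assumes e: "inj e" and GH: "nil2 G" "nil2 H"
begin

interpretation G: nil2 G by (rule GH)
interpretation H: nil2 H by (rule GH)

lemma coded_prod_simps:
  "carrier (coded_prod e G H) = e ` (carrier G \<times> carrier H)"
  "e (x, y) \<otimes>\<^bsub>coded_prod e G H\<^esub> e (x', y') = e (x \<otimes>\<^bsub>G\<^esub> x', y \<otimes>\<^bsub>H\<^esub> y')"
  "\<one>\<^bsub>coded_prod e G H\<^esub> = e (\<one>\<^bsub>G\<^esub>, \<one>\<^bsub>H\<^esub>)"
  using e by (simp_all add: coded_prod_def)

lemma group_coded_prod: "group (coded_prod e G H)"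
proof (rule groupI)
  fix p assume "p \<in> carrier (coded_prod e G H)"
  then obtain x y where "p = e (x, y)" "x \<in> carrier G" "y \<in> carrier H"
    by (auto simp: coded_prod_simps)
  then show "\<exists>q\<in>carrier (coded_prod e G H). q \<otimes>\<^bsub>coded_prod e G H\<^esub> p = \<one>\<^bsub>coded_prod e G H\<^esub>"
    by (intro bexI[of _ "e (inv\<^bsub>G\<^esub> x, inv\<^bsub>H\<^esub> y)"]) (auto simp: coded_prod_simps)
qed (auto simp: coded_prod_simps G.m_assoc H.m_assoc)

lemma inv_coded_prod:
  "x \<in> carrier G \<Longrightarrow> y \<in> carrier H \<Longrightarrow>
    inv\<^bsub>coded_prod e G H\<^esub> (e (x, y)) = e (inv\<^bsub>G\<^esub> x, inv\<^bsub>H\<^esub> y)"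
  by (rule group.inv_equality[OF group_coded_prod]) (auto simp: coded_prod_simps)

text \<open>Commutators in the product are formed componentwise, so their centrality is that in the
  two factors.\<close>

lemma nil2_coded_prod: "nil2 (coded_prod e G H)"
  by (rule nil2I[OF group_coded_prod])
    (auto simp: coded_prod_simps inv_coded_prod intro!: arg_cong[where f = e] G.central H.central)

text \<open>Inclusions and projections are group homomorphisms, hence q-maps, and the biproduct
  identities hold exactly between them; the last one is the decomposition of \<open>e (x, y)\<close>
  as \<open>e (x, \<one>) \<otimes> e (\<one>, y)\<close>.\<close>

lemma biproduct_Niq_approx:
  "\<exists>s in1 in2 pr1 pr2. biproduct Niq_approx Niq_add G H s in1 in2 pr1 pr2"
proof -
  let ?P = "coded_prod e G H"
  define i1 where "i1 = (\<lambda>x\<in>carrier G. e (x, \<one>\<^bsub>H\<^esub>))"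
  define i2 where "i2 = (\<lambda>y\<in>carrier H. e (\<one>\<^bsub>G\<^esub>, y))"
  define p1 where "p1 = (\<lambda>p\<in>carrier ?P. fst (inv_into UNIV e p))"
  define p2 where "p2 = (\<lambda>p\<in>carrier ?P. snd (inv_into UNIV e p))"
  note P = nil2_coded_prod
  have hom: "i1 \<in> Hom Niq G ?P" "i2 \<in> Hom Niq H ?P" "p1 \<in> Hom Niq ?P G" "p2 \<in> Hom Niq ?P H"
    unfolding i1_def i2_def p1_def p2_def
    by (intro Niq_restrictI q_map_hom GH P homI; auto simp: coded_prod_simps e)+
  have c: "compose (carrier G) p1 i1 = (\<lambda>x\<in>carrier G. x)" "compose (carrier H) p2 i2 = (\<lambda>y\<in>carrier H. y)"
    "compose (carrier H) p1 i2 = one_map H G" "compose (carrier G) p2 i1 = one_map G H"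
    "plus_map ?P ?P (compose (carrier ?P) i1 p1) (compose (carrier ?P) i2 p2) = (\<lambda>p\<in>carrier ?P. p)"
    by (auto simp: compose_def i1_def i2_def p1_def p2_def one_map_def plus_map_def coded_prod_simps e
        intro!: restrict_ext)
  have "biproduct Niq_approx Niq_add G H ?P (approx_rel G ?P `` {i1}) (approx_rel H ?P `` {i2})
      (approx_rel ?P G `` {p1}) (approx_rel ?P H `` {p2})"
    unfolding biproduct_def
    using hom GH P
    by (simp add: approx_class_closed Niq_approx_comp Niq_approx_Ident c Niq_add_class Niq_compose_closed)
      (simp add: Niq_add_def)
  then show ?thesis by blast
qed

end

lemma additive_Niq_approx:
  assumes "infinite (UNIV :: 'a set)"
  shows "additive_category (Niq_approx :: ('a monoid, ('a \<Rightarrow> 'a) set) cat)"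
proof -
  obtain e :: "'a \<times> 'a \<Rightarrow> 'a" where "bij_betw e (UNIV \<times> UNIV) UNIV"
    using Times_same_infinite_bij_betw[OF assms] by blast
  then have e: "inj e"
    by (simp add: bij_betw_def)
  show ?thesis
    unfolding additive_category_def
    using preadditive_Niq_approx zero_object_Niq_approx biproduct_Niq_approx[OF e] by auto
qed

theorem proposition6p3:
  assumes universe: "infinite (UNIV :: 'a set)"
  shows
    "short_exact_bifunc (Niq_approx :: ('a monoid, ('a \<Rightarrow> 'a) set) cat)
       D_sim D_approx D_tilde rho rho_coker
     \<and> linear_extension (pullback_bifunc sim_to_approx D_sim)
         (Niq :: ('a monoid, 'a \<Rightarrow> 'a) cat) Niq_sim to_sim act_sim
     \<and> linear_extension D_approx
         (Niq :: ('a monoid, 'a \<Rightarrow> 'a) cat) Niq_approx to_approx act_approx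
     \<and> linear_extension D_tilde
         (Niq_sim :: ('a monoid, ('a \<Rightarrow> 'a) set) cat) Niq_approx sim_to_approx act_tilde
     \<and> same_functor (Niq :: ('a monoid, 'a \<Rightarrow> 'a) cat)
         to_approx (comp_func sim_to_approx to_sim)
     \<and> (\<forall>G\<in>Obj (Niq :: ('a monoid, 'a \<Rightarrow> 'a) cat). \<forall>H\<in>Obj Niq. \<forall>f\<in>Hom Niq G H.
          \<forall>a\<in>carrier (BGrp D_sim G H). act_sim G H a f = act_approx G H (rho G H a) f)
     \<and> (\<forall>G\<in>Obj (Niq :: ('a monoid, 'a \<Rightarrow> 'a) cat). \<forall>H\<in>Obj Niq. \<forall>f\<in>Hom Niq G H.
          \<forall>h\<in>carrier (BGrp D_approx G H).
          act_tilde G H (rho_coker G H h) (on_hom to_sim G H f)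
            = on_hom to_sim G H (act_approx G H h f))
     \<and> additive_category (Niq_approx :: ('a monoid, ('a \<Rightarrow> 'a) set) cat)
     \<and> reflects_isos (Niq :: ('a monoid, 'a \<Rightarrow> 'a) cat) Niq_sim to_sim
     \<and> reflects_isos (Niq_sim :: ('a monoid, ('a \<Rightarrow> 'a) set) cat) Niq_approx sim_to_approx
     \<and> bijective_on_iso_classes (Niq :: ('a monoid, 'a \<Rightarrow> 'a) cat) Niq_sim to_sim
     \<and> bijective_on_iso_classes (Niq_sim :: ('a monoid, ('a \<Rightarrow> 'a) set) cat)
         Niq_approx sim_to_approx"
  by (intro conjI ballI short_exact_rho linear_extension_D_sim linear_extension_D_approx
      linear_extension_D_tilde same_functor_Niq additive_Niq_approx[OF universe]
      linear_extension_reflects_isos[OF linear_extension_D_sim]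
      linear_extension_reflects_isos[OF linear_extension_D_tilde]
      linear_extension_bijective[OF linear_extension_D_sim]
      linear_extension_bijective[OF linear_extension_D_tilde])
    (simp_all add: act_sim_eq act_tilde_induced)

end
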